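(* Suppose that there exist $\alpha>0$, $r(\alpha)\in(0,1)$ and $C<\infty$ such that for each $\ell\ge1$ there is an $\ell$-variate measurable function $F_\ell$ with $$E\bigl\{|F(\mathbf Z_k)-F_\ell(\tilde{\mathbf Z}_{k,\ell})|^\alpha\bigr\}\le C\,(r(\alpha))^\ell ,$$ and that, with $\delta_\ell$ defined from these $F_\ell$, $\sum_{i=0}^\infty\sup_{\ell\ge i}\delta_\ell<\infty$. (i) If $\sum|w_i|<\infty$, then, as $n\to\infty$, $$n^{-1/2}\sum_{i,j=1}^nw_{i-j}\bigl[K(X_i,X_j)-EK(X_i,X_j)\bigr]\xrightarrow{d}\mathrm N(0,\sigma^2)$$ for some $\sigma^2<\infty$. (ii) Let $\sum_{i=1}^\infty|w_i|=\infty$. If also $\liminf_{n\to\infty}W_n/\bigl(\sum_{i=0}^n|w_i|\bigr)>0$ and $\sum_{k=0}^n(n-k)w_k^2=o(nW_n^2)$, then, as $n\to\infty$, $$(nW_n^2)^{-1/2}\sum_{i,j=1}^nw_{i-j}\bigl[K(X_i,X_j)-EK(X_i,X_j)\bigr]\xrightarrow{d}\mathrm N(0,\sigma^2)$$ for some $\sigma^2<\infty$.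
   Context: Let $(\varepsilon_j)_{j\in\mathbb Z}$ be i.i.d. random elements taking values in a general state space, $\mathbf Z_k=(\ldots,\varepsilon_{k-1},\varepsilon_k)$ and, for $\ell\ge1$, $\tilde{\mathbf Z}_{k,\ell}=(\varepsilon_{k-\ell+1},\ldots,\varepsilon_k)$. $F$ is a real-valued measurable function and $X_i=F(\mathbf Z_i)$. $K:\mathbb R^2\to\mathbb R$ is a fixed symmetric measurable function and $(w_i)_{i\in\mathbb Z}$ are real constants with $w_{-i}=w_i$. For given $F_\ell$ let $\tilde X_i=\tilde X_{i,\ell}=F_\ell(\tilde{\mathbf Z}_{i,\ell})$, $$Y_{i,j}=K(X_i,X_j)-EK(X_i,X_j),\qquad \tilde Y_{i,j}=\tilde Y^{(\ell)}_{i,j}=K(\tilde X_i,\tilde X_j)-EK(\tilde X_i,\tilde X_j);$$ these are assumed to have finite variances for all $i,j,\ell$. For $\ell=0$ the convention is $\tilde Y^{(0)}_{i,j}=0$. With $\|\xi\|=(E\xi^2)^{1/2}$, $$\delta_\ell=\sup_{j\in\mathbb Z}\|Y_{1,j}-\tilde Y^{(\ell)}_{1,j}\|.$$ Also $W_n(i)=\sum_{j=1}^nw_{i-j}$ and $W_n=[\sum_{i=1}^nW_n^2(i)/n]^{1/2}$. $\xrightarrow{d}$ denotes convergence in distribution and $\mathrm N(0,\sigma^2)$ is the normal law with mean $0$ and variance $\sigma^2$ (degenerate at $0$ if $\sigma^2=0$). *)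

theory Defs
  imports "HOL-Probability.Probability" "HOL-Library.Landau_Symbols"
begin

text \<open>
  One-sided sequences are indexed backwards in time: coordinate \<open>m\<close> of \<open>past_seq eps k\<close> is
  \<open>eps (k - m)\<close>, so the infinite past lives in the product space over \<open>nat\<close> and the window of
  length \<open>l\<close> in the product space over \<open>{..<l}\<close>.
\<close>

definition past_seq :: "(int \<Rightarrow> 'a \<Rightarrow> 'b) \<Rightarrow> int \<Rightarrow> 'a \<Rightarrow> nat \<Rightarrow> 'b" where
  "past_seq eps k \<omega> = (\<lambda>m. eps (k - int m) \<omega>)"

definition past_window :: "(int \<Rightarrow> 'a \<Rightarrow> 'b) \<Rightarrow> int \<Rightarrow> nat \<Rightarrow> 'a \<Rightarrow> nat \<Rightarrow> 'b" where
  "past_window eps k l \<omega> = (\<lambda>m\<in>{..<l}. eps (k - int m) \<omega>)"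

definition iid :: "'a measure \<Rightarrow> 'b measure \<Rightarrow> ('i \<Rightarrow> 'a \<Rightarrow> 'b) \<Rightarrow> bool" where
  "iid M S eps \<longleftrightarrow> prob_space.indep_vars M (\<lambda>_. S) eps UNIV \<and>
     (\<forall>i j. distr M S (eps i) = distr M S (eps j))"

definition proc :: "((nat \<Rightarrow> 'b) \<Rightarrow> real) \<Rightarrow> (int \<Rightarrow> 'a \<Rightarrow> 'b) \<Rightarrow> int \<Rightarrow> 'a \<Rightarrow> real" where
  "proc F eps i \<omega> = F (past_seq eps i \<omega>)"

definition proc_trunc ::
    "(nat \<Rightarrow> (nat \<Rightarrow> 'b) \<Rightarrow> real) \<Rightarrow> (int \<Rightarrow> 'a \<Rightarrow> 'b) \<Rightarrow> nat \<Rightarrow> int \<Rightarrow> 'a \<Rightarrow> real" where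
  "proc_trunc Fl eps l i \<omega> = Fl l (past_window eps i l \<omega>)"

definition centred_kernel ::
    "'a measure \<Rightarrow> (real \<Rightarrow> real \<Rightarrow> real) \<Rightarrow> (int \<Rightarrow> 'a \<Rightarrow> real) \<Rightarrow> int \<Rightarrow> int \<Rightarrow> 'a \<Rightarrow> real" where
  "centred_kernel M K X i j \<omega> = K (X i \<omega>) (X j \<omega>) - (\<integral>\<omega>'. K (X i \<omega>') (X j \<omega>') \<partial>M)"

text \<open>
  Finite variance of the centred kernel variables; integrability is what makes the centring
  meaningful, since the Bochner integral of a non-integrable function is \<open>0\<close> by convention.
\<close>

definition finite_variances ::
    "'a measure \<Rightarrow> (real \<Rightarrow> real \<Rightarrow> real) \<Rightarrow> (int \<Rightarrow> 'a \<Rightarrow> real) \<Rightarrow> bool" where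
  "finite_variances M K X \<longleftrightarrow>
     (\<forall>i j. integrable M (\<lambda>\<omega>. K (X i \<omega>) (X j \<omega>)) \<and>
            integrable M (\<lambda>\<omega>. (centred_kernel M K X i j \<omega>)\<^sup>2))"

definition Y_trunc ::
    "'a measure \<Rightarrow> (real \<Rightarrow> real \<Rightarrow> real) \<Rightarrow> (nat \<Rightarrow> (nat \<Rightarrow> 'b) \<Rightarrow> real) \<Rightarrow> (int \<Rightarrow> 'a \<Rightarrow> 'b)
      \<Rightarrow> nat \<Rightarrow> int \<Rightarrow> int \<Rightarrow> 'a \<Rightarrow> real" where
  "Y_trunc M K Fl eps l i j \<omega> =
     (if l = 0 then 0 else centred_kernel M K (proc_trunc Fl eps l) i j \<omega>)"

definition L2_norm :: "'a measure \<Rightarrow> ('a \<Rightarrow> real) \<Rightarrow> real" where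
  "L2_norm M \<xi> = sqrt (\<integral>\<omega>. (\<xi> \<omega>)\<^sup>2 \<partial>M)"

text \<open>Extended-valued, because the supremum over \<open>j\<close> need not be finite a priori.\<close>

definition delta ::
    "'a measure \<Rightarrow> (real \<Rightarrow> real \<Rightarrow> real) \<Rightarrow> ((nat \<Rightarrow> 'b) \<Rightarrow> real) \<Rightarrow> (nat \<Rightarrow> (nat \<Rightarrow> 'b) \<Rightarrow> real)
      \<Rightarrow> (int \<Rightarrow> 'a \<Rightarrow> 'b) \<Rightarrow> nat \<Rightarrow> ennreal" where
  "delta M K F Fl eps l =
     (SUP j. ennreal (L2_norm M
        (\<lambda>\<omega>. centred_kernel M K (proc F eps) 1 j \<omega> - Y_trunc M K Fl eps l 1 j \<omega>)))"

definition W_at :: "(int \<Rightarrow> real) \<Rightarrow> nat \<Rightarrow> int \<Rightarrow> real" where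
  "W_at w n i = (\<Sum>j=1..int n. w (i - j))"

definition W :: "(int \<Rightarrow> real) \<Rightarrow> nat \<Rightarrow> real" where
  "W w n = sqrt ((\<Sum>i=1..int n. (W_at w n i)\<^sup>2) / real n)"

definition weighted_U_stat ::
    "'a measure \<Rightarrow> (real \<Rightarrow> real \<Rightarrow> real) \<Rightarrow> (int \<Rightarrow> real) \<Rightarrow> (int \<Rightarrow> 'a \<Rightarrow> real) \<Rightarrow> nat \<Rightarrow> 'a \<Rightarrow> real" where
  "weighted_U_stat M K w X n \<omega> =
     (\<Sum>i=1..int n. \<Sum>j=1..int n. w (i - j) * centred_kernel M K X i j \<omega>)"

text \<open>Parametrised by the variance; \<open>normal_density\<close> takes the standard deviation.\<close>

definition centred_normal :: "real \<Rightarrow> real measure" where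
  "centred_normal v =
     (if v = 0 then return borel 0 else density lborel (\<lambda>x. ennreal (normal_density 0 (sqrt v) x)))"

definition conv_in_distr :: "'a measure \<Rightarrow> (nat \<Rightarrow> 'a \<Rightarrow> real) \<Rightarrow> real measure \<Rightarrow> bool" where
  "conv_in_distr M T N \<longleftrightarrow> weak_conv_m (\<lambda>n. distr M borel (T n)) N"

end

theory Submission
  imports Defs
begin

text \<open>
  Everything rests on three observations.

  \<^item> \<^emph>\<open>Normality passes to \<open>L\<^sup>2\<close> limits.\<close>  Characteristic functions are Lipschitz in the
    \<open>L\<^sup>2\<close> norm.  If \<open>T n\<close> can be approximated in \<open>L\<^sup>2\<close>, to any accuracy and uniformly for large
    \<open>n\<close>, by sequences with centred normal limits, then the limiting variances form a Cauchy
    sequence and \<open>T n\<close> has a centred normal limit as well (\<open>asymp_normal_approx\<close>).  No variance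
    ever has to be computed.  This licence to pass to simpler sums is used at every step below.

  \<^item> \<^emph>\<open>Covariances are summable.\<close>  Let \<open>Y\<close> be the centred kernel variables, \<open>Yt l\<close> their
    truncations to windows of length \<open>l\<close>, and \<open>tail_delta m\<close> the supremum of the \<open>L\<^sup>2\<close> truncation
    errors beyond \<open>m\<close>.  If both indices of one pair have distance at least \<open>m\<close> from both indices
    of another pair, then replacing the variables by their truncations to windows of length \<open>m\<close>
    makes them independent, so
    \<open>\<bar>Cov (Y i j - Yt l i j) (Y i' j' - Yt l i' j')\<bar> \<le> 3 * tail_delta l * tail_delta m\<close>.
    Bounding \<open>tail_delta\<close> at the minimum of the four distances by the sum of its values at all four
    and summing over both pairs gives (\<open>truncation_error_sum\<close>)
    \<open>\<parallel>\<Sum>v (i - j) * (Y i j - Yt l i j)\<parallel>\<^sup>2 \<le> const * tail_delta l * V\<^sup>2 * n\<close> whenever the row sums of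
    \<open>\<bar>v\<bar>\<close> are at most \<open>V\<close>.  In both parts of the theorem \<open>V\<^sup>2 * n\<close> is of the order of the squared
    normalisation, so a large fixed \<open>l\<close> may replace the infinite past.

  \<^item> \<^emph>\<open>A central limit theorem for stationary \<open>m\<close>-dependent variables\<close> \<open>Z i\<close> with weights
    \<open>a n i = O(n powr (-1/2))\<close> that vary slowly, \<open>\<Sum>i. (a n (i + 1) - a n i)\<^sup>2 \<longlonglongrightarrow> 0\<close>, and have
    convergent energy (\<open>m_dependent_clt\<close>).  Cut \<open>{1..n}\<close> into blocks of fixed length \<open>p\<close> separated by gaps
    just long enough to make the block sums independent, and replace the weights by their
    values at the block starts.  This leaves a weighted sum of i.i.d. variables; the
    squared error is \<open>O(1/p)\<close> for large \<open>n\<close>, and \<open>p\<close> is arbitrary.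

  If \<open>\<Sum>\<bar>w i\<bar> < \<infinity>\<close>, the same covariance bound (with \<open>l = 0\<close>) shows that the weights outside a
  band \<open>\<bar>i - j\<bar> \<le> m\<close> are negligible, and inside the band the statistic is, up to boundary terms,
  a sum of the stationary window functions \<open>Z i = \<Sum>\<bar>k\<bar> \<le> m. w k * Yt l i (i + k)\<close>.

  If \<open>\<Sum>\<bar>w i\<bar> = \<infinity>\<close>, the truncated kernel is projected: off the band \<open>\<bar>i - j\<bar> < l\<close> its two arguments
  are independent, and \<open>Yt l i j\<close> equals \<open>h (X i) + h (X j)\<close> plus a degenerate remainder.  The
  projections add up to \<open>2 * (\<Sum>i. W_at w n i * h (X i))\<close>, to which the central limit theorem
  applies: the increments of \<open>W_at w n\<close> are differences of single weights, so the condition on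
  \<open>\<Sum>k. (n - k) * (w k)\<^sup>2\<close> makes the sum of their squares \<open>o(n * (W w n)\<^sup>2)\<close>.  The same condition controls the
  remainder off the band, where by degeneracy only neighbouring index pairs are correlated.  On
  the band the row sums of the weights are bounded, while \<open>W w n \<longlonglongrightarrow> \<infinity>\<close>.
\<close>

section \<open>Square-integrable random variables\<close>

definition sq_integrable :: "'a measure \<Rightarrow> ('a \<Rightarrow> real) \<Rightarrow> bool" where
  "sq_integrable M f \<longleftrightarrow> f \<in> borel_measurable M \<and> integrable M (\<lambda>\<omega>. (f \<omega>)\<^sup>2)"

lemma sq_integrable_measurable [measurable_dest]: "sq_integrable M f \<Longrightarrow> f \<in> borel_measurable M"
  by (simp add: sq_integrable_def)

lemma sq_integrable_mult:
  assumes "sq_integrable M f" "sq_integrable M g"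
  shows "integrable M (\<lambda>\<omega>. f \<omega> * g \<omega>)"
proof (rule Bochner_Integration.integrable_bound)
  show "integrable M (\<lambda>\<omega>. (f \<omega>)\<^sup>2 + (g \<omega>)\<^sup>2)"
    using assms by (auto simp: sq_integrable_def)
  show "(\<lambda>\<omega>. f \<omega> * g \<omega>) \<in> borel_measurable M"
    using assms by (auto simp: sq_integrable_def)
  have "\<bar>x * y\<bar> \<le> x\<^sup>2 + y\<^sup>2" for x y :: real
  proof -
    have "2 * (\<bar>x\<bar> * \<bar>y\<bar>) \<le> x\<^sup>2 + y\<^sup>2" using sum_squares_bound[of "\<bar>x\<bar>" "\<bar>y\<bar>"] by simp
    moreover have "0 \<le> \<bar>x\<bar> * \<bar>y\<bar>" by simp
    ultimately show ?thesis unfolding abs_mult by linarith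
  qed
  then show "AE \<omega> in M. norm (f \<omega> * g \<omega>) \<le> norm ((f \<omega>)\<^sup>2 + (g \<omega>)\<^sup>2)"
    by simp
qed

lemma sq_integrable_add:
  assumes "sq_integrable M f" "sq_integrable M g"
  shows "sq_integrable M (\<lambda>\<omega>. f \<omega> + g \<omega>)"
proof -
  have "integrable M (\<lambda>\<omega>. (f \<omega>)\<^sup>2 + (g \<omega>)\<^sup>2 + 2 * (f \<omega> * g \<omega>))"
    using assms sq_integrable_mult[OF assms] by (auto simp: sq_integrable_def)
  then show ?thesis
    using assms by (auto simp: sq_integrable_def power2_sum mult.assoc)
qed

lemma sq_integrable_cmult:
  "sq_integrable M f \<Longrightarrow> sq_integrable M (\<lambda>\<omega>. c * f \<omega>)"
  by (auto simp: sq_integrable_def power_mult_distrib)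

lemma sq_integrable_divide:
  "sq_integrable M f \<Longrightarrow> sq_integrable M (\<lambda>\<omega>. f \<omega> / c)"
  using sq_integrable_cmult[of M f "1/c"] by simp

lemma sq_integrable_diff:
  assumes "sq_integrable M f" "sq_integrable M g"
  shows "sq_integrable M (\<lambda>\<omega>. f \<omega> - g \<omega>)"
  using sq_integrable_add[OF assms(1) sq_integrable_cmult[OF assms(2), of "-1"]] by simp

lemma sq_integrable_zero: "sq_integrable M (\<lambda>_. 0)"
  by (auto simp: sq_integrable_def)

lemma sq_integrable_sum:
  "(\<And>i. i \<in> A \<Longrightarrow> sq_integrable M (f i)) \<Longrightarrow> sq_integrable M (\<lambda>\<omega>. \<Sum>i\<in>A. f i \<omega>)"
  by (induction A rule: infinite_finite_induct) (auto simp: sq_integrable_zero sq_integrable_add)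

lemmas sq_integrable_intros = sq_integrable_add sq_integrable_cmult sq_integrable_divide
  sq_integrable_diff sq_integrable_zero sq_integrable_sum

lemma L2_norm_nonneg [simp]: "0 \<le> L2_norm M f"
  by (simp add: L2_norm_def)

lemma L2_norm_zero [simp]: "L2_norm M (\<lambda>_. 0) = 0"
  by (simp add: L2_norm_def)

lemma L2_norm_power2: "(L2_norm M f)\<^sup>2 = (\<integral>\<omega>. (f \<omega>)\<^sup>2 \<partial>M)"
  by (simp add: L2_norm_def)

lemma L2_norm_cmult: "L2_norm M (\<lambda>\<omega>. c * f \<omega>) = \<bar>c\<bar> * L2_norm M f"
  by (simp add: L2_norm_def power_mult_distrib real_sqrt_mult)

lemma L2_norm_divide: "L2_norm M (\<lambda>\<omega>. f \<omega> / c) = L2_norm M f / \<bar>c\<bar>"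
  using L2_norm_cmult[of M "1/c" f] by simp

text \<open>The quadratic \<open>t \<mapsto> \<parallel>f + t g\<parallel>\<^sup>2\<close> is nonnegative.\<close>

lemma L2_norm_Cauchy_Schwarz:
  assumes f: "sq_integrable M f" and g: "sq_integrable M g"
  shows "\<bar>\<integral>\<omega>. f \<omega> * g \<omega> \<partial>M\<bar> \<le> L2_norm M f * L2_norm M g"
proof -
  define a b c where "a = (\<integral>\<omega>. (f \<omega>)\<^sup>2 \<partial>M)" and "b = (\<integral>\<omega>. f \<omega> * g \<omega> \<partial>M)"
    and "c = (\<integral>\<omega>. (g \<omega>)\<^sup>2 \<partial>M)"
  have pos: "a \<ge> 0" "c \<ge> 0" by (auto simp: a_def c_def)
  have quad: "0 \<le> x\<^sup>2 * a + 2 * x * y * b + y\<^sup>2 * c" for x y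
  proof -
    have "0 \<le> (\<integral>\<omega>. (x * f \<omega> + y * g \<omega>)\<^sup>2 \<partial>M)" by simp
    also have "(\<lambda>\<omega>. (x * f \<omega> + y * g \<omega>)\<^sup>2)
        = (\<lambda>\<omega>. x\<^sup>2 * (f \<omega>)\<^sup>2 + 2 * x * y * (f \<omega> * g \<omega>) + y\<^sup>2 * (g \<omega>)\<^sup>2)"
      by (auto simp: power2_eq_square algebra_simps)
    also have "(\<integral>\<omega>. x\<^sup>2 * (f \<omega>)\<^sup>2 + 2 * x * y * (f \<omega> * g \<omega>) + y\<^sup>2 * (g \<omega>)\<^sup>2 \<partial>M)
        = x\<^sup>2 * a + 2 * x * y * b + y\<^sup>2 * c"
      using f g sq_integrable_mult[OF f g] unfolding a_def b_def c_def sq_integrable_def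
      by (simp add: Bochner_Integration.integral_add)
    finally show ?thesis .
  qed
  have "b\<^sup>2 \<le> a * c"
  proof (cases "c = 0")
    case True
    have "b = 0"
    proof (rule ccontr)
      assume "b \<noteq> 0"
      have "0 \<le> a + 2 * (- (a + 1) / (2 * b)) * b"
        using quad[of 1 "- (a + 1) / (2 * b)"] True by simp
      then have "0 \<le> a + (- (a + 1))" using \<open>b \<noteq> 0\<close> by (simp add: field_simps)
      then show False by simp
    qed
    then show ?thesis using pos by simp
  next
    case False
    have "0 \<le> c\<^sup>2 * a + 2 * c * (-b) * b + (-b)\<^sup>2 * c" by (rule quad)
    also have "\<dots> = c * (a * c - b\<^sup>2)" by (simp add: power2_eq_square algebra_simps)
    finally show ?thesis using False pos by (simp add: zero_le_mult_iff)
  qed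
  then have "sqrt (b\<^sup>2) \<le> sqrt (a * c)" by (rule real_sqrt_le_mono)
  then show ?thesis
    by (simp add: L2_norm_def a_def b_def c_def real_sqrt_mult)
qed

lemma L2_norm_triangle:
  assumes f: "sq_integrable M f" and g: "sq_integrable M g"
  shows "L2_norm M (\<lambda>\<omega>. f \<omega> + g \<omega>) \<le> L2_norm M f + L2_norm M g"
proof (rule power2_le_imp_le)
  have "(L2_norm M (\<lambda>\<omega>. f \<omega> + g \<omega>))\<^sup>2 = (\<integral>\<omega>. (f \<omega>)\<^sup>2 + (g \<omega>)\<^sup>2 + 2 * (f \<omega> * g \<omega>) \<partial>M)"
    by (simp add: L2_norm_power2 power2_sum mult.assoc)
  also have "\<dots> = (L2_norm M f)\<^sup>2 + (L2_norm M g)\<^sup>2 + 2 * (\<integral>\<omega>. f \<omega> * g \<omega> \<partial>M)"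
    using f g sq_integrable_mult[OF f g] by (simp add: L2_norm_power2 sq_integrable_def)
  also have "\<dots> \<le> (L2_norm M f + L2_norm M g)\<^sup>2"
    using L2_norm_Cauchy_Schwarz[OF f g] by (simp add: power2_sum)
  finally show "(L2_norm M (\<lambda>\<omega>. f \<omega> + g \<omega>))\<^sup>2 \<le> (L2_norm M f + L2_norm M g)\<^sup>2" .
qed auto

lemma L2_norm_diff_le:
  assumes "sq_integrable M f" "sq_integrable M g"
  shows "L2_norm M (\<lambda>\<omega>. f \<omega> - g \<omega>) \<le> L2_norm M f + L2_norm M g"
  using L2_norm_triangle[of M f "\<lambda>\<omega>. -1 * g \<omega>"] L2_norm_cmult[of M "-1" g]
    sq_integrable_cmult[OF assms(2), of "-1"] assms(1) by simp

lemma L2_norm_sum: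
  "(\<And>i. i \<in> A \<Longrightarrow> sq_integrable M (f i)) \<Longrightarrow>
     L2_norm M (\<lambda>\<omega>. \<Sum>i\<in>A. f i \<omega>) \<le> (\<Sum>i\<in>A. L2_norm M (f i))"
proof (induction A rule: infinite_finite_induct)
  case (insert x F)
  then have "L2_norm M (\<lambda>\<omega>. \<Sum>i\<in>insert x F. f i \<omega>) \<le> L2_norm M (f x) + L2_norm M (\<lambda>\<omega>. \<Sum>i\<in>F. f i \<omega>)"
    using L2_norm_triangle[of M "f x" "\<lambda>\<omega>. \<Sum>i\<in>F. f i \<omega>"] by (simp add: sq_integrable_sum)
  also have "\<dots> \<le> (\<Sum>i\<in>insert x F. L2_norm M (f i))"
    using insert by simp
  finally show ?case .
qed auto

lemma L2_norm_sum_square_le: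
  assumes A: "finite A" and f: "\<And>p. p \<in> A \<Longrightarrow> sq_integrable M (f p)"
    and c: "\<And>p q. p \<in> A \<Longrightarrow> q \<in> A \<Longrightarrow> \<bar>\<integral>\<omega>. f p \<omega> * f q \<omega> \<partial>M\<bar> \<le> c p q"
  shows "(L2_norm M (\<lambda>\<omega>. \<Sum>p\<in>A. a p * f p \<omega>))\<^sup>2 \<le> (\<Sum>p\<in>A. \<Sum>q\<in>A. \<bar>a p\<bar> * \<bar>a q\<bar> * c p q)"
proof -
  have "(L2_norm M (\<lambda>\<omega>. \<Sum>p\<in>A. a p * f p \<omega>))\<^sup>2
      = (\<integral>\<omega>. (\<Sum>p\<in>A. \<Sum>q\<in>A. (a p * a q) * (f p \<omega> * f q \<omega>)) \<partial>M)"
    unfolding L2_norm_power2 by (simp add: power2_eq_square sum_product mult_ac)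
  also have "\<dots> = (\<Sum>p\<in>A. \<Sum>q\<in>A. (a p * a q) * (\<integral>\<omega>. f p \<omega> * f q \<omega> \<partial>M))"
    using sq_integrable_mult[OF f f] by (simp add: Bochner_Integration.integral_sum)
  also have "\<dots> \<le> (\<Sum>p\<in>A. \<Sum>q\<in>A. \<bar>a p\<bar> * \<bar>a q\<bar> * c p q)"
  proof (intro sum_mono)
    fix p q assume pq: "p \<in> A" "q \<in> A"
    have "(a p * a q) * (\<integral>\<omega>. f p \<omega> * f q \<omega> \<partial>M) \<le> \<bar>a p * a q\<bar> * \<bar>\<integral>\<omega>. f p \<omega> * f q \<omega> \<partial>M\<bar>"
      by (metis abs_ge_self abs_mult)
    also have "\<dots> \<le> \<bar>a p * a q\<bar> * c p q"
      by (intro mult_left_mono c pq) auto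
    finally show "(a p * a q) * (\<integral>\<omega>. f p \<omega> * f q \<omega> \<partial>M) \<le> \<bar>a p\<bar> * \<bar>a q\<bar> * c p q"
      by (simp add: abs_mult)
  qed
  finally show ?thesis .
qed

context prob_space
begin

lemma sq_integrable_const: "sq_integrable M (\<lambda>_. c)"
  by (auto simp: sq_integrable_def)

lemma sq_integrable_imp_integrable: "sq_integrable M f \<Longrightarrow> integrable M f"
  using sq_integrable_mult[of M f "\<lambda>_. 1"] sq_integrable_const by auto

lemma expectation_abs_le_L2_norm:
  assumes "sq_integrable M f"
  shows "expectation (\<lambda>\<omega>. \<bar>f \<omega>\<bar>) \<le> L2_norm M f"
proof -
  have "sq_integrable M (\<lambda>\<omega>. \<bar>f \<omega>\<bar>)" using assms by (auto simp: sq_integrable_def)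
  from L2_norm_Cauchy_Schwarz[OF this sq_integrable_const[of 1]]
  show ?thesis by (simp add: L2_norm_def prob_space)
qed

end

section \<open>Asymptotic normality in terms of characteristic functions\<close>

text \<open>
  Convergence to some centred normal law, possibly degenerate.  The pointwise formulation makes the
  \<open>L\<^sup>2\<close> approximation argument elementary; Levy's continuity theorem is only needed once, to return
  to weak convergence.
\<close>

definition asymp_normal :: "'a measure \<Rightarrow> (nat \<Rightarrow> 'a \<Rightarrow> real) \<Rightarrow> bool" where
  "asymp_normal M T \<longleftrightarrow>
     (\<exists>v\<ge>0. \<forall>t. (\<lambda>n. char (distr M borel (T n)) t) \<longlonglongrightarrow> complex_of_real (exp (- (v * t\<^sup>2 / 2))))"

lemma iexp_lipschitz: "cmod (iexp x - iexp y) \<le> \<bar>x - y\<bar>"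
proof -
  have "iexp x - iexp y = iexp y * (iexp (x - y) - 1)"
    by (simp add: ring_distribs exp_diff algebra_simps)
  then have "cmod (iexp x - iexp y) = cmod (iexp (x - y) - 1)"
    by (simp add: norm_mult)
  also have "\<dots> \<le> \<bar>x - y\<bar>"
    using iexp_approx1[of "x - y" 0] by simp
  finally show ?thesis .
qed

lemma (in prob_space) char_distr_diff_le:
  assumes f: "sq_integrable M f" and g: "sq_integrable M g"
  shows "cmod (char (distr M borel f) t - char (distr M borel g) t) \<le> \<bar>t\<bar> * L2_norm M (\<lambda>\<omega>. f \<omega> - g \<omega>)"
proof -
  have [measurable]: "f \<in> borel_measurable M" "g \<in> borel_measurable M"
    using f g by (auto simp: sq_integrable_def)
  have ii: "integrable M (\<lambda>\<omega>. iexp (t * h \<omega>))" if [measurable]: "h \<in> borel_measurable M" for h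
    by (intro integrable_iexp) auto
  have "char (distr M borel f) t - char (distr M borel g) t
      = (CLINT \<omega>|M. iexp (t * f \<omega>) - iexp (t * g \<omega>))"
    unfolding char_def using ii[of f] ii[of g]
    by (subst (1 2) integral_distr) (auto simp: Bochner_Integration.integral_diff)
  also have "cmod \<dots> \<le> expectation (\<lambda>\<omega>. cmod (iexp (t * f \<omega>) - iexp (t * g \<omega>)))"
    by (rule integral_norm_bound)
  also have "\<dots> \<le> expectation (\<lambda>\<omega>. \<bar>t\<bar> * \<bar>f \<omega> - g \<omega>\<bar>)"
  proof (rule integral_mono)
    show "integrable M (\<lambda>\<omega>. cmod (iexp (t * f \<omega>) - iexp (t * g \<omega>)))"
      by (intro integrable_norm Bochner_Integration.integrable_diff ii) auto
    show "integrable M (\<lambda>\<omega>. \<bar>t\<bar> * \<bar>f \<omega> - g \<omega>\<bar>)"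
      using sq_integrable_imp_integrable[OF f] sq_integrable_imp_integrable[OF g] by auto
    show "cmod (iexp (t * f \<omega>) - iexp (t * g \<omega>)) \<le> \<bar>t\<bar> * \<bar>f \<omega> - g \<omega>\<bar>" for \<omega>
      using iexp_lipschitz[of "t * f \<omega>" "t * g \<omega>"] by (simp add: abs_mult flip: right_diff_distrib)
  qed
  also have "\<dots> \<le> \<bar>t\<bar> * L2_norm M (\<lambda>\<omega>. f \<omega> - g \<omega>)"
    using expectation_abs_le_L2_norm[OF sq_integrable_diff[OF f g]] by (simp add: mult_left_mono)
  finally show ?thesis .
qed

text \<open>
  The limiting variances \<open>v k\<close> of approximating sequences of accuracy \<open>e k\<close> satisfy
  \<open>\<bar>exp (- v k * t\<^sup>2 / 2) - exp (- v l * t\<^sup>2 / 2)\<bar> \<le> \<bar>t\<bar> * (e k + e l)\<close>.  Small \<open>t\<close> shows that they are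
  bounded, and then \<open>t = 1\<close> that they converge.
\<close>

lemma (in prob_space) asymp_normal_approx:
  assumes T: "\<And>n. sq_integrable M (T n)"
    and approx: "\<And>e. e > 0 \<Longrightarrow> \<exists>T'. (\<forall>n. sq_integrable M (T' n)) \<and> asymp_normal M T' \<and>
        (\<forall>\<^sub>F n in sequentially. L2_norm M (\<lambda>\<omega>. T n \<omega> - T' n \<omega>) \<le> e)"
  shows "asymp_normal M T"
proof -
  define e where "e k = 1 / real (Suc k)" for k
  have e_pos: "e k > 0" for k by (simp add: e_def)
  have e_lim: "e \<longlonglongrightarrow> 0" unfolding e_def using LIMSEQ_inverse_real_of_nat by (simp add: inverse_eq_divide)
  have "\<forall>k. \<exists>T'. (\<forall>n. sq_integrable M (T' n)) \<and> asymp_normal M T' \<and>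
        (\<forall>\<^sub>F n in sequentially. L2_norm M (\<lambda>\<omega>. T n \<omega> - T' n \<omega>) \<le> e k)"
    using approx e_pos by blast
  then obtain T' where T': "\<And>k n. sq_integrable M (T' k n)" "\<And>k. asymp_normal M (T' k)"
      "\<And>k. \<forall>\<^sub>F n in sequentially. L2_norm M (\<lambda>\<omega>. T n \<omega> - T' k n \<omega>) \<le> e k"
    by metis
  then obtain v where v: "\<And>k. v k \<ge> 0"
      "\<And>k t. (\<lambda>n. char (distr M borel (T' k n)) t) \<longlonglongrightarrow> complex_of_real (exp (- (v k * t\<^sup>2 / 2)))"
    unfolding asymp_normal_def by metis
  let ?\<phi> = "\<lambda>n t. char (distr M borel (T n)) t" and ?\<psi> = "\<lambda>k n t. char (distr M borel (T' k n)) t"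
  have close: "\<forall>\<^sub>F n in sequentially. cmod (?\<phi> n t - ?\<psi> k n t) \<le> \<bar>t\<bar> * e k" for k t
    using T'(3)[of k]
  proof eventually_elim
    case (elim n)
    then show ?case
      using char_distr_diff_le[OF T[of n] T'(1)[of k n], of t] by (meson abs_ge_zero mult_left_mono order_trans)
  qed
  have diff: "\<bar>exp (- (v k * t\<^sup>2 / 2)) - exp (- (v l * t\<^sup>2 / 2))\<bar> \<le> \<bar>t\<bar> * (e k + e l)" for k l t
  proof -
    have "(\<lambda>n. cmod (?\<psi> k n t - ?\<psi> l n t)) \<longlonglongrightarrow>
        cmod (complex_of_real (exp (- (v k * t\<^sup>2 / 2))) - complex_of_real (exp (- (v l * t\<^sup>2 / 2))))"
      by (intro tendsto_intros v)
    moreover have "\<forall>\<^sub>F n in sequentially. cmod (?\<psi> k n t - ?\<psi> l n t) \<le> \<bar>t\<bar> * (e k + e l)"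
      using close[of t k] close[of t l]
    proof eventually_elim
      case (elim n)
      have "cmod (?\<psi> k n t - ?\<psi> l n t) \<le> cmod (?\<phi> n t - ?\<psi> l n t) + cmod (?\<phi> n t - ?\<psi> k n t)"
        using norm_triangle_ineq4[of "?\<phi> n t - ?\<psi> l n t" "?\<phi> n t - ?\<psi> k n t"] by simp
      then show ?case using elim by (simp add: algebra_simps)
    qed
    ultimately have "cmod (complex_of_real (exp (- (v k * t\<^sup>2 / 2))) - complex_of_real (exp (- (v l * t\<^sup>2 / 2)))) \<le> \<bar>t\<bar> * (e k + e l)"
      by (rule tendsto_upperbound) auto
    then show ?thesis by (metis norm_of_real of_real_diff)
  qed
  \<comment> \<open>The variances stay bounded, since the characteristic functions stay away from \<open>0\<close> near \<open>0\<close>.\<close>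
  have "((\<lambda>t::real. exp (- (v 0 * t\<^sup>2 / 2)) - 2 * t) \<longlongrightarrow> exp (- (v 0 * 0\<^sup>2 / 2)) - 2 * 0) (at_right 0)"
    by (intro tendsto_intros) auto
  then have "\<forall>\<^sub>F t in at_right (0::real). exp (- (v 0 * t\<^sup>2 / 2)) - 2 * t > 0"
    by (intro order_tendstoD(1)) auto
  moreover have "\<forall>\<^sub>F t in at_right (0::real). t > 0"
    by (rule eventually_at_right_less)
  ultimately have "\<forall>\<^sub>F t in at_right (0::real). exp (- (v 0 * t\<^sup>2 / 2)) - 2 * t > 0 \<and> t > 0"
    by (rule eventually_conj)
  then obtain t0 :: real where t0: "t0 > 0" "exp (- (v 0 * t0\<^sup>2 / 2)) - 2 * t0 > 0"
    using eventually_happens trivial_limit_at_right_real by blast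
  define \<eta> where "\<eta> = exp (- (v 0 * t0\<^sup>2 / 2)) - 2 * t0"
  have \<eta>: "\<eta> > 0" using t0 by (simp add: \<eta>_def)
  define b where "b = - 2 * ln \<eta> / t0\<^sup>2"
  have vb: "v k \<le> b" for k
  proof -
    have "e k + e 0 \<le> 2" by (simp add: e_def)
    then have "\<bar>t0\<bar> * (e k + e 0) \<le> t0 * 2" using t0 by simp
    then have "exp (- (v k * t0\<^sup>2 / 2)) \<ge> \<eta>"
      using diff[of k t0 0] unfolding \<eta>_def by linarith
    then have "ln \<eta> \<le> - (v k * t0\<^sup>2 / 2)"
      using \<eta> by (metis exp_gt_zero ln_exp ln_le_cancel_iff)
    then show ?thesis using t0 by (simp add: b_def field_simps)
  qed
  have "Cauchy (\<lambda>k. exp (- (v k / 2)))"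
  proof (rule metric_CauchyI)
    fix \<epsilon> :: real assume "\<epsilon> > 0"
    then have "\<forall>\<^sub>F k in sequentially. e k < \<epsilon> / 2" using e_lim by (intro order_tendstoD(2)[of e 0]) auto
    then obtain N where N: "\<And>k. k \<ge> N \<Longrightarrow> e k < \<epsilon> / 2" by (auto simp: eventually_sequentially)
    show "\<exists>N. \<forall>m\<ge>N. \<forall>n\<ge>N. dist (exp (- (v m / 2))) (exp (- (v n / 2))) < \<epsilon>"
    proof (intro exI allI impI)
      fix m n assume "m \<ge> N" "n \<ge> N"
      then show "dist (exp (- (v m / 2))) (exp (- (v n / 2))) < \<epsilon>"
        using diff[of m 1 n] N[of m] N[of n] by (simp add: dist_real_def)
    qed
  qed
  then obtain c where c: "(\<lambda>k. exp (- (v k / 2))) \<longlonglongrightarrow> c"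
    using Cauchy_convergent_iff convergent_def by blast
  have "c \<ge> exp (- (b / 2))"
    by (rule tendsto_lowerbound[OF c]) (use vb in auto)
  then have c0: "c > 0" by (meson exp_gt_zero less_le_trans)
  have c1: "c \<le> 1"
    by (rule tendsto_upperbound[OF c]) (use v(1) in auto)
  define u where "u = - 2 * ln c"
  have u0: "u \<ge> 0" using c0 c1 by (simp add: u_def)
  have "(\<lambda>k. - 2 * ln (exp (- (v k / 2)))) \<longlonglongrightarrow> - 2 * ln c"
    using c c0 by (intro tendsto_intros) auto
  then have vu: "v \<longlonglongrightarrow> u" by (simp add: u_def)
  have "(\<lambda>n. ?\<phi> n t) \<longlonglongrightarrow> complex_of_real (exp (- (u * t\<^sup>2 / 2)))" for t
  proof (rule tendstoI)
    fix \<epsilon> :: real assume \<epsilon>: "\<epsilon> > 0"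
    have "(\<lambda>k. \<bar>t\<bar> * e k + \<bar>exp (- (v k * t\<^sup>2 / 2)) - exp (- (u * t\<^sup>2 / 2))\<bar>) \<longlonglongrightarrow>
       \<bar>t\<bar> * 0 + \<bar>exp (- (u * t\<^sup>2 / 2)) - exp (- (u * t\<^sup>2 / 2))\<bar>"
      by (intro tendsto_intros vu e_lim) auto
    then have "\<forall>\<^sub>F k in sequentially. \<bar>t\<bar> * e k + \<bar>exp (- (v k * t\<^sup>2 / 2)) - exp (- (u * t\<^sup>2 / 2))\<bar> < \<epsilon> / 2"
      by (rule order_tendstoD) (use \<epsilon> in auto)
    then obtain k where k: "\<bar>t\<bar> * e k + \<bar>exp (- (v k * t\<^sup>2 / 2)) - exp (- (u * t\<^sup>2 / 2))\<bar> < \<epsilon> / 2"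
      by (auto simp: eventually_sequentially)
    have "\<forall>\<^sub>F n in sequentially. dist (?\<psi> k n t) (complex_of_real (exp (- (v k * t\<^sup>2 / 2)))) < \<epsilon> / 2"
      using v(2)[of k t] \<epsilon> by (auto dest!: tendstoD[where e="\<epsilon>/2"])
    then show "\<forall>\<^sub>F n in sequentially. dist (?\<phi> n t) (complex_of_real (exp (- (u * t\<^sup>2 / 2)))) < \<epsilon>"
      using close[of t k]
    proof eventually_elim
      case (elim n)
      have "dist (complex_of_real (exp (- (v k * t\<^sup>2 / 2)))) (complex_of_real (exp (- (u * t\<^sup>2 / 2))))
         = \<bar>exp (- (v k * t\<^sup>2 / 2)) - exp (- (u * t\<^sup>2 / 2))\<bar>"
        by (metis dist_norm norm_of_real of_real_diff)
      moreover have "dist (?\<phi> n t) (?\<psi> k n t) \<le> \<bar>t\<bar> * e k" using elim by (simp add: dist_norm)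
      ultimately show ?case
        using k elim(1) dist_triangle[of "?\<phi> n t" "complex_of_real (exp (- (u * t\<^sup>2 / 2)))" "?\<psi> k n t"]
         dist_triangle[of "?\<psi> k n t" "complex_of_real (exp (- (u * t\<^sup>2 / 2)))" "complex_of_real (exp (- (v k * t\<^sup>2 / 2)))"]
        by linarith
    qed
  qed
  then show ?thesis using u0 by (auto simp: asymp_normal_def)
qed

text \<open>
  For positive variance the law is the image of the standard normal law under scaling.
\<close>

lemma char_centred_normal:
  assumes "v \<ge> 0"
  shows "char (centred_normal v) t = complex_of_real (exp (- (v * t\<^sup>2 / 2)))"
    and "real_distribution (centred_normal v)"
proof -
  have "char (centred_normal v) t = complex_of_real (exp (- (v * t\<^sup>2 / 2))) \<and> real_distribution (centred_normal v)"
  proof (cases "v = 0")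
    case True
    have *: "centred_normal v = return borel 0" using True by (simp add: centred_normal_def)
    have "real_distribution (return borel (0::real))"
      unfolding real_distribution_def real_distribution_axioms_def
      by (auto intro: prob_space_return)
    moreover have "char (return borel 0) t = 1"
      by (simp add: char_def integral_return)
    ultimately show ?thesis using True * by simp
  next
    case False
    define s where "s = sqrt v"
    have s: "s > 0" "s\<^sup>2 = v" using False assms by (auto simp: s_def)
    have eq: "centred_normal v = density lborel (\<lambda>x. ennreal (normal_density 0 s x))"
      using False by (simp add: centred_normal_def s_def)
    interpret N: prob_space std_normal_distribution by (rule prob_space_normal_density) auto
    have "distributed std_normal_distribution lborel (\<lambda>x. x) (\<lambda>x. ennreal (normal_density 0 1 x))"
      unfolding distributed_def by (auto simp: distr_id2)
    from N.normal_density_affine[OF this, of s 0] s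
    have "distributed std_normal_distribution lborel (\<lambda>x. s * x) (\<lambda>x. ennreal (normal_density 0 s x))"
      by simp
    then have dst: "distr std_normal_distribution borel (\<lambda>x. s * x) = centred_normal v"
      unfolding distributed_def eq by (metis distr_cong sets_lborel)
    have "char (centred_normal v) t = (CLINT x|std_normal_distribution. iexp ((t * s) * x))"
      unfolding dst[symmetric] char_def by (subst integral_distr) (auto simp: mult_ac)
    also have "\<dots> = char std_normal_distribution (t * s)" by (simp add: char_def)
    also have "\<dots> = complex_of_real (exp (- (v * t\<^sup>2 / 2)))"
      unfolding char_std_normal_distribution using s(2) by (simp add: power_mult_distrib mult_ac)
    finally show ?thesis
      unfolding dst[symmetric] by (auto intro!: N.real_distribution_distr)
  qed
  then show "char (centred_normal v) t = complex_of_real (exp (- (v * t\<^sup>2 / 2)))"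
    "real_distribution (centred_normal v)" by auto
qed

lemma (in prob_space) asymp_normal_imp_conv_in_distr:
  assumes T: "\<And>n. T n \<in> borel_measurable M" and "asymp_normal M T"
  shows "\<exists>v\<ge>0. conv_in_distr M T (centred_normal v)"
proof -
  obtain v where v: "v \<ge> 0"
    "\<And>t. (\<lambda>n. char (distr M borel (T n)) t) \<longlonglongrightarrow> complex_of_real (exp (- (v * t\<^sup>2 / 2)))"
    using assms(2) by (auto simp: asymp_normal_def)
  have "weak_conv_m (\<lambda>n. distr M borel (T n)) (centred_normal v)"
  proof (rule levy_continuity)
    show "real_distribution (distr M borel (T n))" for n by (rule real_distribution_distr) (rule T)
    show "real_distribution (centred_normal v)" by (rule char_centred_normal[OF v(1)])
    show "(\<lambda>n. char (distr M borel (T n)) t) \<longlonglongrightarrow> char (centred_normal v) t" for t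
      unfolding char_centred_normal(1)[OF v(1)] by (rule v)
  qed
  then show ?thesis using v(1) by (auto simp: conv_in_distr_def)
qed

section \<open>Weighted sums of i.i.d. variables\<close>

text \<open>
  The second-order Taylor expansion of the characteristic function, with the remainder made uniform
  near \<open>0\<close> by dominated convergence.  This is what replaces Lindeberg's condition below.
\<close>

lemma (in real_distribution) char_minus_gaussian_small:
  assumes int2: "integrable M (\<lambda>x. x\<^sup>2)" and mean: "expectation (\<lambda>x. x) = 0"
    and v: "v = expectation (\<lambda>x. x\<^sup>2)" and \<epsilon>: "\<epsilon> > 0"
  shows "\<exists>\<delta>>0. \<forall>s. \<bar>s\<bar> \<le> \<delta> \<longrightarrow>
           cmod (char M s - complex_of_real (exp (- (v * s\<^sup>2 / 2)))) \<le> \<epsilon> * s\<^sup>2"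
proof -
  have sq: "sq_integrable M (\<lambda>x. x)" using int2 by (auto simp: sq_integrable_def)
  have int1: "integrable M (\<lambda>x. x)" by (rule sq_integrable_imp_integrable[OF sq])
  have v0: "v \<ge> 0" by (simp add: v)
  have var: "variance (\<lambda>x. x) = v" by (simp add: mean v)
  let ?m = "\<lambda>s. expectation (\<lambda>x. min (6 * x\<^sup>2) (\<bar>s\<bar> * \<bar>x\<bar> ^ 3))"
  have lim: "(?m \<longlongrightarrow> 0) (at 0)"
  proof -
    have "((\<lambda>s. expectation (\<lambda>x. min (6 * x\<^sup>2) (\<bar>s\<bar> * \<bar>x\<bar> ^ 3))) \<longlongrightarrow> expectation (\<lambda>x. 0)) (at 0)"
      unfolding tendsto_at_iff_sequentially comp_def
    proof (intro allI impI)
      fix X :: "nat \<Rightarrow> real" assume X: "\<forall>i. X i \<in> UNIV - {0}" "X \<longlonglongrightarrow> 0"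
      show "(\<lambda>n. expectation (\<lambda>x. min (6 * x\<^sup>2) (\<bar>X n\<bar> * \<bar>x\<bar> ^ 3))) \<longlonglongrightarrow> expectation (\<lambda>x. 0)"
      proof (rule integral_dominated_convergence[where w = "\<lambda>x. 6 * x\<^sup>2"])
        show "AE x in M. (\<lambda>n. min (6 * x\<^sup>2) (\<bar>X n\<bar> * \<bar>x\<bar> ^ 3)) \<longlonglongrightarrow> 0"
        proof (rule AE_I2)
          fix x
          have "(\<lambda>n. min (6 * x\<^sup>2) (\<bar>X n\<bar> * \<bar>x\<bar> ^ 3)) \<longlonglongrightarrow> min (6 * x\<^sup>2) (\<bar>0\<bar> * \<bar>x\<bar> ^ 3)"
            by (intro tendsto_intros X)
          then show "(\<lambda>n. min (6 * x\<^sup>2) (\<bar>X n\<bar> * \<bar>x\<bar> ^ 3)) \<longlonglongrightarrow> 0" by simp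
        qed
      qed (use int2 in auto)
    qed
    then show ?thesis by simp
  qed
  have lim2: "((\<lambda>s. ?m s / 6 + v\<^sup>2 * s\<^sup>2 / 8) \<longlongrightarrow> 0 / 6 + v\<^sup>2 * 0\<^sup>2 / 8) (at 0)"
    by (intro tendsto_intros lim) auto
  then have "\<forall>\<^sub>F s in at 0. ?m s / 6 + v\<^sup>2 * s\<^sup>2 / 8 < \<epsilon>"
    by (rule order_tendstoD) (use \<epsilon> in auto)
  then obtain d where d: "d > 0" "\<And>s. s \<noteq> 0 \<Longrightarrow> \<bar>s\<bar> < d \<Longrightarrow> ?m s / 6 + v\<^sup>2 * s\<^sup>2 / 8 < \<epsilon>"
    unfolding eventually_at by (auto simp: dist_real_def)
  have main: "cmod (char M s - complex_of_real (exp (- (v * s\<^sup>2 / 2)))) \<le> \<epsilon> * s\<^sup>2" if s: "\<bar>s\<bar> \<le> d / 2" for s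
  proof (cases "s = 0")
    case True then show ?thesis by (simp add: char_zero)
  next
    case False
    define y where "y = v * s\<^sup>2 / 2"
    have y0: "y \<ge> 0" using v0 by (simp add: y_def)
    have 1: "cmod (char M s - complex_of_real (1 - y)) \<le> (s\<^sup>2 / 6) * ?m s"
      using char_approx3[OF int1 mean int2 var, of s] by (simp add: y_def mult.commute)
    have 2: "\<bar>(1 - y) - exp (- y)\<bar> \<le> y\<^sup>2 / 2"
    proof -
      have "exp (-y) \<ge> 1 - y" using exp_ge_add_one_self[of "-y"] by simp
      moreover have "exp (-y) \<le> 1 - y + y\<^sup>2 / 2"
      proof -
        have "1 + y + y\<^sup>2/2 \<le> exp y" using exp_lower_Taylor_quadratic[OF y0] .
        moreover have "(1 - y + y\<^sup>2 / 2) * (1 + y + y\<^sup>2 / 2) = 1 + y ^ 4 / 4"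
          by (simp add: field_simps power2_eq_square power4_eq_xxxx)
        moreover have "1 - y + y\<^sup>2 / 2 = ((1 - y)\<^sup>2 + 1) / 2"
          by (simp add: field_simps power2_eq_square)
        then have "1 - y + y\<^sup>2 / 2 > 0" by (metis add_nonneg_pos half_gt_zero zero_le_power2 zero_less_one)
        ultimately have "1 \<le> (1 - y + y\<^sup>2 / 2) * exp y"
          using mult_left_mono[of "1 + y + y\<^sup>2/2" "exp y" "1 - y + y\<^sup>2 / 2"] zero_le_power[OF y0, of 4]
          by linarith
        then show ?thesis by (simp add: exp_minus field_simps)
      qed
      ultimately show ?thesis by simp
    qed
    have "cmod (char M s - complex_of_real (exp (- y)))
        \<le> cmod (char M s - complex_of_real (1 - y)) + cmod (complex_of_real (1 - y) - complex_of_real (exp (- y)))"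
      by (metis dist_norm dist_triangle)
    also have "cmod (complex_of_real (1 - y) - complex_of_real (exp (- y))) = \<bar>(1 - y) - exp (- y)\<bar>"
      by (metis norm_of_real of_real_diff)
    also have "cmod (char M s - complex_of_real (1 - y)) + \<bar>(1 - y) - exp (- y)\<bar> \<le> (s\<^sup>2 / 6) * ?m s + y\<^sup>2 / 2"
      using 1 2 by simp
    also have "\<dots> = s\<^sup>2 * (?m s / 6 + v\<^sup>2 * s\<^sup>2 / 8)"
      by (simp add: y_def field_simps power2_eq_square)
    also have "\<dots> \<le> s\<^sup>2 * \<epsilon>"
      using d(2)[OF False] s d(1) by (intro mult_left_mono) auto
    finally show ?thesis by (simp add: y_def mult.commute)
  qed
  show ?thesis using d(1) main by (intro exI[of _ "d/2"]) auto
qed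

text \<open>
  The characteristic function of the sum is a product whose factors are compared one by one with
  Gaussian ones; the error of each factor is \<open>\<epsilon> * (t * c n b)\<^sup>2\<close> as soon as the weights are small.
\<close>

lemma (in prob_space) asymp_normal_weighted_iid:
  fixes U :: "nat \<Rightarrow> 'a \<Rightarrow> real" and c :: "nat \<Rightarrow> nat \<Rightarrow> real"
  assumes indep: "indep_vars (\<lambda>_. borel) U UNIV"
    and distr: "\<And>b. distr M borel (U b) = distr M borel (U 0)"
    and sq: "sq_integrable M (U 0)" and mean: "expectation (U 0) = 0"
    and small: "d \<longlonglongrightarrow> 0" "\<forall>\<^sub>F n in sequentially. \<forall>b<N n. \<bar>c n b\<bar> \<le> d n"
    and total: "(\<lambda>n. \<Sum>b<N n. (c n b)\<^sup>2) \<longlonglongrightarrow> s"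
  shows "asymp_normal M (\<lambda>n \<omega>. \<Sum>b<N n. c n b * U b \<omega>)"
proof -
  define \<mu> where "\<mu> = distr M borel (U 0)"
  have [measurable]: "U b \<in> borel_measurable M" for b
    using indep by (auto simp: indep_vars_def)
  interpret \<mu>: real_distribution \<mu> unfolding \<mu>_def by (rule real_distribution_distr) simp
  define v where "v = \<mu>.expectation (\<lambda>x. x\<^sup>2)"
  have v0: "v \<ge> 0" by (simp add: v_def)
  have int2: "integrable \<mu> (\<lambda>x. x\<^sup>2)"
    using sq by (simp add: \<mu>_def integrable_distr_eq sq_integrable_def)
  have mean': "\<mu>.expectation (\<lambda>x. x) = 0" by (simp add: \<mu>_def integral_distr mean)
  have s0: "s \<ge> 0" by (rule tendsto_lowerbound[OF total]) (auto intro!: always_eventually sum_nonneg)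
  have "(\<lambda>n. char (distr M borel (\<lambda>\<omega>. \<Sum>b<N n. c n b * U b \<omega>)) t) \<longlonglongrightarrow> complex_of_real (exp (- ((s * v) * t\<^sup>2 / 2)))" for t
  proof -
    have char_eq: "char (distr M borel (\<lambda>\<omega>. \<Sum>b<N n. c n b * U b \<omega>)) t = (\<Prod>b<N n. char \<mu> (t * c n b))" for n
    proof -
      have "indep_vars (\<lambda>_. borel) (\<lambda>b \<omega>. c n b * U b \<omega>) {..<N n}"
        by (rule indep_vars_compose2[where X=U and M'="\<lambda>_. borel"]) (auto intro: indep_vars_subset[OF indep])
      then have "char (distr M borel (\<lambda>\<omega>. \<Sum>b<N n. c n b * U b \<omega>)) t = (\<Prod>b<N n. char (distr M borel (\<lambda>\<omega>. c n b * U b \<omega>)) t)"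
        by (rule char_distr_sum)
      also have "\<dots> = (\<Prod>b<N n. char \<mu> (t * c n b))"
      proof (intro prod.cong refl)
        fix b
        have "char \<mu> (t * c n b) = char (distr M borel (U b)) (t * c n b)" unfolding \<mu>_def distr[of b] ..
        also have "\<dots> = char (distr M borel (\<lambda>\<omega>. c n b * U b \<omega>)) t"
          by (simp add: char_def integral_distr mult_ac)
        finally show "char (distr M borel (\<lambda>\<omega>. c n b * U b \<omega>)) t = char \<mu> (t * c n b)" by simp
      qed
      finally show ?thesis .
    qed
    have gauss: "complex_of_real (exp (- (v * t\<^sup>2 / 2 * (\<Sum>b<N n. (c n b)\<^sup>2)))) = (\<Prod>b<N n. complex_of_real (exp (- (v * (t * c n b)\<^sup>2 / 2))))" for n
    proof -
      have "- (v * t\<^sup>2 / 2 * (\<Sum>b<N n. (c n b)\<^sup>2)) = (\<Sum>b<N n. - (v * (t * c n b)\<^sup>2 / 2))"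
        by (simp add: sum_distrib_left power_mult_distrib sum_negf mult_ac)
      then show ?thesis by (simp add: exp_sum)
    qed
    let ?D = "\<lambda>n. (\<Prod>b<N n. char \<mu> (t * c n b)) - complex_of_real (exp (- (v * t\<^sup>2 / 2 * (\<Sum>b<N n. (c n b)\<^sup>2))))"
    have "?D \<longlonglongrightarrow> 0"
    proof (rule tendstoI)
      fix \<epsilon> :: real assume \<epsilon>: "\<epsilon> > 0"
      define \<epsilon>' where "\<epsilon>' = \<epsilon> / ((t\<^sup>2 + 1) * (s + 1))"
      have \<epsilon>': "\<epsilon>' > 0" using \<epsilon> s0 by (simp add: \<epsilon>'_def add_nonneg_pos)
      obtain \<delta> where \<delta>: "\<delta> > 0" "\<And>r. \<bar>r\<bar> \<le> \<delta> \<Longrightarrow> cmod (char \<mu> r - complex_of_real (exp (- (v * r\<^sup>2 / 2)))) \<le> \<epsilon>' * r\<^sup>2"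
        using \<mu>.char_minus_gaussian_small[OF int2 mean' v_def \<epsilon>'] by blast
      have "(\<lambda>n. \<bar>t\<bar> * d n) \<longlonglongrightarrow> \<bar>t\<bar> * 0" by (intro tendsto_intros small)
      then have "\<forall>\<^sub>F n in sequentially. \<bar>t\<bar> * d n < \<delta>"
        by (rule order_tendstoD) (use \<delta> in auto)
      moreover have "\<forall>\<^sub>F n in sequentially. (\<Sum>b<N n. (c n b)\<^sup>2) < s + 1"
        using total by (rule order_tendstoD) auto
      ultimately show "\<forall>\<^sub>F n in sequentially. dist (?D n) 0 < \<epsilon>"
        using small(2)
      proof eventually_elim
        case (elim n)
        have "norm (?D n) \<le> (\<Sum>b<N n. cmod (char \<mu> (t * c n b) - complex_of_real (exp (- (v * (t * c n b)\<^sup>2 / 2)))))"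
          unfolding gauss by (intro norm_prod_diff) (use \<mu>.cmod_char_le_1 v0 in \<open>auto simp: norm_exp_eq_Re\<close>)
        also have "\<dots> \<le> (\<Sum>b<N n. \<epsilon>' * (t * c n b)\<^sup>2)"
        proof (intro sum_mono \<delta>)
          fix b assume "b \<in> {..<N n}"
          then have "\<bar>t\<bar> * \<bar>c n b\<bar> \<le> \<bar>t\<bar> * d n" using elim(3) by (intro mult_left_mono) auto
          then show "\<bar>t * c n b\<bar> \<le> \<delta>" using elim(1) by (simp add: abs_mult)
        qed
        also have "\<dots> = \<epsilon>' * t\<^sup>2 * (\<Sum>b<N n. (c n b)\<^sup>2)"
          by (simp add: sum_distrib_left power_mult_distrib mult_ac)
        also have "\<dots> \<le> \<epsilon>' * t\<^sup>2 * (s + 1)"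
          using elim(2) \<epsilon>' by (intro mult_left_mono) auto
        also have "\<dots> < \<epsilon>' * (t\<^sup>2 + 1) * (s + 1)"
          using \<epsilon>' s0 by (intro mult_strict_right_mono mult_strict_left_mono) auto
        also have "\<dots> = \<epsilon>"
        proof -
          have "(t\<^sup>2 + 1) * (s + 1) \<noteq> 0" using s0 by (metis add_nonneg_pos less_numeral_extra(3) mult_pos_pos zero_le_power2 zero_less_one)
          then show ?thesis unfolding \<epsilon>'_def by (metis mult.assoc nonzero_eq_divide_eq)
        qed
        finally show ?case by (simp add: dist_norm)
      qed
    qed
    moreover have "(\<lambda>n. complex_of_real (exp (- (v * t\<^sup>2 / 2 * (\<Sum>b<N n. (c n b)\<^sup>2))))) \<longlonglongrightarrow> complex_of_real (exp (- (v * t\<^sup>2 / 2 * s)))"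
      by (intro tendsto_intros total)
    ultimately have "(\<lambda>n. ?D n + complex_of_real (exp (- (v * t\<^sup>2 / 2 * (\<Sum>b<N n. (c n b)\<^sup>2))))) \<longlonglongrightarrow> 0 + complex_of_real (exp (- (v * t\<^sup>2 / 2 * s)))"
      by (rule tendsto_add)
    then show ?thesis unfolding char_eq by (simp add: mult_ac)
  qed
  then show ?thesis unfolding asymp_normal_def using v0 s0 by (intro exI[of _ "s * v"]) auto
qed

section \<open>Functions of windows of an i.i.d. sequence\<close>

locale iid_sequence = prob_space M for M :: "'a measure" +
  fixes S :: "'b measure" and eps :: "int \<Rightarrow> 'a \<Rightarrow> 'b"
  assumes iid: "iid M S eps"
begin

lemma eps_measurable [measurable]: "eps i \<in> measurable M S"
  using iid by (auto simp: iid_def indep_vars_def)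

text \<open>
  The \<open>\<sigma>\<close>-algebra generated by the innovations with index in \<open>J\<close>.  Measurability with respect to
  it expresses that a variable depends only on these innovations, and is stable under the usual
  operations without exhibiting a factorisation.
\<close>

definition window_algebra :: "int set \<Rightarrow> 'a measure" where
  "window_algebra J = vimage_algebra (space M) (\<lambda>\<omega>. \<lambda>i\<in>J. eps i \<omega>) (PiM J (\<lambda>_. S))"

lemma space_window_algebra [simp]: "space (window_algebra J) = space M"
  by (simp add: window_algebra_def)

lemma restrict_eps_space: "(\<lambda>\<omega>. \<lambda>i\<in>J. eps i \<omega>) \<in> space M \<rightarrow> space (PiM J (\<lambda>_. S))"
  using measurable_space[OF eps_measurable] by (auto simp: space_PiM)

lemma sets_window_algebra:
  "sets (window_algebra J) = {(\<lambda>\<omega>. \<lambda>i\<in>J. eps i \<omega>) -` A \<inter> space M | A. A \<in> sets (PiM J (\<lambda>_. S))}"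
  unfolding window_algebra_def by (rule sets_vimage_algebra2[OF restrict_eps_space])

lemma eps_measurable_window: "i \<in> J \<Longrightarrow> eps i \<in> measurable (window_algebra J) S"
proof -
  assume i: "i \<in> J"
  have "(\<lambda>\<omega>. \<lambda>i\<in>J. eps i \<omega>) \<in> measurable (window_algebra J) (PiM J (\<lambda>_. S))"
    unfolding window_algebra_def by (rule measurable_vimage_algebra1[OF restrict_eps_space])
  from measurable_compose[OF this measurable_component_singleton[OF i]] i
  show ?thesis by simp
qed

lemma measurable_window_mono:
  assumes f: "f \<in> measurable (window_algebra J) N" and "J \<subseteq> J'"
  shows "f \<in> measurable (window_algebra J') N"
proof -
  have "sets (window_algebra J) \<subseteq> sets (window_algebra J')"
    unfolding window_algebra_def[of J]
  proof (rule sets_image_in_sets)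
    show "(\<lambda>\<omega>. \<lambda>i\<in>J. eps i \<omega>) \<in> measurable (window_algebra J') (PiM J (\<lambda>_. S))"
      using assms(2) by (intro measurable_restrict eps_measurable_window) auto
  qed simp
  then show ?thesis
    using f by (auto simp: measurable_def)
qed

lemma measurable_window_imp:
  assumes f: "f \<in> measurable (window_algebra J) N"
  shows "f \<in> measurable M N"
proof -
  have "sets (window_algebra J) \<subseteq> sets M"
    unfolding window_algebra_def[of J]
    by (rule sets_image_in_sets) auto
  then show ?thesis
    using f by (auto simp: measurable_def)
qed

text \<open>
  Disjoint families of innovations are independent, and generate the window algebras.
\<close>

lemma indep_vars_windows:
  assumes J: "disjoint_family_on J L"
    and f: "\<And>b. b \<in> L \<Longrightarrow> f b \<in> measurable (window_algebra (J b)) (N b)"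
  shows "indep_vars N f L"
proof -
  have "indep_vars (\<lambda>b. PiM (J b) (\<lambda>_. S)) (\<lambda>b \<omega>. \<lambda>i\<in>J b. eps i \<omega>) L"
    using iid J by (intro indep_vars_restrict[where I=UNIV]) (auto simp: iid_def)
  then have "indep_sets (\<lambda>b. {(\<lambda>\<omega>. \<lambda>i\<in>J b. eps i \<omega>) -` A \<inter> space M | A. A \<in> sets (PiM (J b) (\<lambda>_. S))}) L"
    by (simp add: indep_vars_def2)
  then have ind: "indep_sets (\<lambda>b. sets (window_algebra (J b))) L"
    by (simp add: sets_window_algebra)
  have "indep_sets (\<lambda>b. {f b -` A \<inter> space M | A. A \<in> sets (N b)}) L"
  proof (rule indep_sets_mono_sets[OF ind], safe)
    fix b A assume "b \<in> L" "A \<in> sets (N b)"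
    then show "f b -` A \<inter> space M \<in> sets (window_algebra (J b))"
      using measurable_sets[OF f, of b A] by simp
  qed
  then show ?thesis
    using f by (auto simp: indep_vars_def2 intro: measurable_window_imp)
qed

lemma indep_var_windows:
  assumes "J \<inter> J' = {}"
    and "f \<in> measurable (window_algebra J) N" and "g \<in> measurable (window_algebra J') N'"
  shows "indep_var N f N' g"
  unfolding indep_var_def
  by (rule indep_vars_windows[of "case_bool J J'"])
     (use assms in \<open>auto simp: disjoint_family_on_def split: bool.split\<close>)

lemma expectation_mult_windows_zero:
  assumes "J \<inter> J' = {}"
    and f: "f \<in> borel_measurable (window_algebra J)" "sq_integrable M f" "expectation f = 0"
    and g: "g \<in> borel_measurable (window_algebra J')" "sq_integrable M g"
  shows "expectation (\<lambda>\<omega>. f \<omega> * g \<omega>) = 0"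
proof -
  have "expectation (\<lambda>\<omega>. f \<omega> * g \<omega>) = expectation f * expectation g"
    by (intro indep_var_lebesgue_integral indep_var_windows[OF assms(1)] f g sq_integrable_imp_integrable)
  then show ?thesis using f by simp
qed

text \<open>
  The sequence of innovations seen from time \<open>s\<close>.  A stationary process is a fixed functional
  evaluated along \<open>shifted s\<close>, so stationarity reduces to the shift invariance of a product
  measure.
\<close>

definition shifted :: "int \<Rightarrow> 'a \<Rightarrow> int \<Rightarrow> 'b" where
  "shifted s \<omega> = (\<lambda>k. eps (s + k) \<omega>)"

lemma shifted_measurable [measurable]: "shifted s \<in> measurable M (PiM UNIV (\<lambda>_. S))"
  unfolding shifted_def by (rule measurable_PiM_single') (auto simp: space_PiM measurable_space[OF eps_measurable])

lemma distr_shifted: "distr M (PiM UNIV (\<lambda>_. S)) (shifted s) = PiM UNIV (\<lambda>_. distr M S (eps 0))"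
proof -
  have "indep_vars (\<lambda>_. S) (\<lambda>k. eps (s + k)) UNIV"
    by (rule indep_vars_windows[of "\<lambda>k. {s + k}"]) (auto simp: disjoint_family_on_def eps_measurable_window)
  then have "distr M (PiM UNIV (\<lambda>_. S)) (\<lambda>\<omega>. \<lambda>k\<in>UNIV. eps (s + k) \<omega>) = PiM UNIV (\<lambda>k. distr M S (eps (s + k)))"
    by (subst (asm) indep_vars_iff_distr_eq_PiM) auto
  moreover have "distr M S (eps (s + k)) = distr M S (eps 0)" for k
    using iid by (auto simp: iid_def)
  ultimately show ?thesis
    unfolding shifted_def[abs_def] restrict_UNIV by (simp only:)
qed

lemma distr_functional_shifted:
  assumes [measurable]: "G \<in> borel_measurable (PiM UNIV (\<lambda>_. S))"
  shows "distr M borel (\<lambda>\<omega>. G (shifted s \<omega>)) = distr M borel (\<lambda>\<omega>. G (shifted s' \<omega>))"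
proof -
  have "distr M borel (\<lambda>\<omega>. G (shifted s \<omega>)) = distr (PiM UNIV (\<lambda>_. distr M S (eps 0))) borel G" for s
    unfolding distr_shifted[of s, symmetric] by (subst distr_distr) (auto simp: comp_def)
  then show ?thesis by simp
qed

lemma expectation_functional_shifted:
  fixes G :: "(int \<Rightarrow> 'b) \<Rightarrow> real"
  assumes [measurable]: "G \<in> borel_measurable (PiM UNIV (\<lambda>_. S))"
  shows "expectation (\<lambda>\<omega>. G (shifted s \<omega>)) = expectation (\<lambda>\<omega>. G (shifted s' \<omega>))"
proof -
  have "expectation (\<lambda>\<omega>. G (shifted s \<omega>)) = integral\<^sup>L (distr M borel (\<lambda>\<omega>. G (shifted s \<omega>))) (\<lambda>x. x)" for s
    by (subst integral_distr) auto
  then show ?thesis using distr_functional_shifted[OF assms] by metis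
qed

lemma integrable_functional_shifted:
  fixes G :: "(int \<Rightarrow> 'b) \<Rightarrow> real"
  assumes [measurable]: "G \<in> borel_measurable (PiM UNIV (\<lambda>_. S))"
  shows "integrable M (\<lambda>\<omega>. G (shifted s \<omega>)) \<longleftrightarrow> integrable M (\<lambda>\<omega>. G (shifted s' \<omega>))"
proof -
  have "integrable M (\<lambda>\<omega>. G (shifted s \<omega>)) \<longleftrightarrow> integrable (distr M borel (\<lambda>\<omega>. G (shifted s \<omega>))) (\<lambda>x. x)" for s
    by (subst integrable_distr_eq) auto
  then show ?thesis using distr_functional_shifted[OF assms] by metis
qed

lemma L2_functional_shifted:
  fixes G :: "(int \<Rightarrow> 'b) \<Rightarrow> real"
  assumes [measurable]: "G \<in> borel_measurable (PiM UNIV (\<lambda>_. S))"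
  shows "sq_integrable M (\<lambda>\<omega>. G (shifted s \<omega>)) \<longleftrightarrow> sq_integrable M (\<lambda>\<omega>. G (shifted s' \<omega>))"
    and "L2_norm M (\<lambda>\<omega>. G (shifted s \<omega>)) = L2_norm M (\<lambda>\<omega>. G (shifted s' \<omega>))"
  using integrable_functional_shifted[of "\<lambda>x. (G x)\<^sup>2" s s'] expectation_functional_shifted[of "\<lambda>x. (G x)\<^sup>2" s s']
  by (auto simp: sq_integrable_def L2_norm_def)

end

section \<open>Central limit theorem for slowly varying weights\<close>

text \<open>
  When every variable is correlated with at most \<open>k\<close> others, \<open>2 * \<bar>a p * a q\<bar> \<le> (a p)\<^sup>2 + (a q)\<^sup>2\<close>
  makes the sum essentially diagonal.
\<close>

lemma L2_norm_sum_neighbours: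
  fixes f :: "'i \<Rightarrow> 'a \<Rightarrow> real"
  assumes A: "finite A" and f: "\<And>p. p \<in> A \<Longrightarrow> sq_integrable M (f p)"
    and c: "\<And>p q. p \<in> A \<Longrightarrow> q \<in> A \<Longrightarrow> \<bar>\<integral>\<omega>. f p \<omega> * f q \<omega> \<partial>M\<bar> \<le> (if nb p q then c else 0)"
    and sym: "\<And>p q. nb p q \<longleftrightarrow> nb q p"
    and card: "\<And>p. p \<in> A \<Longrightarrow> real (card {q\<in>A. nb p q}) \<le> k" and c0: "c \<ge> 0"
  shows "(L2_norm M (\<lambda>\<omega>. \<Sum>p\<in>A. a p * f p \<omega>))\<^sup>2 \<le> c * k * (\<Sum>p\<in>A. (a p)\<^sup>2)"
proof -
  let ?I = "\<lambda>p q. if nb p q then c else 0"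
  have "(L2_norm M (\<lambda>\<omega>. \<Sum>p\<in>A. a p * f p \<omega>))\<^sup>2 \<le> (\<Sum>p\<in>A. \<Sum>q\<in>A. \<bar>a p\<bar> * \<bar>a q\<bar> * ?I p q)"
    by (rule L2_norm_sum_square_le[OF A f c])
  also have "\<dots> \<le> (\<Sum>p\<in>A. \<Sum>q\<in>A. (a p)\<^sup>2 / 2 * ?I p q + (a q)\<^sup>2 / 2 * ?I p q)"
  proof (intro sum_mono)
    fix p q
    have "\<bar>a p\<bar> * \<bar>a q\<bar> \<le> (a p)\<^sup>2 / 2 + (a q)\<^sup>2 / 2"
      using sum_squares_bound[of "\<bar>a p\<bar>" "\<bar>a q\<bar>"] by simp
    then have "\<bar>a p\<bar> * \<bar>a q\<bar> * ?I p q \<le> ((a p)\<^sup>2 / 2 + (a q)\<^sup>2 / 2) * ?I p q"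
      using c0 by (intro mult_right_mono) auto
    then show "\<bar>a p\<bar> * \<bar>a q\<bar> * ?I p q \<le> (a p)\<^sup>2 / 2 * ?I p q + (a q)\<^sup>2 / 2 * ?I p q"
      by (simp add: algebra_simps)
  qed
  also have "\<dots> = (\<Sum>p\<in>A. \<Sum>q\<in>A. (a p)\<^sup>2 / 2 * ?I p q) + (\<Sum>p\<in>A. \<Sum>q\<in>A. (a q)\<^sup>2 / 2 * ?I p q)"
    by (simp add: sum.distrib)
  also have "(\<Sum>p\<in>A. \<Sum>q\<in>A. (a q)\<^sup>2 / 2 * ?I p q) = (\<Sum>q\<in>A. \<Sum>p\<in>A. (a q)\<^sup>2 / 2 * ?I q p)"
    by (subst sum.swap) (simp only: sym)
  also have "(\<Sum>p\<in>A. \<Sum>q\<in>A. (a p)\<^sup>2 / 2 * ?I p q) + (\<Sum>q\<in>A. \<Sum>p\<in>A. (a q)\<^sup>2 / 2 * ?I q p)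
      = (\<Sum>p\<in>A. (a p)\<^sup>2 * (\<Sum>q\<in>A. ?I p q))"
    by (simp add: sum_distrib_left sum.distrib[symmetric] mult.commute)
  also have "\<dots> \<le> (\<Sum>p\<in>A. (a p)\<^sup>2 * (c * k))"
  proof (intro sum_mono mult_left_mono)
    fix p assume p: "p \<in> A"
    have "(\<Sum>q\<in>A. ?I p q) = c * real (card {q\<in>A. nb p q})"
      using A by (subst sum.inter_filter[symmetric]) auto
    also have "\<dots> \<le> c * k" using card[OF p] c0 by (rule mult_left_mono)
    finally show "(\<Sum>q\<in>A. ?I p q) \<le> c * k" .
  qed auto
  finally show ?thesis by (simp add: sum_distrib_left mult.commute)
qed

lemma card_int_neighbours:
  fixes i :: int and A :: "int set"
  shows "real (card {j\<in>A. \<bar>i - j\<bar> < q}) \<le> 2 * real_of_int \<bar>q\<bar>"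
proof -
  have "card {j\<in>A. \<bar>i - j\<bar> < q} \<le> card {i - q<..<i + q}"
    by (intro card_mono) auto
  also have "card {i - q<..<i + q} \<le> nat (2 * \<bar>q\<bar>)" by simp
  finally show ?thesis by linarith
qed

text \<open>
  Position \<open>r\<close> of block \<open>b\<close>.  Summation runs over \<open>{1..n}\<close> whereas positions and blocks are counted
  from \<open>0\<close>, whence the \<open>1\<close>.
\<close>

definition block_index :: "nat \<Rightarrow> nat \<times> nat \<Rightarrow> int" where
  "block_index p = (\<lambda>(b, r). int b * int p + 1 + int r)"

lemma inj_on_block_index:
  assumes "L \<le> p" shows "inj_on (block_index p) ({..<N} \<times> {..<L})"
proof (rule inj_onI, safe)
  fix b r b' r'
  assume *: "r < L" "r' < L" "block_index p (b, r) = block_index p (b', r')"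
  then have "b * p + r = b' * p + r'"
    by (simp add: block_index_def flip: of_nat_mult of_nat_add)
  moreover have "r < p" "r' < p" using * assms by auto
  ultimately show "b = b'" "r = r'"
    by (metis add.commute add_right_cancel div_less div_mult_self3 add_cancel_right_left mult.commute not_less_zero gr0I add_0 , 
        metis mod_less mod_mult_self3)
qed

lemma block_index_image_subset:
  assumes "L \<le> p" "N * p \<le> n"
  shows "block_index p ` ({..<N} \<times> {..<L}) \<subseteq> {1..int n}"
proof safe
  fix b r assume br: "b < N" "r < L"
  have "b * p + r + 1 \<le> (b + 1) * p" using br assms by simp
  also have "\<dots> \<le> N * p" using br by (intro mult_right_mono) auto
  finally have "b * p + r + 1 \<le> n" using assms by simp
  then show "block_index p (b, r) \<in> {1..int n}"
    by (simp add: block_index_def flip: of_nat_mult of_nat_add)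
qed

lemma sum_block_index:
  assumes "L \<le> p"
  shows "(\<Sum>i\<in>block_index p ` ({..<N} \<times> {..<L}). f i) = (\<Sum>b<N. \<Sum>r<L. f (int b * int p + 1 + int r))"
  by (subst sum.reindex[OF inj_on_block_index[OF assms]])
     (simp add: sum.cartesian_product block_index_def case_prod_beta comp_def)

text \<open>
  Within a block the weight differs from its first value by at most \<open>p\<close> increments; each increment
  is counted for at most \<open>p\<close> positions, and Cauchy-Schwarz costs another factor \<open>p\<close>.
\<close>

lemma block_oscillation_le:
  fixes a :: "int \<Rightarrow> real"
  assumes p: "p > 0" "L \<le> p" "N * p \<le> n"
  shows "(\<Sum>b<N. \<Sum>r<L. (a (int b * int p + 1 + int r) - a (int b * int p + 1))\<^sup>2)
     \<le> (real p)\<^sup>2 * (\<Sum>i=1..int n - 1. (a (i + 1) - a i)\<^sup>2)"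
proof -
  let ?d = "\<lambda>i. (a (i + 1) - a i)\<^sup>2"
  have one: "(a (s + int r) - a s)\<^sup>2 \<le> real p * (\<Sum>k<p-1. ?d (s + int k))" if "r < p" for s r
  proof -
    have "a (s + int r) - a s = (\<Sum>k<r. a (s + int k + 1) - a (s + int k))"
      by (induction r) (auto simp: algebra_simps)
    then have "(a (s + int r) - a s)\<^sup>2 \<le> (\<Sum>k<r. ?d (s + int k)) * real r"
      using sum_squared_le_sum_of_squares[of "\<lambda>k. a (s + int k + 1) - a (s + int k)" "{..<r}"]
      by simp
    also have "\<dots> \<le> (\<Sum>k<p-1. ?d (s + int k)) * real p"
      using that by (intro mult_mono sum_mono2 sum_nonneg) auto
    finally show ?thesis by (simp add: mult.commute)
  qed
  have "(\<Sum>b<N. \<Sum>r<L. (a (int b * int p + 1 + int r) - a (int b * int p + 1))\<^sup>2)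
      \<le> (\<Sum>b<N. \<Sum>r<L. real p * (\<Sum>k<p-1. ?d (int b * int p + 1 + int k)))"
    using p by (intro sum_mono one) auto
  also have "\<dots> = real L * real p * (\<Sum>b<N. \<Sum>k<p-1. ?d (int b * int p + 1 + int k))"
    by (simp add: sum_distrib_left mult_ac)
  also have "\<dots> \<le> (real p * real p) * (\<Sum>i=1..int n - 1. ?d i)"
  proof (intro mult_mono)
    have "(\<Sum>b<N. \<Sum>k<p-1. ?d (int b * int p + 1 + int k)) = (\<Sum>i\<in>block_index p ` ({..<N} \<times> {..<p-1}). ?d i)"
      by (rule sum_block_index[symmetric]) simp
    also have "\<dots> \<le> (\<Sum>i=1..int n - 1. ?d i)"
    proof (intro sum_mono2)
      show "block_index p ` ({..<N} \<times> {..<p-1}) \<subseteq> {1..int n - 1}"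
      proof safe
        fix b r assume br: "b < N" "r < p - 1"
        have "block_index p (b, k) \<in> {1..int n}" if "k < p" for k
          by (rule subsetD[OF block_index_image_subset[OF order_refl p(3)] imageI]) (use br that in simp)
        from this[of r] this[of "Suc r"] br
        have "block_index p (b, r) \<in> {1..int n}" "block_index p (b, Suc r) \<in> {1..int n}"
          by simp_all
        then show "block_index p (b, r) \<in> {1..int n - 1}" by (simp add: block_index_def)
      qed
    qed auto
    finally show "(\<Sum>b<N. \<Sum>k<p-1. ?d (int b * int p + 1 + int k)) \<le> (\<Sum>i=1..int n - 1. ?d i)" .
  qed (use p in \<open>auto intro!: sum_nonneg mult_right_mono\<close>)
  finally show ?thesis by (simp add: power2_eq_square)
qed

text \<open>
  There are at most \<open>n / p\<close> gaps of length \<open>p - L\<close>, and one incomplete last block.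
\<close>

lemma card_block_complement:
  assumes "L \<le> p" "0 < p"
  shows "real (card ({1..int n} - block_index p ` ({..<n div p} \<times> {..<L}))) \<le> real n * real (p - L) / real p + real p"
proof -
  let ?N = "n div p"
  have sub: "block_index p ` ({..<?N} \<times> {..<L}) \<subseteq> {1..int n}"
    by (rule block_index_image_subset[OF assms(1)]) simp
  have "card ({1..int n} - block_index p ` ({..<?N} \<times> {..<L})) = n - ?N * L"
    using sub inj_on_block_index[OF assms(1), of ?N]
    by (simp add: card_Diff_subset finite_subset[OF sub] card_image)
  also have "real (n - ?N * L) \<le> real ?N * real (p - L) + real p"
  proof -
    have "n \<le> ?N * p + p" using assms(2) by (metis add.commute add_le_cancel_right div_mult_mod_eq less_imp_le_nat mod_less_divisor nat_add_left_cancel_le)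
    moreover have "?N * p = ?N * L + ?N * (p - L)" using assms(1) by (simp flip: distrib_left)
    ultimately have "n - ?N * L \<le> ?N * (p - L) + p" by linarith
    then show ?thesis by (metis of_nat_add of_nat_le_iff of_nat_mult)
  qed
  also have "real ?N \<le> real n / real p" by (rule of_nat_div_le_of_nat)
  finally show ?thesis using assms by (simp add: mult_right_mono)
qed

text \<open>
  Since \<open>\<bar>x\<^sup>2 - y\<^sup>2\<bar> = \<bar>x - y\<bar> * \<bar>x + y\<bar>\<close> with \<open>\<bar>x + y\<bar> \<le> 2 * B / sqrt n\<close>, the small oscillation within
  blocks lets every weight be replaced by the one at the start of its block, each of which is then
  counted \<open>p\<close> times.
\<close>

lemma sampled_weights_energy:
  fixes a :: "nat \<Rightarrow> int \<Rightarrow> real"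
  assumes p: "p > 0" and B: "B \<ge> 0"
    and bound: "\<forall>\<^sub>F n in sequentially. \<forall>i\<in>{1..int n}. \<bar>a n i\<bar> \<le> B / sqrt (real n)"
    and smooth: "(\<lambda>n. \<Sum>i=1..int n - 1. (a n (i + 1) - a n i)\<^sup>2) \<longlonglongrightarrow> 0"
    and total: "(\<lambda>n. \<Sum>i=1..int n. (a n i)\<^sup>2) \<longlonglongrightarrow> s"
  shows "(\<lambda>n. \<Sum>b<n div p. (a n (int b * int p + 1))\<^sup>2) \<longlonglongrightarrow> s / real p"
proof -
  define D where "D n = (\<Sum>i=1..int n - 1. (a n (i + 1) - a n i)\<^sup>2)" for n
  define A where "A n = (\<Sum>b<n div p. (a n (int b * int p + 1))\<^sup>2)" for n
  define e where "e n = 2 * B * real p * sqrt (D n) + real p * B\<^sup>2 / real n" for n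
  have "(\<lambda>n. real p * B\<^sup>2 / real n) \<longlonglongrightarrow> 0"
    by (rule lim_const_over_n)
  then have "e \<longlonglongrightarrow> 2 * B * real p * sqrt 0 + 0"
    unfolding e_def using smooth by (intro tendsto_intros) (auto simp: D_def)
  then have e0: "e \<longlonglongrightarrow> 0" by simp
  have "\<forall>\<^sub>F n in sequentially. norm (real p * A n - (\<Sum>i=1..int n. (a n i)\<^sup>2)) \<le> e n"
    using bound eventually_gt_at_top[of 0]
  proof eventually_elim
    case (elim n)
    let ?I = "block_index p ` ({..<n div p} \<times> {..<p})"
    let ?N = "n div p" and ?x = "\<lambda>b r. a n (int b * int p + 1 + int r)"
    have sub: "?I \<subseteq> {1..int n}" by (rule block_index_image_subset) auto
    have Dn: "D n \<ge> 0" by (auto simp: D_def intro!: sum_nonneg)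
    have inI: "int b * int p + 1 + int r \<in> {1..int n}" if "b < ?N" "r < p" for b r
      using sub that by (force simp: block_index_def image_subset_iff)
    have absx: "\<bar>?x b r\<bar> \<le> B / sqrt n" if "b < ?N" "r < p" for b r
      using elim(1) inI[OF that] by auto
    have split: "(\<Sum>i=1..int n. (a n i)\<^sup>2) = (\<Sum>b<?N. \<Sum>r<p. (?x b r)\<^sup>2) + (\<Sum>i\<in>{1..int n} - ?I. (a n i)\<^sup>2)"
      using sum.subset_diff[OF sub, of "\<lambda>i. (a n i)\<^sup>2"] by (simp add: sum_block_index)
    have pA: "real p * A n = (\<Sum>b<?N. \<Sum>r<p. (?x b 0)\<^sup>2)"
      by (simp add: A_def sum_distrib_left)
    have 1: "\<bar>real p * A n - (\<Sum>b<?N. \<Sum>r<p. (?x b r)\<^sup>2)\<bar> \<le> 2 * B * real p * sqrt (D n)"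
    proof -
      let ?T = "{..<?N} \<times> {..<p}" and ?y = "\<lambda>(b, r). \<bar>?x b r - ?x b 0\<bar>"
      have "\<bar>real p * A n - (\<Sum>b<?N. \<Sum>r<p. (?x b r)\<^sup>2)\<bar> = \<bar>\<Sum>b<?N. \<Sum>r<p. (?x b 0)\<^sup>2 - (?x b r)\<^sup>2\<bar>"
        by (simp add: pA sum_subtractf)
      also have "\<dots> \<le> (\<Sum>b<?N. \<Sum>r<p. \<bar>(?x b 0)\<^sup>2 - (?x b r)\<^sup>2\<bar>)"
        by (rule order_trans[OF sum_abs sum_mono[OF sum_abs]])
      also have "\<dots> \<le> (\<Sum>b<?N. \<Sum>r<p. (2 * B / sqrt n) * \<bar>?x b r - ?x b 0\<bar>)"
      proof (intro sum_mono)
        fix b r assume br: "b \<in> {..<?N}" "r \<in> {..<p}"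
        have "\<bar>?x b 0 + ?x b r\<bar> \<le> 2 * B / sqrt n"
          using absx[of b r] absx[of b 0] br p by auto
        then have "\<bar>?x b 0 + ?x b r\<bar> * \<bar>?x b r - ?x b 0\<bar> \<le> (2 * B / sqrt n) * \<bar>?x b r - ?x b 0\<bar>"
          by (intro mult_right_mono) auto
        moreover have "(?x b 0)\<^sup>2 - (?x b r)\<^sup>2 = - ((?x b 0 + ?x b r) * (?x b r - ?x b 0))"
          by (simp add: power2_eq_square algebra_simps)
        ultimately show "\<bar>(?x b 0)\<^sup>2 - (?x b r)\<^sup>2\<bar> \<le> (2 * B / sqrt n) * \<bar>?x b r - ?x b 0\<bar>"
          by (simp add: abs_mult)
      qed
      also have "\<dots> = (2 * B / sqrt n) * sum ?y ?T"
        by (simp add: sum.cartesian_product sum_distrib_left case_prod_beta)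
      also have "\<dots> \<le> (2 * B / sqrt n) * (sqrt n * (real p * sqrt (D n)))"
      proof (intro mult_left_mono)
        have "(sum ?y ?T)\<^sup>2 \<le> (\<Sum>z\<in>?T. (?y z)\<^sup>2) * real (card ?T)"
          by (rule sum_squared_le_sum_of_squares)
        also have "\<dots> \<le> ((real p)\<^sup>2 * D n) * real n"
        proof (intro mult_mono)
          have "(\<Sum>z\<in>?T. (?y z)\<^sup>2) = (\<Sum>b<?N. \<Sum>r<p. (?x b r - ?x b 0)\<^sup>2)"
            by (simp add: sum.cartesian_product case_prod_beta)
          also have "\<dots> \<le> (real p)\<^sup>2 * D n"
            using block_oscillation_le[OF p order_refl, of ?N n "a n"] by (simp add: D_def)
          finally show "(\<Sum>z\<in>?T. (?y z)\<^sup>2) \<le> (real p)\<^sup>2 * D n" .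
          show "real (card ?T) \<le> real n" by (simp flip: of_nat_mult)
        qed (use Dn in auto)
        finally have "(sum ?y ?T)\<^sup>2 \<le> (real p)\<^sup>2 * D n * real n" .
        then have "sum ?y ?T \<le> sqrt ((real p)\<^sup>2 * D n * real n)" by (rule real_le_rsqrt)
        then show "sum ?y ?T \<le> sqrt n * (real p * sqrt (D n))" by (simp add: real_sqrt_mult mult_ac)
      qed (use B in auto)
      also have "\<dots> = 2 * B * real p * sqrt (D n)" using elim(2) by simp
      finally show ?thesis .
    qed
    have 2: "(\<Sum>i\<in>{1..int n} - ?I. (a n i)\<^sup>2) \<le> real p * B\<^sup>2 / n"
    proof -
      have "(\<Sum>i\<in>{1..int n} - ?I. (a n i)\<^sup>2) \<le> (\<Sum>i\<in>{1..int n} - ?I. B\<^sup>2 / n)"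
      proof (intro sum_mono)
        fix i assume "i \<in> {1..int n} - ?I"
        then have "\<bar>a n i\<bar> \<le> B / sqrt n" using elim(1) by auto
        then have "\<bar>a n i\<bar>\<^sup>2 \<le> (B / sqrt n)\<^sup>2" by (intro power_mono) auto
        then show "(a n i)\<^sup>2 \<le> B\<^sup>2 / n" by (simp add: power_divide)
      qed
      also have "\<dots> = real (card ({1..int n} - ?I)) * (B\<^sup>2 / n)" by simp
      also have "\<dots> \<le> real p * (B\<^sup>2 / n)"
        using card_block_complement[of p p n] p by (intro mult_right_mono) auto
      finally show ?thesis by simp
    qed
    have "(\<Sum>i\<in>{1..int n} - ?I. (a n i)\<^sup>2) \<ge> 0" by (intro sum_nonneg) auto
    then show ?case using 1 2 unfolding split e_def real_norm_def by linarith
  qed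
  then have "(\<lambda>n. real p * A n - (\<Sum>i=1..int n. (a n i)\<^sup>2)) \<longlonglongrightarrow> 0"
    by (rule Lim_null_comparison) (rule e0)
  from tendsto_add[OF this total] have "(\<lambda>n. real p * A n) \<longlonglongrightarrow> s" by simp
  then have "(\<lambda>n. real p * A n / real p) \<longlonglongrightarrow> s / real p" using p by (intro tendsto_intros) auto
  then show ?thesis using p by (simp add: A_def)
qed

context iid_sequence
begin

text \<open>
  Window functions of radius \<open>m\<close> are uncorrelated at distance \<open>2 * m + 1\<close>.
\<close>

lemma L2_norm_m_dependent_sum:
  assumes G [measurable]: "G \<in> borel_measurable (PiM UNIV (\<lambda>_. S))"
    and win: "\<And>i. (\<lambda>\<omega>. G (shifted i \<omega>)) \<in> borel_measurable (window_algebra {i - m..i + m})"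
    and sq: "sq_integrable M (\<lambda>\<omega>. G (shifted 0 \<omega>))"
    and mean: "expectation (\<lambda>\<omega>. G (shifted 0 \<omega>)) = 0"
    and A: "finite A" and m: "m \<ge> 0"
  shows "(L2_norm M (\<lambda>\<omega>. \<Sum>i\<in>A. e i * G (shifted i \<omega>)))\<^sup>2
     \<le> (L2_norm M (\<lambda>\<omega>. G (shifted 0 \<omega>)))\<^sup>2 * (2 * real_of_int (2 * m + 1)) * (\<Sum>i\<in>A. (e i)\<^sup>2)"
proof (rule L2_norm_sum_neighbours[where nb = "\<lambda>i j. \<bar>i - j\<bar> < 2 * m + 1"])
  let ?Z = "\<lambda>i \<omega>. G (shifted i \<omega>)"
  show sqi: "sq_integrable M (?Z i)" for i
    using sq L2_functional_shifted(1)[OF G, of i 0] by simp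
  fix i j
  show "\<bar>expectation (\<lambda>\<omega>. ?Z i \<omega> * ?Z j \<omega>)\<bar> \<le> (if \<bar>i - j\<bar> < 2 * m + 1 then (L2_norm M (?Z 0))\<^sup>2 else 0)"
  proof (cases "\<bar>i - j\<bar> < 2 * m + 1")
    case True
    then show ?thesis
      using L2_norm_Cauchy_Schwarz[OF sqi[of i] sqi[of j]] L2_functional_shifted(2)[OF G, of i 0]
        L2_functional_shifted(2)[OF G, of j 0] by (simp add: power2_eq_square)
  next
    case False
    have "expectation (\<lambda>\<omega>. ?Z i \<omega> * ?Z j \<omega>) = 0"
    proof (rule expectation_mult_windows_zero[OF _ win sqi _ win sqi])
      show "{i - m..i + m} \<inter> {j - m..j + m} = {}" using False by auto
      show "expectation (?Z i) = 0" using expectation_functional_shifted[OF G, of i 0] mean by simp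
    qed
    then show ?thesis using False by simp
  qed
next
  fix i
  show "real (card {j \<in> A. \<bar>i - j\<bar> < 2 * m + 1}) \<le> 2 * real_of_int (2 * m + 1)"
    using card_int_neighbours[of A i "2 * m + 1"] m by simp
qed (use A in auto)

text \<open>
  The block length \<open>p\<close> is \<open>p0 + q\<close>, where \<open>q = 2 * m + 1\<close> is the gap that makes block sums independent
  and \<open>p0\<close> is chosen so large that the weights in the gaps, a proportion \<open>q / p\<close> of all, contribute
  little.  The limiting variance depends on \<open>p\<close>; it converges by the approximation lemma.
\<close>

theorem m_dependent_clt:
  fixes a :: "nat \<Rightarrow> int \<Rightarrow> real"
  assumes G [measurable]: "G \<in> borel_measurable (PiM UNIV (\<lambda>_. S))"
    and win: "\<And>i. (\<lambda>\<omega>. G (shifted i \<omega>)) \<in> borel_measurable (window_algebra {i - m..i + m})"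
    and sq: "sq_integrable M (\<lambda>\<omega>. G (shifted 0 \<omega>))"
    and mean: "expectation (\<lambda>\<omega>. G (shifted 0 \<omega>)) = 0"
    and bound: "\<forall>\<^sub>F n in sequentially. \<forall>i\<in>{1..int n}. \<bar>a n i\<bar> \<le> B / sqrt (real n)"
    and smooth: "(\<lambda>n. \<Sum>i=1..int n - 1. (a n (i + 1) - a n i)\<^sup>2) \<longlonglongrightarrow> 0"
    and total: "(\<lambda>n. \<Sum>i=1..int n. (a n i)\<^sup>2) \<longlonglongrightarrow> s"
    and m: "m \<ge> 0" and B: "B \<ge> 0"
  shows "asymp_normal M (\<lambda>n \<omega>. \<Sum>i=1..int n. a n i * G (shifted i \<omega>))"
proof (rule asymp_normal_approx)
  let ?Z = "\<lambda>i \<omega>. G (shifted i \<omega>)"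
  have sqi: "sq_integrable M (?Z i)" for i
    using sq L2_functional_shifted(1)[OF G, of i 0] by simp
  show "sq_integrable M (\<lambda>\<omega>. \<Sum>i=1..int n. a n i * ?Z i \<omega>)" for n
    by (intro sq_integrable_intros sqi)
  fix e :: real assume e: "e > 0"
  define q where "q = nat (2 * m + 1)"
  define C where "C = (L2_norm M (?Z 0))\<^sup>2 * (2 * real q)"
  have C0: "C \<ge> 0" by (simp add: C_def)
  have q: "real_of_int (2 * m + 1) = real q" "q > 0" "int q = 2 * m + 1" using m by (auto simp: q_def)
  define D where "D n = (\<Sum>i=1..int n - 1. (a n (i + 1) - a n i)\<^sup>2)" for n
  \<comment> \<open>\<open>C * B\<^sup>2 * q / p\<close> is the limit of the bound on the squared error.\<close>
  obtain p0 :: nat where p0: "real p0 > C * (B\<^sup>2 * real q) / e\<^sup>2" using reals_Archimedean2 by blast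
  define p where "p = p0 + q"
  define L where "L = p0"
  have p: "p > 0" "L \<le> p" "p - L = q" using q(2) by (auto simp: p_def L_def)
  have pe: "C * (B\<^sup>2 * real q / real p) < e\<^sup>2"
  proof -
    have "C * (B\<^sup>2 * real q) / e\<^sup>2 < real p" using p0 by (simp add: p_def)
    then show ?thesis using e p(1) by (simp add: field_simps)
  qed
  define U where "U b \<omega> = (\<Sum>r<L. ?Z (int b * int p + 1 + int r) \<omega>)" for b \<omega>
  define I where "I n = block_index p ` ({..<n div p} \<times> {..<L})" for n
  have I: "I n \<subseteq> {1..int n}" "finite (I n)" for n
    unfolding I_def using block_index_image_subset[OF p(2), of "n div p" n] by auto
  define T' where "T' n \<omega> = (\<Sum>b<n div p. a n (int b * int p + 1) * U b \<omega>)" for n \<omega>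
  show "\<exists>T'. (\<forall>n. sq_integrable M (T' n)) \<and> asymp_normal M T' \<and>
        (\<forall>\<^sub>F n in sequentially. L2_norm M (\<lambda>\<omega>. (\<Sum>i=1..int n. a n i * ?Z i \<omega>) - T' n \<omega>) \<le> e)"
  proof (intro exI[of _ T'] conjI allI)
    show "sq_integrable M (T' n)" for n
      unfolding T'_def U_def by (intro sq_integrable_intros sqi)
    show "asymp_normal M T'"
      unfolding T'_def
    proof (rule asymp_normal_weighted_iid)
      define GU where "GU x = (\<Sum>r<L. G (\<lambda>k. x (1 + int r + k)))" for x :: "int \<Rightarrow> 'b"
      have [measurable]: "(\<lambda>x k. x (c + k)) \<in> measurable (PiM UNIV (\<lambda>_. S)) (PiM UNIV (\<lambda>_. S))" for c :: int
        by (rule measurable_PiM_single') (auto simp: space_PiM)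
      have GU [measurable]: "GU \<in> borel_measurable (PiM UNIV (\<lambda>_. S))"
        unfolding GU_def by measurable
      have UGU: "U b = (\<lambda>\<omega>. GU (shifted (int b * int p) \<omega>))" for b
        by (auto simp: U_def GU_def shifted_def algebra_simps intro!: sum.cong)
      show "distr M borel (U b) = distr M borel (U 0)" for b
        unfolding UGU by (rule distr_functional_shifted[OF GU])
      show "sq_integrable M (U 0)" unfolding U_def by (intro sq_integrable_intros sqi)
      show "expectation (U 0) = 0"
        unfolding U_def using sq_integrable_imp_integrable[OF sqi] expectation_functional_shifted[OF G, of _ 0] mean
        by (subst Bochner_Integration.integral_sum) auto
      show "(\<lambda>n. B / sqrt (real n)) \<longlonglongrightarrow> 0"
        by (intro tendsto_divide_0[OF tendsto_const] filterlim_at_top_imp_at_infinity filterlim_compose[OF sqrt_at_top] filterlim_real_sequentially)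
      show "\<forall>\<^sub>F n in sequentially. \<forall>b<n div p. \<bar>a n (int b * int p + 1)\<bar> \<le> B / sqrt (real n)"
        using bound
      proof eventually_elim
        case (elim n)
        show ?case
        proof (intro allI impI)
          fix b assume "b < n div p"
          then have "block_index p (b, 0) \<in> {1..int n}"
            using p(1) by (intro subsetD[OF block_index_image_subset[of p p "n div p"]] imageI) auto
          then show "\<bar>a n (int b * int p + 1)\<bar> \<le> B / sqrt (real n)"
            using elim by (simp add: block_index_def)
        qed
      qed
      show "(\<lambda>n. \<Sum>b<n div p. (a n (int b * int p + 1))\<^sup>2) \<longlonglongrightarrow> s / real p"
        by (rule sampled_weights_energy[OF p(1) B bound smooth total])
      show "indep_vars (\<lambda>_. borel) U UNIV"
      proof (rule indep_vars_windows[of "\<lambda>b. {int b * int p + 1 - m..int b * int p + int L + m}"])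
        have dis: "{int b * int p + 1 - m..int b * int p + int L + m} \<inter> {int b' * int p + 1 - m..int b' * int p + int L + m} = {}"
          if "b < b'" for b b'
        proof -
          have "(int b + 1) * int p \<le> int b' * int p" using that by (intro mult_right_mono) auto
          then have "int b * int p + int p \<le> int b' * int p" by (simp add: algebra_simps)
          moreover have "int p = int L + 2 * m + 1" using q(3) by (simp add: p_def L_def)
          ultimately show ?thesis by auto
        qed
        show "disjoint_family_on (\<lambda>b. {int b * int p + 1 - m..int b * int p + int L + m}) UNIV"
          unfolding disjoint_family_on_def
        proof (intro ballI impI)
          fix b b' :: nat assume "b \<noteq> b'"
          then show "{int b * int p + 1 - m..int b * int p + int L + m} \<inter> {int b' * int p + 1 - m..int b' * int p + int L + m} = {}"
            using dis[of b b'] dis[of b' b] by (cases "b < b'") (auto simp: Int_commute)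
        qed
        show "U b \<in> borel_measurable (window_algebra {int b * int p + 1 - m..int b * int p + int L + m})" for b
          unfolding U_def by (intro borel_measurable_sum measurable_window_mono[OF win]) auto
      qed
    qed
    have err: "\<forall>\<^sub>F n in sequentially. (L2_norm M (\<lambda>\<omega>. (\<Sum>i=1..int n. a n i * ?Z i \<omega>) - T' n \<omega>))\<^sup>2
         \<le> C * ((real p)\<^sup>2 * D n + (B\<^sup>2 * real q / real p + B\<^sup>2 * real p / real n))"
      using bound eventually_gt_at_top[of 0]
    proof eventually_elim
      case (elim n)
      \<comment> \<open>\<open>st i\<close> is the first index of the block that contains \<open>i\<close>.\<close>
      define st where "st i = (i - 1) div int p * int p + 1" for i :: int
      have st: "st (int b * int p + 1 + int r) = int b * int p + 1" if "r < L" for b r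
      proof -
        have "(int b * int p + int r) div int p = int b"
          using that p by (auto simp flip: of_nat_mult of_nat_add of_nat_div)
        then show ?thesis unfolding st_def by (simp add: algebra_simps)
      qed
      define d where "d i = (if i \<in> I n then a n i - a n (st i) else a n i)" for i
      have T'_eq: "T' n \<omega> = (\<Sum>i\<in>I n. a n (st i) * ?Z i \<omega>)" for \<omega>
        unfolding I_def sum_block_index[OF p(2)] T'_def U_def sum_distrib_left
        by (intro sum.cong refl) (simp add: st)
      have "(\<Sum>i=1..int n. a n i * ?Z i \<omega>) - T' n \<omega> = (\<Sum>i=1..int n. d i * ?Z i \<omega>)" for \<omega>
      proof -
        have "T' n \<omega> = (\<Sum>i=1..int n. if i \<in> I n then a n (st i) * ?Z i \<omega> else 0)"
          unfolding T'_eq using I(1)[of n] by (simp add: sum.inter_restrict[symmetric] Int_absorb1)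
        then show ?thesis
          by (simp add: sum_subtractf[symmetric] d_def if_distrib if_distribR algebra_simps cong: if_cong sum.cong)
      qed
      then have "(L2_norm M (\<lambda>\<omega>. (\<Sum>i=1..int n. a n i * ?Z i \<omega>) - T' n \<omega>))\<^sup>2 \<le> C * (\<Sum>i=1..int n. (d i)\<^sup>2)"
        using L2_norm_m_dependent_sum[OF G win sq mean, of "{1..int n}" d] m by (simp add: C_def q(1)[symmetric])
      also have "(\<Sum>i=1..int n. (d i)\<^sup>2) = (\<Sum>i\<in>{1..int n} - I n. (d i)\<^sup>2) + (\<Sum>i\<in>I n. (d i)\<^sup>2)"
        by (rule sum.subset_diff[OF I(1)]) simp
      also have "(\<Sum>i\<in>I n. (d i)\<^sup>2) = (\<Sum>i\<in>I n. (a n i - a n (st i))\<^sup>2)"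
        by (simp add: d_def)
      also have "\<dots> = (\<Sum>b<n div p. \<Sum>r<L. (a n (int b * int p + 1 + int r) - a n (int b * int p + 1))\<^sup>2)"
        unfolding I_def sum_block_index[OF p(2)] by (intro sum.cong refl) (simp add: st)
      also have "\<dots> \<le> (real p)\<^sup>2 * D n"
        unfolding D_def by (rule block_oscillation_le[OF p(1,2)]) simp
      also have "(\<Sum>i\<in>{1..int n} - I n. (d i)\<^sup>2) \<le> (\<Sum>i\<in>{1..int n} - I n. B\<^sup>2 / n)"
      proof (intro sum_mono)
        fix i assume i: "i \<in> {1..int n} - I n"
        then have "\<bar>a n i\<bar> \<le> B / sqrt n" using elim(1) by auto
        then have "\<bar>a n i\<bar>\<^sup>2 \<le> (B / sqrt n)\<^sup>2" by (intro power_mono) auto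
        then show "(d i)\<^sup>2 \<le> B\<^sup>2 / n" using i by (simp add: power_divide d_def)
      qed
      also have "\<dots> = real (card ({1..int n} - I n)) * (B\<^sup>2 / n)" by simp
      also have "\<dots> \<le> (real n * real q / real p + real p) * (B\<^sup>2 / n)"
        using card_block_complement[OF p(2,1), of n] p(3) unfolding I_def by (intro mult_right_mono) auto
      also have "\<dots> = B\<^sup>2 * real q / real p + B\<^sup>2 * real p / real n"
        using elim(2) p(1) by (simp add: field_simps)
      finally show ?case using C0 by (simp add: mult_left_mono add.commute)
    qed
    have lim: "(\<lambda>n. C * ((real p)\<^sup>2 * D n + (B\<^sup>2 * real q / real p + B\<^sup>2 * real p / real n)))
       \<longlonglongrightarrow> C * ((real p)\<^sup>2 * 0 + (B\<^sup>2 * real q / real p + 0))"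
      using smooth unfolding D_def[symmetric] by (intro tendsto_intros lim_const_over_n)
    then have "\<forall>\<^sub>F n in sequentially. C * ((real p)\<^sup>2 * D n + (B\<^sup>2 * real q / real p + B\<^sup>2 * real p / real n)) < e\<^sup>2"
      by (rule order_tendstoD) (use pe in simp)
    with err show "\<forall>\<^sub>F n in sequentially. L2_norm M (\<lambda>\<omega>. (\<Sum>i=1..int n. a n i * ?Z i \<omega>) - T' n \<omega>) \<le> e"
    proof eventually_elim
      case (elim n)
      then have "(L2_norm M (\<lambda>\<omega>. (\<Sum>i=1..int n. a n i * ?Z i \<omega>) - T' n \<omega>))\<^sup>2 \<le> e\<^sup>2" by linarith
      then show ?case by (rule power2_le_imp_le) (use e in simp)
    qed
  qed
qed

end

section \<open>Weighted sums over pairs of indices\<close>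

text \<open>
  Each distance occurs at most twice, once on either side of \<open>i\<close>.
\<close>

lemma sum_int_distances_le:
  fixes f :: "nat \<Rightarrow> real" and A :: "int set"
  assumes f: "summable f" "\<And>k. f k \<ge> 0" and A: "finite A"
  shows "(\<Sum>j\<in>A. f (nat \<bar>i - j\<bar>)) \<le> 2 * suminf f"
proof -
  have half: "(\<Sum>j\<in>B. f (nat \<bar>i - j\<bar>)) \<le> suminf f" if "finite B" "inj_on (\<lambda>j. nat \<bar>i - j\<bar>) B" for B
  proof -
    have "(\<Sum>j\<in>B. f (nat \<bar>i - j\<bar>)) = sum f ((\<lambda>j. nat \<bar>i - j\<bar>) ` B)"
      by (simp add: sum.reindex[OF that(2)] comp_def)
    also have "\<dots> \<le> suminf f" using that(1) f by (intro sum_le_suminf) auto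
    finally show ?thesis .
  qed
  have "(\<Sum>j\<in>A. f (nat \<bar>i - j\<bar>)) = (\<Sum>j\<in>{j\<in>A. j \<le> i}. f (nat \<bar>i - j\<bar>)) + (\<Sum>j\<in>{j\<in>A. j > i}. f (nat \<bar>i - j\<bar>))"
    using A by (subst sum.union_disjoint[symmetric]) (auto intro!: sum.cong)
  also have "\<dots> \<le> suminf f + suminf f"
    using A by (intro add_mono half) (auto simp: inj_on_def)
  finally show ?thesis by simp
qed

text \<open>
  Summing one of the four terms over both pairs, the weights of the two indices that it does not
  mention are summed first and give \<open>V\<^sup>2\<close>; the remaining double sum of \<open>\<rho>\<close> over distances is at most
  \<open>2 * suminf \<rho> * n\<close>.  Evenness of \<open>v\<close> makes row and column sums equal.
\<close>

lemma L2_norm_pair_sum: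
  fixes \<xi> :: "int \<Rightarrow> int \<Rightarrow> 'a \<Rightarrow> real" and v :: "int \<Rightarrow> real"
  assumes sq: "\<And>i j. sq_integrable M (\<xi> i j)"
    and cov: "\<And>i j i' j'. \<bar>\<integral>\<omega>. \<xi> i j \<omega> * \<xi> i' j' \<omega> \<partial>M\<bar>
          \<le> \<rho> (nat \<bar>i - i'\<bar>) + \<rho> (nat \<bar>i - j'\<bar>) + \<rho> (nat \<bar>j - i'\<bar>) + \<rho> (nat \<bar>j - j'\<bar>)"
    and v: "\<And>k. v (- k) = v k"
    and V: "\<And>i. i \<in> {1..int n} \<Longrightarrow> (\<Sum>j=1..int n. \<bar>v (i - j)\<bar>) \<le> V" "V \<ge> 0"
    and \<rho>: "\<And>k. \<rho> k \<ge> 0" "summable \<rho>"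
  shows "(L2_norm M (\<lambda>\<omega>. \<Sum>i=1..int n. \<Sum>j=1..int n. v (i - j) * \<xi> i j \<omega>))\<^sup>2
      \<le> 8 * suminf \<rho> * V\<^sup>2 * real n"
proof -
  define N where "N = {1..int n}"
  have N: "finite N" by (simp add: N_def)
  define u where "u p = (case p of (i, j) \<Rightarrow> v (i - j))" for p
  let ?A = "N \<times> N"
  have one: "(\<Sum>p\<in>?A. \<bar>u p\<bar> * \<phi> (g p)) \<le> V * (\<Sum>i\<in>N. \<phi> i)"
    if g: "g = fst \<or> g = snd" and \<phi>: "\<And>i. \<phi> i \<ge> 0" for g :: "int \<times> int \<Rightarrow> int" and \<phi> :: "int \<Rightarrow> real"
  proof -
    have "(\<Sum>p\<in>?A. \<bar>u p\<bar> * \<phi> (g p)) = (\<Sum>i\<in>N. (\<Sum>j\<in>N. \<bar>v (i - j)\<bar>) * \<phi> i)"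
      using g
    proof
      assume "g = fst"
      then show ?thesis by (simp add: u_def sum.cartesian_product case_prod_beta sum_distrib_right)
    next
      assume g: "g = snd"
      have "(\<Sum>p\<in>?A. \<bar>u p\<bar> * \<phi> (g p)) = (\<Sum>i\<in>N. \<Sum>j\<in>N. \<bar>v (i - j)\<bar> * \<phi> j)"
        by (simp add: g u_def sum.cartesian_product case_prod_beta)
      also have "\<dots> = (\<Sum>j\<in>N. \<Sum>i\<in>N. \<bar>v (i - j)\<bar> * \<phi> j)" by (rule sum.swap)
      also have "\<dots> = (\<Sum>j\<in>N. \<Sum>i\<in>N. \<bar>v (j - i)\<bar> * \<phi> j)"
        by (intro sum.cong refl) (metis minus_diff_eq v)
      finally show ?thesis by (simp add: sum_distrib_right)
    qed
    also have "\<dots> \<le> (\<Sum>i\<in>N. V * \<phi> i)"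
      using V(1) \<phi> by (intro sum_mono mult_right_mono) (auto simp: N_def)
    finally show ?thesis by (simp add: sum_distrib_left)
  qed
  have two: "(\<Sum>p\<in>?A. \<Sum>q\<in>?A. \<bar>u p\<bar> * \<bar>u q\<bar> * \<rho> (nat \<bar>g p - g' q\<bar>)) \<le> 2 * suminf \<rho> * V\<^sup>2 * real n"
    if g: "g = fst \<or> g = snd" "g' = fst \<or> g' = snd" for g g'
  proof -
    have "(\<Sum>p\<in>?A. \<Sum>q\<in>?A. \<bar>u p\<bar> * \<bar>u q\<bar> * \<rho> (nat \<bar>g p - g' q\<bar>))
        = (\<Sum>p\<in>?A. \<bar>u p\<bar> * (\<Sum>q\<in>?A. \<bar>u q\<bar> * \<rho> (nat \<bar>g p - g' q\<bar>)))"
      by (simp add: sum_distrib_left mult.assoc)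
    also have "\<dots> \<le> (\<Sum>p\<in>?A. \<bar>u p\<bar> * (V * (2 * suminf \<rho>)))"
    proof (intro sum_mono mult_left_mono)
      fix p
      have "(\<Sum>q\<in>?A. \<bar>u q\<bar> * \<rho> (nat \<bar>g p - g' q\<bar>)) \<le> V * (\<Sum>j\<in>N. \<rho> (nat \<bar>g p - j\<bar>))"
        by (rule one[OF g(2), of "\<lambda>j. \<rho> (nat \<bar>g p - j\<bar>)"]) (rule \<rho>)
      also have "\<dots> \<le> V * (2 * suminf \<rho>)"
        by (intro mult_left_mono sum_int_distances_le \<rho> N V)
      finally show "(\<Sum>q\<in>?A. \<bar>u q\<bar> * \<rho> (nat \<bar>g p - g' q\<bar>)) \<le> V * (2 * suminf \<rho>)" .
    qed auto
    also have "\<dots> \<le> V * (\<Sum>i\<in>N. V * (2 * suminf \<rho>))"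
      using V(2) suminf_nonneg[OF \<rho>(2,1)] by (intro one[of fst]) auto
    also have "\<dots> = 2 * suminf \<rho> * V\<^sup>2 * real n" by (simp add: N_def power2_eq_square)
    finally show ?thesis .
  qed
  define c where "c p q = \<rho> (nat \<bar>fst p - fst q\<bar>) + \<rho> (nat \<bar>fst p - snd q\<bar>) + \<rho> (nat \<bar>snd p - fst q\<bar>) + \<rho> (nat \<bar>snd p - snd q\<bar>)" for p q
  have "(L2_norm M (\<lambda>\<omega>. \<Sum>p\<in>?A. u p * (case p of (i, j) \<Rightarrow> \<xi> i j) \<omega>))\<^sup>2 \<le> (\<Sum>p\<in>?A. \<Sum>q\<in>?A. \<bar>u p\<bar> * \<bar>u q\<bar> * c p q)"
    by (rule L2_norm_sum_square_le) (use N sq cov in \<open>auto simp: c_def\<close>)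
  also have "\<dots> \<le> 4 * (2 * suminf \<rho> * V\<^sup>2 * real n)"
    using two[of fst fst] two[of fst snd] two[of snd fst] two[of snd snd]
    by (simp add: c_def distrib_left sum.distrib)
  finally show ?thesis
    by (simp add: u_def N_def sum.cartesian_product case_prod_beta)
qed

section \<open>The kernel variables and their truncations\<close>

locale kernel_process = iid_sequence M S eps for M :: "'a measure" and S :: "'b measure" and eps +
  fixes F :: "(nat \<Rightarrow> 'b) \<Rightarrow> real" and Fl :: "nat \<Rightarrow> (nat \<Rightarrow> 'b) \<Rightarrow> real"
    and K :: "real \<Rightarrow> real \<Rightarrow> real"
  assumes F_measurable [measurable]: "F \<in> borel_measurable (PiM UNIV (\<lambda>_. S))"
    and K_measurable: "(\<lambda>(x, y). K x y) \<in> borel_measurable (borel \<Otimes>\<^sub>M borel)"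
    and K_sym: "K x y = K y x"
    and Fl_measurable: "l \<ge> 1 \<Longrightarrow> Fl l \<in> borel_measurable (PiM {..<l} (\<lambda>_. S))"
    and finite_var: "finite_variances M K (proc F eps)"
    and finite_var_trunc: "l \<ge> 1 \<Longrightarrow> finite_variances M K (proc_trunc Fl eps l)"
    and delta_summable: "(\<Sum>i. SUP l\<in>{i..}. delta M K F Fl eps l) < \<infinity>"
begin

abbreviation "Y \<equiv> centred_kernel M K (proc F eps)"
abbreviation "Yt \<equiv> Y_trunc M K Fl eps"

lemma K_measurable_compose [measurable (raw)]:
  "f \<in> borel_measurable N \<Longrightarrow> g \<in> borel_measurable N \<Longrightarrow> (\<lambda>x. K (f x) (g x)) \<in> borel_measurable N"
  using measurable_compose[OF measurable_Pair K_measurable, of f N g] by simp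

text \<open>
  The process at time \<open>i\<close> and its truncation, as functionals of a whole sequence of innovations; this
  is the form in which the shift acts on them.
\<close>

definition past_at :: "int \<Rightarrow> (int \<Rightarrow> 'b) \<Rightarrow> real" where
  "past_at i x = F (\<lambda>m. x (i - int m))"

definition window_at :: "nat \<Rightarrow> int \<Rightarrow> (int \<Rightarrow> 'b) \<Rightarrow> real" where
  "window_at l i x = Fl l (\<lambda>m\<in>{..<l}. x (i - int m))"

lemma past_at_measurable [measurable]: "past_at i \<in> borel_measurable (PiM UNIV (\<lambda>_. S))"
proof -
  have "(\<lambda>x m. x (i - int m)) \<in> measurable (PiM UNIV (\<lambda>_. S)) (PiM UNIV (\<lambda>_. S))"
    by (rule measurable_PiM_single') (auto simp: space_PiM)
  then show ?thesis unfolding past_at_def[abs_def] by measurable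
qed

lemma window_at_measurable: 
  assumes "l \<ge> 1"
  shows "window_at l i \<in> borel_measurable (PiM UNIV (\<lambda>_. S))"
  unfolding window_at_def[abs_def]
  by (rule measurable_compose[OF _ Fl_measurable[OF assms]]) (intro measurable_restrict measurable_component_singleton, simp)

lemma proc_shifted: "proc F eps (s + i) \<omega> = past_at i (shifted s \<omega>)"
  by (simp add: proc_def past_seq_def past_at_def shifted_def algebra_simps)

lemma proc_trunc_shifted: "proc_trunc Fl eps l (s + i) \<omega> = window_at l i (shifted s \<omega>)"
  by (simp add: proc_trunc_def past_window_def window_at_def shifted_def algebra_simps)

lemma proc_measurable [measurable]: "proc F eps i \<in> borel_measurable M"
  using measurable_compose[OF shifted_measurable[of i] past_at_measurable[of 0]]
  by (simp add: proc_shifted[of i 0, simplified, symmetric])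

lemma proc_trunc_window:
  assumes "l \<ge> 1"
  shows "proc_trunc Fl eps l i \<in> borel_measurable (window_algebra {i - int l<..i})"
  unfolding proc_trunc_def past_window_def
  by (rule measurable_compose[OF _ Fl_measurable[OF assms]], intro measurable_restrict eps_measurable_window) auto

lemma proc_trunc_measurable: "l \<ge> 1 \<Longrightarrow> proc_trunc Fl eps l i \<in> borel_measurable M"
  by (rule measurable_window_imp[OF proc_trunc_window])

definition kernel_at :: "(int \<Rightarrow> (int \<Rightarrow> 'b) \<Rightarrow> real) \<Rightarrow> int \<Rightarrow> int \<Rightarrow> (int \<Rightarrow> 'b) \<Rightarrow> real" where
  "kernel_at X i j x = K (X i x) (X j x) - expectation (\<lambda>\<omega>. K (X i (shifted 0 \<omega>)) (X j (shifted 0 \<omega>)))"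

lemma kernel_at_measurable:
  assumes [measurable]: "\<And>i. X i \<in> borel_measurable (PiM UNIV (\<lambda>_. S))"
  shows "kernel_at X i j \<in> borel_measurable (PiM UNIV (\<lambda>_. S))"
  unfolding kernel_at_def[abs_def] by measurable

lemma centred_kernel_shifted:
  assumes [measurable]: "\<And>i. X i \<in> borel_measurable (PiM UNIV (\<lambda>_. S))"
    and P: "\<And>s i \<omega>. P (s + i) \<omega> = X i (shifted s \<omega>)"
  shows "centred_kernel M K P (s + i) (s + j) \<omega> = kernel_at X i j (shifted s \<omega>)"
proof -
  have "expectation (\<lambda>\<omega>'. K (P (s + i) \<omega>') (P (s + j) \<omega>')) = expectation (\<lambda>\<omega>. K (X i (shifted 0 \<omega>)) (X j (shifted 0 \<omega>)))"
    unfolding P by (rule expectation_functional_shifted[of "\<lambda>x. K (X i x) (X j x)"]) measurable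
  then show ?thesis by (simp add: centred_kernel_def kernel_at_def P)
qed

lemma Y_shifted: "Y (s + i) (s + j) \<omega> = kernel_at past_at i j (shifted s \<omega>)"
  by (rule centred_kernel_shifted[OF past_at_measurable proc_shifted])

definition trunc_kernel_at :: "nat \<Rightarrow> int \<Rightarrow> int \<Rightarrow> (int \<Rightarrow> 'b) \<Rightarrow> real" where
  "trunc_kernel_at l i j x = (if l = 0 then 0 else kernel_at (window_at l) i j x)"

lemma trunc_kernel_at_measurable [measurable]: "trunc_kernel_at l i j \<in> borel_measurable (PiM UNIV (\<lambda>_. S))"
  by (cases "l = 0") (auto simp: trunc_kernel_at_def[abs_def] intro!: kernel_at_measurable window_at_measurable)

lemma Yt_shifted: "Yt l (s + i) (s + j) \<omega> = trunc_kernel_at l i j (shifted s \<omega>)"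
  by (cases "l = 0") (auto simp: Y_trunc_def trunc_kernel_at_def
    intro!: centred_kernel_shifted window_at_measurable proc_trunc_shifted)

lemma Y_sq_integrable: "sq_integrable M (Y i j)"
  using finite_var unfolding finite_variances_def sq_integrable_def centred_kernel_def[abs_def] by auto

lemma Yt_sq_integrable: "sq_integrable M (Yt l i j)"
proof (cases "l = 0")
  case False
  then have [measurable]: "proc_trunc Fl eps l i \<in> borel_measurable M" for i
    by (intro proc_trunc_measurable) auto
  show ?thesis
    using finite_var_trunc[of l] False
    unfolding finite_variances_def sq_integrable_def Y_trunc_def[abs_def] centred_kernel_def[abs_def] by auto
qed (simp add: Y_trunc_def[abs_def] sq_integrable_zero)

lemma Yt_mean: "expectation (Yt l i j) = 0"
proof (cases "l = 0")
  case False
  then show ?thesis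
    using finite_var_trunc[of l]
    unfolding finite_variances_def Y_trunc_def[abs_def] centred_kernel_def[abs_def] by (simp add: prob_space)
qed (simp add: Y_trunc_def[abs_def])

lemma Yt_window: "Yt l i j \<in> borel_measurable (window_algebra ({i - int l<..i} \<union> {j - int l<..j}))"
proof (cases "l = 0")
  case False
  have [measurable]: "proc_trunc Fl eps l i' \<in> borel_measurable (window_algebra ({i - int l<..i} \<union> {j - int l<..j}))"
    if "i' = i \<or> i' = j" for i'
    by (rule measurable_window_mono[OF proc_trunc_window]) (use that False in auto)
  show ?thesis using False unfolding Y_trunc_def[abs_def] centred_kernel_def[abs_def] by simp
qed (simp add: Y_trunc_def[abs_def])

text \<open>
  The real-valued form of the suprema whose summability is assumed; they are finite because their sum is.
\<close>

definition tail_delta :: "nat \<Rightarrow> real" where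
  "tail_delta i = enn2real (SUP l\<in>{i..}. delta M K F Fl eps l)"

lemma tail_delta_nonneg [simp]: "tail_delta i \<ge> 0"
  by (simp add: tail_delta_def)

lemma ennreal_tail_delta: "ennreal (tail_delta i) = (SUP l\<in>{i..}. delta M K F Fl eps l)"
proof -
  have "(SUP l\<in>{i..}. delta M K F Fl eps l) \<le> (\<Sum>i. SUP l\<in>{i..}. delta M K F Fl eps l)"
    using sum_le_suminf[of "\<lambda>i. SUP l\<in>{i..}. delta M K F Fl eps l" "{i}"] by (simp add: summableI)
  then have "(SUP l\<in>{i..}. delta M K F Fl eps l) < \<infinity>" using delta_summable by (rule le_less_trans)
  then show ?thesis by (simp add: tail_delta_def)
qed

lemma tail_delta_summable: "summable tail_delta"
proof -
  have "(\<Sum>i. ennreal (tail_delta i)) \<noteq> \<infinity>"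
    using delta_summable by (simp add: ennreal_tail_delta)
  then show ?thesis by (intro summable_suminf_not_top) auto
qed

lemma tail_delta_tendsto_0: "tail_delta \<longlonglongrightarrow> 0"
  by (rule summable_LIMSEQ_zero[OF tail_delta_summable])

text \<open>
  By stationarity the first index may be moved to \<open>1\<close>, where the supremum over \<open>j\<close> in \<open>delta\<close> applies.
\<close>

lemma L2_norm_Y_diff_le:
  assumes "m \<le> l"
  shows "L2_norm M (\<lambda>\<omega>. Y i j \<omega> - Yt l i j \<omega>) \<le> tail_delta m"
proof -
  let ?G = "\<lambda>x. kernel_at past_at 1 (j - i + 1) x - trunc_kernel_at l 1 (j - i + 1) x"
  have [measurable]: "kernel_at past_at 1 (j - i + 1) \<in> borel_measurable (PiM UNIV (\<lambda>_. S))"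
    by (rule kernel_at_measurable) simp
  have G: "?G \<in> borel_measurable (PiM UNIV (\<lambda>_. S))" by measurable
  have eq: "Y (s + 1) (s + (j - i + 1)) \<omega> - Yt l (s + 1) (s + (j - i + 1)) \<omega> = ?G (shifted s \<omega>)" for s \<omega>
    by (simp only: Y_shifted Yt_shifted)
  have "L2_norm M (\<lambda>\<omega>. Y i j \<omega> - Yt l i j \<omega>) = L2_norm M (\<lambda>\<omega>. ?G (shifted (i - 1) \<omega>))"
    using eq[of "i - 1"] by simp
  also have "\<dots> = L2_norm M (\<lambda>\<omega>. ?G (shifted 0 \<omega>))" by (rule L2_functional_shifted(2)[OF G])
  also have "\<dots> = L2_norm M (\<lambda>\<omega>. Y 1 (j - i + 1) \<omega> - Yt l 1 (j - i + 1) \<omega>)"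
    using eq[of 0] by simp
  finally have 1: "L2_norm M (\<lambda>\<omega>. Y i j \<omega> - Yt l i j \<omega>) = L2_norm M (\<lambda>\<omega>. Y 1 (j - i + 1) \<omega> - Yt l 1 (j - i + 1) \<omega>)" .
  have "ennreal (L2_norm M (\<lambda>\<omega>. Y i j \<omega> - Yt l i j \<omega>)) \<le> delta M K F Fl eps l"
    unfolding delta_def 1 by (rule SUP_upper) simp
  also have "\<dots> \<le> (SUP l\<in>{m..}. delta M K F Fl eps l)" using assms by (intro SUP_upper) simp
  finally show ?thesis unfolding ennreal_tail_delta[symmetric] by simp
qed

text \<open>
  At distance \<open>m\<close>, windows of length \<open>m\<close> do not overlap.  Truncating both errors to such windows
  therefore leaves independent centred variables, and each replacement costs \<open>tail_delta m\<close> in \<open>L\<^sup>2\<close>.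
\<close>

lemma truncation_error_covariance:
  assumes m: "int m \<le> \<bar>i - i'\<bar>" "int m \<le> \<bar>i - j'\<bar>" "int m \<le> \<bar>j - i'\<bar>" "int m \<le> \<bar>j - j'\<bar>"
  shows "\<bar>expectation (\<lambda>\<omega>. (Y i j \<omega> - Yt l i j \<omega>) * (Y i' j' \<omega> - Yt l i' j' \<omega>))\<bar>
       \<le> 3 * tail_delta l * tail_delta m"
proof -
  let ?D = "\<lambda>i j \<omega>. Y i j \<omega> - Yt l i j \<omega>"
  \<comment> \<open>\<open>E\<close> is the truncation of the error to windows of length \<open>m\<close>, which vanishes for \<open>m \<le> l\<close> because
    the error then already lies beyond \<open>m\<close>; \<open>R\<close> is what is left.\<close>
  define k where "k = max l m"
  define E where "E i j \<omega> = (if m \<le> l then 0 else Yt m i j \<omega> - Yt l i j \<omega>)" for i j \<omega>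
  define R where "R i j \<omega> = Y i j \<omega> - Yt k i j \<omega>" for i j \<omega>
  have DER: "?D i j \<omega> = E i j \<omega> + R i j \<omega>" for i j \<omega>
    by (simp add: E_def R_def k_def max_def)
  have D_sq: "sq_integrable M (?D i j)" for i j by (intro sq_integrable_diff Y_sq_integrable Yt_sq_integrable)
  have R_sq: "sq_integrable M (R i j)" for i j unfolding R_def by (intro sq_integrable_diff Y_sq_integrable Yt_sq_integrable)
  have E_sq: "sq_integrable M (E i j)" for i j
    unfolding E_def by (cases "m \<le> l") (auto intro!: sq_integrable_diff Yt_sq_integrable sq_integrable_zero)
  have D_le: "L2_norm M (?D i j) \<le> tail_delta l" for i j by (rule L2_norm_Y_diff_le) simp
  have R_le: "L2_norm M (R i j) \<le> tail_delta m" for i j unfolding R_def by (rule L2_norm_Y_diff_le) (simp add: k_def)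
  have R_le': "L2_norm M (R i j) \<le> tail_delta l" for i j unfolding R_def by (rule L2_norm_Y_diff_le) (simp add: k_def)
  have E_le: "L2_norm M (E i j) \<le> 2 * tail_delta l" for i j
  proof -
    have "E i j = (\<lambda>\<omega>. ?D i j \<omega> - R i j \<omega>)" using DER by auto
    then have "L2_norm M (E i j) \<le> L2_norm M (?D i j) + L2_norm M (R i j)"
      using L2_norm_diff_le[OF D_sq R_sq] by simp
    then show ?thesis using D_le[of i j] R_le'[of i j] by simp
  qed
  have E0: "expectation (\<lambda>\<omega>. E i j \<omega> * E i' j' \<omega>) = 0"
  proof (cases "m \<le> l")
    case False
    have win: "E i j \<in> borel_measurable (window_algebra ({i - int m<..i} \<union> {j - int m<..j}))" for i j
    proof -
      have [measurable]: "Yt m i j \<in> borel_measurable (window_algebra ({i - int m<..i} \<union> {j - int m<..j}))"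
        by (rule Yt_window)
      have [measurable]: "Yt l i j \<in> borel_measurable (window_algebra ({i - int m<..i} \<union> {j - int m<..j}))"
        by (rule measurable_window_mono[OF Yt_window]) (use False in auto)
      show ?thesis using False unfolding E_def[abs_def] by simp
    qed
    show ?thesis
    proof (rule expectation_mult_windows_zero[OF _ win E_sq _ win E_sq])
      show "({i - int m<..i} \<union> {j - int m<..j}) \<inter> ({i' - int m<..i'} \<union> {j' - int m<..j'}) = {}"
        using m by auto
      show "expectation (E i j) = 0"
        using False sq_integrable_imp_integrable[OF Yt_sq_integrable] unfolding E_def[abs_def]
        by (simp add: Yt_mean)
    qed
  qed (simp add: E_def)
  have "(\<lambda>\<omega>. ?D i j \<omega> * ?D i' j' \<omega>) = (\<lambda>\<omega>. R i j \<omega> * ?D i' j' \<omega> + (E i j \<omega> * R i' j' \<omega> + E i j \<omega> * E i' j' \<omega>))"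
    unfolding DER by (simp add: algebra_simps)
  then have eq: "expectation (\<lambda>\<omega>. ?D i j \<omega> * ?D i' j' \<omega>) = expectation (\<lambda>\<omega>. R i j \<omega> * ?D i' j' \<omega>) + expectation (\<lambda>\<omega>. E i j \<omega> * R i' j' \<omega>)"
    using sq_integrable_mult[OF R_sq D_sq] sq_integrable_mult[OF E_sq R_sq] sq_integrable_mult[OF E_sq E_sq] E0 by simp
  have "\<bar>expectation (\<lambda>\<omega>. R i j \<omega> * ?D i' j' \<omega>)\<bar> \<le> tail_delta m * tail_delta l"
    using L2_norm_Cauchy_Schwarz[OF R_sq[of i j] D_sq[of i' j']]
      mult_mono[OF R_le[of i j] D_le[of i' j'] tail_delta_nonneg L2_norm_nonneg] by linarith
  moreover have "\<bar>expectation (\<lambda>\<omega>. E i j \<omega> * R i' j' \<omega>)\<bar> \<le> (2 * tail_delta l) * tail_delta m"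
    using L2_norm_Cauchy_Schwarz[OF E_sq[of i j] R_sq[of i' j']]
      mult_mono[OF E_le[of i j] R_le[of i' j'] _ L2_norm_nonneg] by simp
  ultimately have "\<bar>expectation (\<lambda>\<omega>. ?D i j \<omega> * ?D i' j' \<omega>)\<bar> \<le> tail_delta m * tail_delta l + (2 * tail_delta l) * tail_delta m"
    unfolding eq by linarith
  then show ?thesis by (simp add: mult_ac)
qed

text \<open>
  The central estimate.  With \<open>l = 0\<close>, where \<open>Yt 0\<close> vanishes, it bounds the weighted sum of the \<open>Y i j\<close>
  themselves.
\<close>

lemma truncation_error_sum:
  assumes v: "\<And>k. v (- k) = v k"
    and V: "\<And>i. i \<in> {1..int n} \<Longrightarrow> (\<Sum>j=1..int n. \<bar>v (i - j)\<bar>) \<le> V" "V \<ge> 0"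
  shows "(L2_norm M (\<lambda>\<omega>. \<Sum>i=1..int n. \<Sum>j=1..int n. v (i - j) * (Y i j \<omega> - Yt l i j \<omega>)))\<^sup>2
      \<le> 24 * suminf tail_delta * tail_delta l * V\<^sup>2 * real n"
proof -
  define \<rho> where "\<rho> d = (3 * tail_delta l) * tail_delta d" for d
  have "(L2_norm M (\<lambda>\<omega>. \<Sum>i=1..int n. \<Sum>j=1..int n. v (i - j) * (Y i j \<omega> - Yt l i j \<omega>)))\<^sup>2
      \<le> 8 * suminf \<rho> * V\<^sup>2 * real n"
  proof (rule L2_norm_pair_sum)
    show "sq_integrable M (\<lambda>\<omega>. Y i j \<omega> - Yt l i j \<omega>)" for i j
      by (intro sq_integrable_diff Y_sq_integrable Yt_sq_integrable)
    show \<rho>0: "\<rho> k \<ge> 0" for k by (simp add: \<rho>_def)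
    show "summable \<rho>" unfolding \<rho>_def by (intro summable_mult tail_delta_summable)
    have aux: "x \<le> \<rho> a + \<rho> b + \<rho> c + \<rho> d" if "x \<le> \<rho> m" "m = a \<or> m = b \<or> m = c \<or> m = d" for x a b c d m
      using that \<rho>0[of a] \<rho>0[of b] \<rho>0[of c] \<rho>0[of d] by (elim disjE) simp_all
    fix i j i' j'
    define m where "m = nat (min (min \<bar>i - i'\<bar> \<bar>i - j'\<bar>) (min \<bar>j - i'\<bar> \<bar>j - j'\<bar>))"
    have "\<bar>expectation (\<lambda>\<omega>. (Y i j \<omega> - Yt l i j \<omega>) * (Y i' j' \<omega> - Yt l i' j' \<omega>))\<bar> \<le> \<rho> m"
    proof -
      have "int (nat (min (min a b) (min c d))) \<le> a" "int (nat (min (min a b) (min c d))) \<le> b"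
        "int (nat (min (min a b) (min c d))) \<le> c" "int (nat (min (min a b) (min c d))) \<le> d"
        if "a \<ge> 0" "b \<ge> 0" "c \<ge> 0" "d \<ge> 0" for a b c d :: int using that by auto
      note le = this[of "\<bar>i - i'\<bar>" "\<bar>i - j'\<bar>" "\<bar>j - i'\<bar>" "\<bar>j - j'\<bar>", OF abs_ge_zero abs_ge_zero abs_ge_zero abs_ge_zero]
      show ?thesis unfolding \<rho>_def m_def by (rule truncation_error_covariance) (rule le)+
    qed
    moreover have "m = nat \<bar>i - i'\<bar> \<or> m = nat \<bar>i - j'\<bar> \<or> m = nat \<bar>j - i'\<bar> \<or> m = nat \<bar>j - j'\<bar>"
    proof -
      have "nat (min (min a b) (min c d)) = nat a \<or> nat (min (min a b) (min c d)) = nat b \<or>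
          nat (min (min a b) (min c d)) = nat c \<or> nat (min (min a b) (min c d)) = nat d" for a b c d :: int
        by (auto simp: min_def)
      then show ?thesis unfolding m_def .
    qed
    ultimately show "\<bar>expectation (\<lambda>\<omega>. (Y i j \<omega> - Yt l i j \<omega>) * (Y i' j' \<omega> - Yt l i' j' \<omega>))\<bar>
          \<le> \<rho> (nat \<bar>i - i'\<bar>) + \<rho> (nat \<bar>i - j'\<bar>) + \<rho> (nat \<bar>j - i'\<bar>) + \<rho> (nat \<bar>j - j'\<bar>)"
      by (rule aux)
  qed (rule v V | assumption)+
  also have "suminf \<rho> = 3 * tail_delta l * suminf tail_delta"
    unfolding \<rho>_def by (rule suminf_mult[OF tail_delta_summable])
  finally show ?thesis by (simp add: mult_ac)
qed

lemma L2_norm_Yt_le: "L2_norm M (Yt l i j) \<le> 2 * tail_delta 0"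
proof -
  have "L2_norm M (\<lambda>\<omega>. Y i j \<omega> - (Y i j \<omega> - Yt l i j \<omega>)) \<le> L2_norm M (Y i j) + L2_norm M (\<lambda>\<omega>. Y i j \<omega> - Yt l i j \<omega>)"
    by (intro L2_norm_diff_le sq_integrable_diff Y_sq_integrable Yt_sq_integrable)
  moreover have "L2_norm M (Y i j) \<le> tail_delta 0"
    using L2_norm_Y_diff_le[of 0 0 i j] by (simp add: Y_trunc_def)
  moreover have "L2_norm M (\<lambda>\<omega>. Y i j \<omega> - Yt l i j \<omega>) \<le> tail_delta 0" by (rule L2_norm_Y_diff_le) simp
  ultimately show ?thesis by simp
qed

end

section \<open>Absolutely summable weights\<close>

context kernel_process
begin

lemma band_sum_eq:
  fixes g :: "int \<Rightarrow> int \<Rightarrow> real"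
  shows "(\<Sum>j=1..int n. (if \<bar>i - j\<bar> \<le> m then g i j else 0)) = (\<Sum>k=-m..m. if i + k \<in> {1..int n} then g i (i + k) else 0)"
proof -
  have "(\<Sum>j=1..int n. (if \<bar>i - j\<bar> \<le> m then g i j else 0)) = (\<Sum>j\<in>{j\<in>{1..int n}. \<bar>i - j\<bar> \<le> m}. g i j)"
    by (rule sum.inter_filter[symmetric]) simp
  also have "\<dots> = (\<Sum>k\<in>{k\<in>{-m..m}. i + k \<in> {1..int n}}. g i (i + k))"
    by (rule sum.reindex_bij_witness[where i="\<lambda>k. i + k" and j="\<lambda>j. j - i"]) auto
  also have "\<dots> = (\<Sum>k=-m..m. if i + k \<in> {1..int n} then g i (i + k) else 0)"
    by (rule sum.inter_filter) simp
  finally show ?thesis .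
qed

text \<open>
  The two sums differ only in pairs with one index in \<open>{1..n}\<close> and the other outside.  For each of the
  \<open>2 * m + 1\<close> diagonals there are at most \<open>2 * m\<close> of these, independently of \<open>n\<close>.
\<close>

lemma band_boundary_le:
  assumes w: "\<And>k. w (- k) = w k" and m: "m \<ge> 0"
  shows "L2_norm M (\<lambda>\<omega>. (\<Sum>i=1..int n. \<Sum>j=1..int n. (if \<bar>i - j\<bar> \<le> m then w (i - j) else 0) * Yt l i j \<omega>)
       - (\<Sum>i=1..int n. \<Sum>k=-m..m. w k * Yt l i (i + k) \<omega>))
     \<le> (\<Sum>k=-m..m. \<bar>w k\<bar>) * (2 * real_of_int m * (2 * tail_delta 0))"
proof -
  let ?bad = "\<lambda>k. {i\<in>{1..int n}. i + k \<notin> {1..int n}}"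
  have "(\<Sum>i=1..int n. \<Sum>j=1..int n. (if \<bar>i - j\<bar> \<le> m then w (i - j) else 0) * Yt l i j \<omega>)
       - (\<Sum>i=1..int n. \<Sum>k=-m..m. w k * Yt l i (i + k) \<omega>)
     = (\<Sum>k=-m..m. \<Sum>i\<in>?bad k. (- w k) * Yt l i (i + k) \<omega>)" for \<omega>
  proof -
    have "(\<Sum>j=1..int n. (if \<bar>i - j\<bar> \<le> m then w (i - j) else 0) * Yt l i j \<omega>)
        = (\<Sum>k=-m..m. if i + k \<in> {1..int n} then w k * Yt l i (i + k) \<omega> else 0)" for i
    proof -
      have "(\<Sum>j=1..int n. (if \<bar>i - j\<bar> \<le> m then w (i - j) else 0) * Yt l i j \<omega>)
         = (\<Sum>j=1..int n. (if \<bar>i - j\<bar> \<le> m then w (i - j) * Yt l i j \<omega> else 0))"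
        by (intro sum.cong) auto
      also have "\<dots> = (\<Sum>k=-m..m. if i + k \<in> {1..int n} then w (i - (i + k)) * Yt l i (i + k) \<omega> else 0)"
        by (rule band_sum_eq[of i m "\<lambda>i j. w (i - j) * Yt l i j \<omega>" n])
      finally have "(\<Sum>j=1..int n. (if \<bar>i - j\<bar> \<le> m then w (i - j) else 0) * Yt l i j \<omega>)
          = (\<Sum>k=-m..m. if i + k \<in> {1..int n} then w (i - (i + k)) * Yt l i (i + k) \<omega> else 0)" .
      moreover have "w (i - (i + k)) = w k" for k using w[of k] by (simp add: algebra_simps)
      ultimately show ?thesis by presburger
    qed
    then have "(\<Sum>i=1..int n. \<Sum>j=1..int n. (if \<bar>i - j\<bar> \<le> m then w (i - j) else 0) * Yt l i j \<omega>)
       - (\<Sum>i=1..int n. \<Sum>k=-m..m. w k * Yt l i (i + k) \<omega>)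
      = (\<Sum>i=1..int n. \<Sum>k=-m..m. (if i + k \<in> {1..int n} then w k * Yt l i (i + k) \<omega> else 0) - w k * Yt l i (i + k) \<omega>)"
      by (simp only: sum_subtractf)
    also have "\<dots> = (\<Sum>i=1..int n. \<Sum>k=-m..m. if i + k \<notin> {1..int n} then (- w k) * Yt l i (i + k) \<omega> else 0)"
      by (intro sum.cong refl) auto
    also have "\<dots> = (\<Sum>k=-m..m. \<Sum>i=1..int n. if i + k \<notin> {1..int n} then (- w k) * Yt l i (i + k) \<omega> else 0)"
      by (rule sum.swap)
    also have "\<dots> = (\<Sum>k=-m..m. \<Sum>i\<in>?bad k. (- w k) * Yt l i (i + k) \<omega>)"
      by (intro sum.cong refl sum.inter_filter[symmetric]) simp
    finally show ?thesis .
  qed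
  then have "L2_norm M (\<lambda>\<omega>. (\<Sum>i=1..int n. \<Sum>j=1..int n. (if \<bar>i - j\<bar> \<le> m then w (i - j) else 0) * Yt l i j \<omega>)
       - (\<Sum>i=1..int n. \<Sum>k=-m..m. w k * Yt l i (i + k) \<omega>))
     = L2_norm M (\<lambda>\<omega>. \<Sum>k=-m..m. \<Sum>i\<in>?bad k. (- w k) * Yt l i (i + k) \<omega>)"
    by presburger
  also have "\<dots> \<le> (\<Sum>k=-m..m. L2_norm M (\<lambda>\<omega>. \<Sum>i\<in>?bad k. (- w k) * Yt l i (i + k) \<omega>))"
    by (intro L2_norm_sum sq_integrable_sum sq_integrable_cmult Yt_sq_integrable)
  also have "\<dots> \<le> (\<Sum>k=-m..m. \<bar>w k\<bar> * (2 * real_of_int m * (2 * tail_delta 0)))"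
  proof (rule sum_mono)
    fix k assume k: "k \<in> {-m..m}"
    have "L2_norm M (\<lambda>\<omega>. \<Sum>i\<in>?bad k. (- w k) * Yt l i (i + k) \<omega>) \<le> (\<Sum>i\<in>?bad k. L2_norm M (\<lambda>\<omega>. (- w k) * Yt l i (i + k) \<omega>))"
      by (intro L2_norm_sum sq_integrable_cmult Yt_sq_integrable)
    also have "\<dots> \<le> (\<Sum>i\<in>?bad k. \<bar>w k\<bar> * (2 * tail_delta 0))"
      unfolding L2_norm_cmult abs_minus_cancel by (intro sum_mono mult_left_mono L2_norm_Yt_le) auto
    also have "\<dots> = real (card (?bad k)) * (\<bar>w k\<bar> * (2 * tail_delta 0))" by simp
    also have "\<dots> \<le> (2 * real_of_int m) * (\<bar>w k\<bar> * (2 * tail_delta 0))"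
    proof (rule mult_right_mono)
      have "card (?bad k) \<le> card ({1..m} \<union> {int n - m + 1..int n})"
        using k by (intro card_mono) auto
      also have "\<dots> \<le> card {1..m} + card {int n - m + 1..int n}" by (rule card_Un_le)
      also have "\<dots> = nat (2 * m)" using m by simp
      finally show "real (card (?bad k)) \<le> 2 * real_of_int m" using m by linarith
    qed simp
    finally show "L2_norm M (\<lambda>\<omega>. \<Sum>i\<in>?bad k. (- w k) * Yt l i (i + k) \<omega>) \<le> \<bar>w k\<bar> * (2 * real_of_int m * (2 * tail_delta 0))"
      by (simp add: mult_ac)
  qed
  finally show ?thesis by (simp only: sum_distrib_right)
qed

lemma banded_clt:
  assumes m: "m \<ge> 0"
  shows "asymp_normal M (\<lambda>n \<omega>. (\<Sum>i=1..int n. \<Sum>k=-m..m. w k * Yt l i (i + k) \<omega>) / sqrt (real n))"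
proof -
  define G where "G x = (\<Sum>k=-m..m. w k * trunc_kernel_at l 0 k x)" for x
  have G: "G \<in> borel_measurable (PiM UNIV (\<lambda>_. S))" unfolding G_def[abs_def] by measurable
  have GY: "G (shifted i \<omega>) = (\<Sum>k=-m..m. w k * Yt l i (i + k) \<omega>)" for i \<omega>
    unfolding G_def using Yt_shifted[of l i 0] by simp
  have "asymp_normal M (\<lambda>n \<omega>. \<Sum>i=1..int n. (1 / sqrt (real n)) * G (shifted i \<omega>))"
  proof (rule m_dependent_clt[OF G, where m = "int l + m" and B = 1 and s = 1])
    show "(\<lambda>\<omega>. G (shifted i \<omega>)) \<in> borel_measurable (window_algebra {i - (int l + m)..i + (int l + m)})" for i
      unfolding GY
      by (intro borel_measurable_sum borel_measurable_times borel_measurable_const measurable_window_mono[OF Yt_window]) auto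
    show "sq_integrable M (\<lambda>\<omega>. G (shifted 0 \<omega>))"
      unfolding GY by (intro sq_integrable_intros Yt_sq_integrable)
    show "expectation (\<lambda>\<omega>. G (shifted 0 \<omega>)) = 0"
      unfolding GY using sq_integrable_imp_integrable[OF Yt_sq_integrable]
      by (subst Bochner_Integration.integral_sum) (auto simp: Yt_mean)
    have "\<forall>\<^sub>F n in sequentially. (1::real) = (\<Sum>i=1..int n. (1 / sqrt (real n))\<^sup>2)"
      using eventually_gt_at_top[of 0] by eventually_elim (simp add: power_divide)
    then show "(\<lambda>n. \<Sum>i=1..int n. (1 / sqrt (real n))\<^sup>2) \<longlonglongrightarrow> 1"
      by (rule Lim_transform_eventually[OF tendsto_const])
  qed (use m in auto)
  then show ?thesis unfolding GY by (simp add: sum_divide_distrib)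
qed

text \<open>
  The weights are split into \<open>v\<close> on the band and \<open>u\<close> off it.  The accuracy \<open>e\<close> is spent in equal parts
  on removing \<open>u\<close> (choice of \<open>m\<close>), truncating the past (choice of \<open>l\<close>), and the boundary terms
  (large \<open>n\<close>).
\<close>

theorem summable_weights_asymp_normal:
  assumes w: "\<And>k. w (- k) = w k" and summable: "(\<lambda>k. \<bar>w k\<bar>) summable_on UNIV"
  shows "asymp_normal M (\<lambda>n \<omega>. weighted_U_stat M K w (proc F eps) n \<omega> / sqrt (real n))"
proof (rule asymp_normal_approx)
  show "sq_integrable M (\<lambda>\<omega>. weighted_U_stat M K w (proc F eps) n \<omega> / sqrt (real n))" for n
    unfolding weighted_U_stat_def by (intro sq_integrable_intros Y_sq_integrable)
  fix e :: real assume e: "e > 0"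
  define V where "V = infsum (\<lambda>k. \<bar>w k\<bar>) UNIV"
  define S\<delta> where "S\<delta> = suminf tail_delta"
  have S0: "S\<delta> \<ge> 0" unfolding S\<delta>_def by (intro suminf_nonneg tail_delta_summable) simp
  have V_sum: "(\<Sum>k\<in>A. \<bar>w k\<bar>) \<le> V" if "finite A" for A
    unfolding V_def by (rule finite_sum_le_infsum[OF summable that]) auto
  have V0: "V \<ge> 0" using V_sum[of "{}"] by simp
  define \<tau> where "\<tau> = e / (3 * (sqrt (24 * S\<delta> * tail_delta 0) + 1))"
  have \<tau>: "\<tau> > 0" "sqrt (24 * S\<delta> * tail_delta 0) * \<tau> \<le> e / 3"
  proof -
    have pos: "sqrt (24 * S\<delta> * tail_delta 0) + 1 > 0" using S0 by (simp add: add_nonneg_pos)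
    then show "\<tau> > 0" using e by (simp add: \<tau>_def)
    have "sqrt (24 * S\<delta> * tail_delta 0) * \<tau> \<le> (sqrt (24 * S\<delta> * tail_delta 0) + 1) * \<tau>"
      using \<open>\<tau> > 0\<close> by (intro mult_right_mono) auto
    also have "\<dots> = e / 3" using pos by (simp add: \<tau>_def field_simps)
    finally show "sqrt (24 * S\<delta> * tail_delta 0) * \<tau> \<le> e / 3" .
  qed
  obtain m :: int where m: "m \<ge> 0" "V - (\<Sum>k=-m..m. \<bar>w k\<bar>) \<le> \<tau>"
  proof -
    have "(sum (\<lambda>k. \<bar>w k\<bar>) \<longlongrightarrow> V) (finite_subsets_at_top UNIV)"
      using summable unfolding V_def by (rule infsum_tendsto)
    then have "\<forall>\<^sub>F X in finite_subsets_at_top UNIV. (\<Sum>k\<in>X. \<bar>w k\<bar>) > V - \<tau>"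
      by (rule order_tendstoD) (use \<tau> in auto)
    then obtain X where X: "finite X" "(\<Sum>k\<in>X. \<bar>w k\<bar>) > V - \<tau>"
      by (auto simp: eventually_finite_subsets_at_top)
    define m where "m = (\<Sum>k\<in>X. \<bar>k\<bar>)"
    have "k \<in> {-m..m}" if "k \<in> X" for k
    proof -
      have "\<bar>k\<bar> \<le> m" unfolding m_def using member_le_sum[OF that, of abs] X(1) by auto
      then show ?thesis by auto
    qed
    then have "X \<subseteq> {-m..m}" by blast
    then have "(\<Sum>k\<in>X. \<bar>w k\<bar>) \<le> (\<Sum>k=-m..m. \<bar>w k\<bar>)" by (intro sum_mono2) auto
    moreover have "m \<ge> 0" unfolding m_def by (intro sum_nonneg) auto
    ultimately show thesis using X that[of m] by auto
  qed
  obtain l where l: "sqrt (24 * S\<delta> * tail_delta l) * V \<le> e / 3"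
  proof -
    have "(\<lambda>l. sqrt (24 * S\<delta> * tail_delta l) * V) \<longlonglongrightarrow> sqrt (24 * S\<delta> * 0) * V"
      by (intro tendsto_intros tail_delta_tendsto_0)
    then have "\<forall>\<^sub>F l in sequentially. sqrt (24 * S\<delta> * tail_delta l) * V < e / 3"
      by (rule order_tendstoD) (use e in auto)
    then obtain l where "sqrt (24 * S\<delta> * tail_delta l) * V < e / 3"
      using eventually_happens trivial_limit_sequentially by blast
    then show thesis using that[of l] by simp
  qed
  define u where "u k = (if \<bar>k\<bar> \<le> m then 0 else w k)" for k
  define v where "v k = (if \<bar>k\<bar> \<le> m then w k else 0)" for k
  have uv: "w k = u k + v k" for k by (simp add: u_def v_def)
  have sym: "u (- k) = u k" "v (- k) = v k" for k using w by (auto simp: u_def v_def)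
  have reindex: "(\<Sum>j=1..int n. f (i - j)) = sum f {i - int n..i - 1}" for f :: "int \<Rightarrow> real" and i n
    by (rule sum.reindex_bij_witness[where i="\<lambda>k. i - k" and j="\<lambda>k. i - k"]) auto
  have v_le: "(\<Sum>j=1..int n. \<bar>v (i - j)\<bar>) \<le> V" for i n
  proof -
    have "(\<Sum>j=1..int n. \<bar>v (i - j)\<bar>) \<le> (\<Sum>j=1..int n. \<bar>w (i - j)\<bar>)"
      by (intro sum_mono) (simp add: v_def)
    also have "\<dots> = (\<Sum>k=i - int n..i - 1. \<bar>w k\<bar>)" by (rule reindex)
    also have "\<dots> \<le> V" by (rule V_sum) simp
    finally show ?thesis .
  qed
  have u_le: "(\<Sum>j=1..int n. \<bar>u (i - j)\<bar>) \<le> \<tau>" for i n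
  proof -
    let ?B = "{i - int n..i - 1}"
    have "(\<Sum>j=1..int n. \<bar>u (i - j)\<bar>) = (\<Sum>k\<in>?B. \<bar>u k\<bar>)" by (rule reindex)
    also have "\<dots> = (\<Sum>k\<in>?B - {-m..m}. \<bar>w k\<bar>)"
      by (rule sum.mono_neutral_cong_right) (auto simp: u_def)
    also have "\<dots> = (\<Sum>k\<in>(?B - {-m..m}) \<union> {-m..m}. \<bar>w k\<bar>) - (\<Sum>k=-m..m. \<bar>w k\<bar>)"
      by (subst sum.union_disjoint) auto
    also have "\<dots> \<le> \<tau>" using V_sum[of "(?B - {-m..m}) \<union> {-m..m}"] m(2) by simp
    finally show ?thesis .
  qed
  define C where "C = (\<Sum>k=-m..m. \<bar>w k\<bar>) * (2 * real_of_int m * (2 * tail_delta 0))"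
  define T' where "T' n \<omega> = (\<Sum>i=1..int n. \<Sum>k=-m..m. w k * Yt l i (i + k) \<omega>)" for n \<omega>
  have T'_sq: "sq_integrable M (T' n)" for n
    unfolding T'_def by (intro sq_integrable_intros Yt_sq_integrable)
  show "\<exists>T'. (\<forall>n. sq_integrable M (T' n)) \<and> asymp_normal M T' \<and>
       (\<forall>\<^sub>F n in sequentially. L2_norm M (\<lambda>\<omega>. weighted_U_stat M K w (proc F eps) n \<omega> / sqrt (real n) - T' n \<omega>) \<le> e)"
  proof (intro exI[of _ "\<lambda>n \<omega>. T' n \<omega> / sqrt (real n)"] conjI allI)
    show "sq_integrable M (\<lambda>\<omega>. T' n \<omega> / sqrt (real n))" for n by (intro sq_integrable_divide T'_sq)
    show "asymp_normal M (\<lambda>n \<omega>. T' n \<omega> / sqrt (real n))"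
      unfolding T'_def by (rule banded_clt[OF m(1)])
    have "(\<lambda>n. C / sqrt (real n)) \<longlonglongrightarrow> 0"
      by (intro tendsto_divide_0[OF tendsto_const] filterlim_at_top_imp_at_infinity filterlim_compose[OF sqrt_at_top] filterlim_real_sequentially)
    then have "\<forall>\<^sub>F n in sequentially. C / sqrt (real n) < e / 3"
      by (rule order_tendstoD) (use e in auto)
    then show "\<forall>\<^sub>F n in sequentially. L2_norm M (\<lambda>\<omega>. weighted_U_stat M K w (proc F eps) n \<omega> / sqrt (real n) - T' n \<omega> / sqrt (real n)) \<le> e"
      using eventually_gt_at_top[of 0]
    proof eventually_elim
      case (elim n)
      let ?U = "\<lambda>\<omega>. \<Sum>i=1..int n. \<Sum>j=1..int n. u (i - j) * (Y i j \<omega> - Yt 0 i j \<omega>)"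
      let ?V = "\<lambda>\<omega>. \<Sum>i=1..int n. \<Sum>j=1..int n. v (i - j) * (Y i j \<omega> - Yt l i j \<omega>)"
      let ?B = "\<lambda>\<omega>. (\<Sum>i=1..int n. \<Sum>j=1..int n. v (i - j) * Yt l i j \<omega>) - T' n \<omega>"
      have sq: "sq_integrable M ?U" "sq_integrable M ?V" "sq_integrable M ?B"
        by (intro sq_integrable_intros Y_sq_integrable Yt_sq_integrable T'_sq)+
      have U: "L2_norm M ?U \<le> sqrt (24 * S\<delta> * tail_delta 0) * \<tau> * sqrt n"
      proof -
        have "(L2_norm M ?U)\<^sup>2 \<le> 24 * S\<delta> * tail_delta 0 * \<tau>\<^sup>2 * real n"
          unfolding S\<delta>_def by (rule truncation_error_sum) (use sym u_le \<tau> in auto)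
        then have "L2_norm M ?U \<le> sqrt (24 * S\<delta> * tail_delta 0 * \<tau>\<^sup>2 * real n)" by (rule real_le_rsqrt)
        then show ?thesis using \<tau>(1) by (simp add: real_sqrt_mult)
      qed
      have V: "L2_norm M ?V \<le> sqrt (24 * S\<delta> * tail_delta l) * V * sqrt n"
      proof -
        have "(L2_norm M ?V)\<^sup>2 \<le> 24 * S\<delta> * tail_delta l * V\<^sup>2 * real n"
          unfolding S\<delta>_def by (rule truncation_error_sum) (use sym v_le V0 in auto)
        then have "L2_norm M ?V \<le> sqrt (24 * S\<delta> * tail_delta l * V\<^sup>2 * real n)" by (rule real_le_rsqrt)
        then show ?thesis using V0 by (simp add: real_sqrt_mult)
      qed
      have B: "L2_norm M ?B \<le> C"
        using band_boundary_le[where w=w, OF w m(1), of l n] unfolding v_def T'_def C_def by simp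
      have eq: "weighted_U_stat M K w (proc F eps) n \<omega> - T' n \<omega> = ?U \<omega> + (?V \<omega> + ?B \<omega>)" for \<omega>
        unfolding weighted_U_stat_def uv
        by (simp add: Y_trunc_def algebra_simps sum.distrib sum_subtractf)
      have "L2_norm M (\<lambda>\<omega>. weighted_U_stat M K w (proc F eps) n \<omega> - T' n \<omega>) \<le> L2_norm M ?U + (L2_norm M ?V + L2_norm M ?B)"
        unfolding eq using L2_norm_triangle[OF sq(1) sq_integrable_add[OF sq(2,3)]] L2_norm_triangle[OF sq(2,3)] by simp
      also have "\<dots> \<le> (sqrt (24 * S\<delta> * tail_delta 0) * \<tau> + sqrt (24 * S\<delta> * tail_delta l) * V + C / sqrt n) * sqrt n"
        using U V B elim(2) by (simp add: distrib_right)
      also have "\<dots> \<le> e * sqrt n"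
      proof (rule mult_right_mono)
        show "sqrt (24 * S\<delta> * tail_delta 0) * \<tau> + sqrt (24 * S\<delta> * tail_delta l) * V + C / sqrt n \<le> e"
          using \<tau>(2) l elim(1) by linarith
      qed simp
      finally have "L2_norm M (\<lambda>\<omega>. weighted_U_stat M K w (proc F eps) n \<omega> - T' n \<omega>) / sqrt n \<le> e"
        using elim(2) by (simp add: field_simps)
      then show ?case
        using L2_norm_divide[of M "\<lambda>\<omega>. weighted_U_stat M K w (proc F eps) n \<omega> - T' n \<omega>" "sqrt n"]
        by (simp add: diff_divide_distrib)
    qed
  qed
qed

end

section \<open>Projection onto single coordinates\<close>

context kernel_process
begin

abbreviation "Xt \<equiv> proc_trunc Fl eps"

definition law_trunc :: "nat \<Rightarrow> real measure" where
  "law_trunc l = distr M borel (Xt l 0)"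

text \<open>
  The mean of the kernel at two independent copies of the truncated variable.  It is subtracted
  inside \<open>proj\<close>, so that \<open>proj\<close> is the projection of the centred kernel.
\<close>

definition far_mean :: "nat \<Rightarrow> real" where
  "far_mean l = (\<integral>z. K (fst z) (snd z) \<partial>(law_trunc l \<Otimes>\<^sub>M law_trunc l))"

definition proj :: "nat \<Rightarrow> real \<Rightarrow> real" where
  "proj l y = (\<integral>x. K x y - far_mean l \<partial>law_trunc l)"

lemma sets_law_trunc [measurable_cong, simp]: "sets (law_trunc l) = sets borel"
  by (simp add: law_trunc_def)

lemma space_law_trunc [simp]: "space (law_trunc l) = UNIV"
  by (simp add: law_trunc_def)

lemma distr_Xt: "l \<ge> 1 \<Longrightarrow> distr M borel (Xt l i) = law_trunc l"
  using distr_functional_shifted[OF window_at_measurable, of l 0 i 0] proc_trunc_shifted[of l i 0] proc_trunc_shifted[of l 0 0]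
  by (simp add: law_trunc_def fun_eq_iff cong: distr_cong)

lemma prob_space_law_trunc: "l \<ge> 1 \<Longrightarrow> prob_space (law_trunc l)"
  unfolding law_trunc_def by (intro prob_space_distr proc_trunc_measurable)

text \<open>
  The product law for two variables with values in different spaces, obtained from the
  independence of the indicators of their events.
\<close>

lemma joint_law_windows:
  assumes "J \<inter> J' = {}" "f \<in> measurable (window_algebra J) N" "g \<in> measurable (window_algebra J') N'"
  shows "distr M (N \<Otimes>\<^sub>M N') (\<lambda>\<omega>. (f \<omega>, g \<omega>)) = distr M N f \<Otimes>\<^sub>M distr M N' g"
proof (rule pair_measure_eqI[symmetric])
  have [measurable]: "f \<in> measurable M N" "g \<in> measurable M N'"
    using assms by (auto intro: measurable_window_imp)
  show "sigma_finite_measure (distr M N f)" "sigma_finite_measure (distr M N' g)"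
    by (intro prob_space_imp_sigma_finite prob_space_distr; measurable)+
  fix A B assume AB: "A \<in> sets (distr M N f)" "B \<in> sets (distr M N' g)"
  then have [measurable]: "A \<in> sets N" "B \<in> sets N'" by auto
  let ?A = "f -` A \<inter> space M" and ?B = "g -` B \<inter> space M"
  have "indep_var borel (indicator ?A) borel (indicator ?B :: 'a \<Rightarrow> real)"
    using measurable_sets[OF assms(2)] measurable_sets[OF assms(3)]
    by (intro indep_var_windows[OF assms(1)] borel_measurable_indicator) auto
  then have "expectation (\<lambda>\<omega>. indicator ?A \<omega> * indicator ?B \<omega> :: real) = expectation (indicator ?A) * expectation (indicator ?B)"
    by (rule indep_var_lebesgue_integral) (auto intro!: integrable_real_indicator simp: less_top[symmetric])
  also have "(\<lambda>\<omega>. indicator ?A \<omega> * indicator ?B \<omega> :: real) = indicator (?A \<inter> ?B)"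
    by (auto simp: indicator_def)
  finally have "prob (?A \<inter> ?B) = prob ?A * prob ?B" by simp
  moreover have "(\<lambda>\<omega>. (f \<omega>, g \<omega>)) -` (A \<times> B) \<inter> space M = ?A \<inter> ?B" by auto
  ultimately show "emeasure (distr M N f) A * emeasure (distr M N' g) B
      = emeasure (distr M (N \<Otimes>\<^sub>M N') (\<lambda>\<omega>. (f \<omega>, g \<omega>))) (A \<times> B)"
    by (simp add: emeasure_distr emeasure_eq_measure ennreal_mult'')
qed simp

lemma far_windows_disjoint: "int l \<le> \<bar>i - j\<bar> \<Longrightarrow> {i - int l<..i} \<inter> {j - int l<..j} = {}"
  by auto

lemma law_pair_far:
  assumes l: "l \<ge> 1" and far: "int l \<le> \<bar>i - j\<bar>"
  shows "distr M (borel \<Otimes>\<^sub>M borel) (\<lambda>\<omega>. (Xt l i \<omega>, Xt l j \<omega>)) = law_trunc l \<Otimes>\<^sub>M law_trunc l"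
  using joint_law_windows[OF far_windows_disjoint[OF far] proc_trunc_window[OF l] proc_trunc_window[OF l]]
  by (simp add: distr_Xt[OF l])

lemma K_pair_measurable [measurable]: "(\<lambda>z. K (fst z) (snd z)) \<in> borel_measurable (borel \<Otimes>\<^sub>M borel)"
  by measurable

lemma Yt_far:
  assumes l: "l \<ge> 1" and far: "int l \<le> \<bar>i - j\<bar>"
  shows "Yt l i j \<omega> = K (Xt l i \<omega>) (Xt l j \<omega>) - far_mean l"
proof -
  have [measurable]: "Xt l i \<in> borel_measurable M" for i by (rule proc_trunc_measurable[OF l])
  have "expectation (\<lambda>\<omega>. K (Xt l i \<omega>) (Xt l j \<omega>)) = (\<integral>z. K (fst z) (snd z) \<partial>distr M (borel \<Otimes>\<^sub>M borel) (\<lambda>\<omega>. (Xt l i \<omega>, Xt l j \<omega>)))"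
    by (subst integral_distr) auto
  then show ?thesis using l by (simp add: Y_trunc_def centred_kernel_def far_mean_def law_pair_far[OF l far])
qed

lemma Yt_sym: "Yt l i j = Yt l j i"
  by (auto simp: Y_trunc_def centred_kernel_def K_sym fun_eq_iff)

lemma proj_measurable [measurable]:
  assumes l: "l \<ge> 1"
  shows "proj l \<in> borel_measurable borel"
proof -
  interpret \<mu>: prob_space "law_trunc l" by (rule prob_space_law_trunc[OF l])
  show ?thesis unfolding proj_def[abs_def]
    by (intro \<mu>.borel_measurable_lebesgue_integral) measurable
qed

lemma proj_Xt_window: "l \<ge> 1 \<Longrightarrow> (\<lambda>\<omega>. proj l (Xt l i \<omega>)) \<in> borel_measurable (window_algebra {i - int l<..i})"
  using measurable_compose[OF proc_trunc_window proj_measurable] .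

text \<open>
  Integrating out a coordinate that is independent of everything else replaces the kernel by its
  projection.
\<close>

lemma expectation_Yt_mult:
  assumes l: "l \<ge> 1" and far: "int l \<le> \<bar>i - j\<bar>"
    and J: "J \<inter> {i - int l<..i} = {}"
    and \<phi>: "\<phi> \<in> borel_measurable (window_algebra J)" "sq_integrable M \<phi>"
  shows "expectation (\<lambda>\<omega>. Yt l i j \<omega> * \<phi> \<omega>) = expectation (\<lambda>\<omega>. proj l (Xt l j \<omega>) * \<phi> \<omega>)"
proof -
  have [measurable]: "Xt l i \<in> borel_measurable M" for i by (rule proc_trunc_measurable[OF l])
  have [measurable]: "\<phi> \<in> borel_measurable M" using \<phi> by (simp add: sq_integrable_def)
  note [measurable] = proj_measurable[OF l]
  define \<nu> where "\<nu> = distr M (borel \<Otimes>\<^sub>M borel) (\<lambda>\<omega>. (Xt l j \<omega>, \<phi> \<omega>))"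
  have [measurable_cong]: "sets \<nu> = sets (borel \<Otimes>\<^sub>M borel)" by (simp add: \<nu>_def)
  interpret \<mu>: prob_space "law_trunc l" by (rule prob_space_law_trunc[OF l])
  interpret \<nu>: prob_space \<nu> unfolding \<nu>_def by (intro prob_space_distr) measurable
  interpret P: pair_sigma_finite \<nu> "law_trunc l" ..
  define f where "f z = (K (snd z) (fst (fst z)) - far_mean l) * snd (fst z)" for z :: "(real \<times> real) \<times> real"
  have f [measurable]: "f \<in> borel_measurable ((borel \<Otimes>\<^sub>M borel) \<Otimes>\<^sub>M borel)" unfolding f_def[abs_def] by measurable
  have law: "distr M ((borel \<Otimes>\<^sub>M borel) \<Otimes>\<^sub>M borel) (\<lambda>\<omega>. ((Xt l j \<omega>, \<phi> \<omega>), Xt l i \<omega>)) = \<nu> \<Otimes>\<^sub>M law_trunc l"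
  proof -
    have "(\<lambda>\<omega>. (Xt l j \<omega>, \<phi> \<omega>)) \<in> measurable (window_algebra (J \<union> {j - int l<..j})) (borel \<Otimes>\<^sub>M borel)"
      by (intro measurable_Pair measurable_window_mono[OF proc_trunc_window[OF l]] measurable_window_mono[OF \<phi>(1)]) auto
    moreover have "(J \<union> {j - int l<..j}) \<inter> {i - int l<..i} = {}" using J far by auto
    ultimately show ?thesis
      using joint_law_windows[OF _ _ proc_trunc_window[OF l]] unfolding \<nu>_def distr_Xt[OF l, of i, symmetric] by blast
  qed
  have fY: "f ((Xt l j \<omega>, \<phi> \<omega>), Xt l i \<omega>) = Yt l i j \<omega> * \<phi> \<omega>" for \<omega>
    by (simp add: f_def Yt_far[OF l far])
  have int: "integrable (\<nu> \<Otimes>\<^sub>M law_trunc l) f"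
    unfolding law[symmetric]
    by (subst integrable_distr_eq) (auto simp: fY sq_integrable_mult Yt_sq_integrable \<phi>)
  have "expectation (\<lambda>\<omega>. Yt l i j \<omega> * \<phi> \<omega>) = integral\<^sup>L (\<nu> \<Otimes>\<^sub>M law_trunc l) f"
    unfolding law[symmetric] by (subst integral_distr) (auto simp: fY)
  also have "\<dots> = (\<integral>z. \<integral>x. f (z, x) \<partial>law_trunc l \<partial>\<nu>)" by (rule P.integral_fst'[OF int, symmetric])
  also have "\<dots> = (\<integral>z. proj l (fst z) * snd z \<partial>\<nu>)" by (simp add: f_def proj_def)
  also have "\<dots> = expectation (\<lambda>\<omega>. proj l (Xt l j \<omega>) * \<phi> \<omega>)"
    unfolding \<nu>_def by (subst integral_distr) auto
  finally show ?thesis .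
qed

lemma proj_Xt_mean:
  assumes l: "l \<ge> 1"
  shows "expectation (\<lambda>\<omega>. proj l (Xt l i \<omega>)) = 0"
proof -
  have "expectation (\<lambda>\<omega>. Yt l (i + int l) i \<omega> * 1) = expectation (\<lambda>\<omega>. proj l (Xt l i \<omega>) * 1)"
    by (rule expectation_Yt_mult[OF l, where J = "{}"]) (auto simp: sq_integrable_const)
  then show ?thesis by (simp add: Yt_mean)
qed

text \<open>
  By Cauchy-Schwarz, \<open>(proj l y)\<^sup>2\<close> is at most the integral of the squared centred kernel over its first
  argument, for almost every \<open>y\<close>.
\<close>

lemma proj_Xt_sq_integrable:
  assumes l: "l \<ge> 1"
  shows "sq_integrable M (\<lambda>\<omega>. proj l (Xt l i \<omega>))"
proof -
  have [measurable]: "Xt l i \<in> borel_measurable M" for i by (rule proc_trunc_measurable[OF l])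
  note [measurable] = proj_measurable[OF l]
  interpret \<mu>: prob_space "law_trunc l" by (rule prob_space_law_trunc[OF l])
  interpret P: pair_sigma_finite "law_trunc l" "law_trunc l" ..
  define f where "f z = (K (snd z) (fst z) - far_mean l)\<^sup>2" for z :: "real \<times> real"
  have f [measurable]: "f \<in> borel_measurable (borel \<Otimes>\<^sub>M borel)" unfolding f_def[abs_def] by measurable
  have far: "int l \<le> \<bar>i - (i + int l)\<bar>" by simp
  have int: "integrable (law_trunc l \<Otimes>\<^sub>M law_trunc l) f"
  proof -
    have "integrable M (\<lambda>\<omega>. (Yt l (i + int l) i \<omega>)\<^sup>2)" using Yt_sq_integrable by (simp add: sq_integrable_def)
    also have "(\<lambda>\<omega>. (Yt l (i + int l) i \<omega>)\<^sup>2) = (\<lambda>\<omega>. f (Xt l i \<omega>, Xt l (i + int l) \<omega>))"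
      by (simp add: f_def Yt_far[OF l])
    finally show ?thesis
      unfolding law_pair_far[OF l far, symmetric] by (subst integrable_distr_eq) auto
  qed
  have int1: "integrable (law_trunc l) (\<lambda>y. \<integral>x. f (y, x) \<partial>law_trunc l)"
    by (rule P.integrable_fst'[OF int])
  have "integrable (law_trunc l) (\<lambda>y. (proj l y)\<^sup>2)"
  proof (rule Bochner_Integration.integrable_bound[OF int1])
    show "(\<lambda>y. (proj l y)\<^sup>2) \<in> borel_measurable (law_trunc l)" by measurable
    show "AE y in law_trunc l. norm ((proj l y)\<^sup>2) \<le> norm (\<integral>x. f (y, x) \<partial>law_trunc l)"
      using P.AE_integrable_fst'[OF int]
    proof eventually_elim
      case (elim y)
      let ?g = "\<lambda>x. K x y - far_mean l"
      have g: "sq_integrable (law_trunc l) ?g"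
        using elim by (auto simp: sq_integrable_def f_def)
      have "\<mu>.prob UNIV = 1" using \<mu>.prob_space by simp
      then have "\<bar>proj l y\<bar> \<le> L2_norm (law_trunc l) ?g"
        using L2_norm_Cauchy_Schwarz[OF g \<mu>.sq_integrable_const[of 1]]
        by (simp add: proj_def L2_norm_def[of _ "\<lambda>_. 1"])
      then have "\<bar>proj l y\<bar>\<^sup>2 \<le> (L2_norm (law_trunc l) ?g)\<^sup>2" by (intro power_mono) auto
      then show ?case by (simp add: L2_norm_power2 f_def)
    qed
  qed
  then have "integrable (distr M borel (Xt l i)) (\<lambda>y. (proj l y)\<^sup>2)" by (simp add: distr_Xt[OF l])
  then show ?thesis
    by (subst (asm) integrable_distr_eq) (auto simp: sq_integrable_def)
qed

lemma L2_norm_proj_Xt: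
  assumes l: "l \<ge> 1"
  shows "L2_norm M (\<lambda>\<omega>. proj l (Xt l i \<omega>)) = L2_norm M (\<lambda>\<omega>. proj l (Xt l 0 \<omega>))"
proof -
  have "L2_norm M (\<lambda>\<omega>. proj l (Xt l i \<omega>)) = sqrt (\<integral>y. (proj l y)\<^sup>2 \<partial>law_trunc l)" for i
    unfolding distr_Xt[OF l, of i, symmetric] L2_norm_def
    by (subst integral_distr) (auto intro: proc_trunc_measurable[OF l] borel_measurable_power proj_measurable[OF l])
  then show ?thesis by simp
qed

text \<open>
  For \<open>\<bar>i - j\<bar> \<ge> l\<close> this is the degenerate part of the kernel.  On the band the same formula is kept:
  the projections then exhaust the full double sum of weights.
\<close>

definition remainder :: "nat \<Rightarrow> int \<Rightarrow> int \<Rightarrow> 'a \<Rightarrow> real" where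
  "remainder l i j \<omega> = Yt l i j \<omega> - proj l (Xt l i \<omega>) - proj l (Xt l j \<omega>)"

definition remainder_bound :: "nat \<Rightarrow> real" where
  "remainder_bound l = 2 * tail_delta 0 + 2 * L2_norm M (\<lambda>\<omega>. proj l (Xt l 0 \<omega>))"

lemma remainder_bound_nonneg: "remainder_bound l \<ge> 0"
  by (simp add: remainder_bound_def)

lemma remainder_sym: "remainder l i j = remainder l j i"
  by (auto simp: remainder_def Yt_sym[of l i j])

lemma remainder_sq_integrable: "l \<ge> 1 \<Longrightarrow> sq_integrable M (remainder l i j)"
  unfolding remainder_def[abs_def] by (intro sq_integrable_diff Yt_sq_integrable proj_Xt_sq_integrable)

lemma remainder_mean: "l \<ge> 1 \<Longrightarrow> expectation (remainder l i j) = 0"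
  unfolding remainder_def[abs_def]
  using sq_integrable_imp_integrable[OF Yt_sq_integrable[of l i j]]
    sq_integrable_imp_integrable[OF proj_Xt_sq_integrable[of l i]]
    sq_integrable_imp_integrable[OF proj_Xt_sq_integrable[of l j]]
  by (simp add: Yt_mean proj_Xt_mean)

lemma remainder_window:
  assumes "l \<ge> 1"
  shows "remainder l i j \<in> borel_measurable (window_algebra ({i - int l<..i} \<union> {j - int l<..j}))"
  unfolding remainder_def[abs_def]
  by (intro borel_measurable_diff Yt_window measurable_window_mono[OF proj_Xt_window[OF assms]]) auto

lemma L2_norm_remainder_le:
  assumes l: "l \<ge> 1"
  shows "L2_norm M (remainder l i j) \<le> remainder_bound l"
proof -
  let ?p = "\<lambda>i \<omega>. proj l (Xt l i \<omega>)"
  have "L2_norm M (remainder l i j) \<le> L2_norm M (\<lambda>\<omega>. Yt l i j \<omega> - ?p i \<omega>) + L2_norm M (?p j)"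
    unfolding remainder_def[abs_def]
    by (intro L2_norm_diff_le sq_integrable_diff Yt_sq_integrable proj_Xt_sq_integrable l)
  also have "L2_norm M (\<lambda>\<omega>. Yt l i j \<omega> - ?p i \<omega>) \<le> L2_norm M (Yt l i j) + L2_norm M (?p i)"
    by (intro L2_norm_diff_le Yt_sq_integrable proj_Xt_sq_integrable l)
  finally show ?thesis
    using L2_norm_Yt_le[of l i j] L2_norm_proj_Xt[OF l, of i] L2_norm_proj_Xt[OF l, of j]
    by (simp add: remainder_bound_def)
qed

lemma remainder_cov_le:
  assumes l: "l \<ge> 1"
  shows "\<bar>expectation (\<lambda>\<omega>. remainder l i j \<omega> * remainder l i' j' \<omega>)\<bar> \<le> (remainder_bound l)\<^sup>2"
proof -
  have "\<bar>expectation (\<lambda>\<omega>. remainder l i j \<omega> * remainder l i' j' \<omega>)\<bar> \<le> L2_norm M (remainder l i j) * L2_norm M (remainder l i' j')"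
    by (intro L2_norm_Cauchy_Schwarz remainder_sq_integrable l)
  also have "\<dots> \<le> remainder_bound l * remainder_bound l"
    by (intro mult_mono L2_norm_remainder_le l remainder_bound_nonneg L2_norm_nonneg)
  finally show ?thesis by (simp add: power2_eq_square)
qed

text \<open>
  An index at distance at least \<open>l\<close> from the three others can be integrated out first, which kills the
  remainder.
\<close>

lemma remainder_degenerate:
  assumes l: "l \<ge> 1" and far: "int l \<le> \<bar>i - j\<bar>"
    and iso: "int l \<le> \<bar>i - i'\<bar>" "int l \<le> \<bar>i - j'\<bar>"
  shows "expectation (\<lambda>\<omega>. remainder l i j \<omega> * remainder l i' j' \<omega>) = 0"
proof -
  let ?p = "\<lambda>i \<omega>. proj l (Xt l i \<omega>)" and ?J = "{i' - int l<..i'} \<union> {j' - int l<..j'}"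
  let ?\<phi> = "remainder l i' j'"
  have J: "?J \<inter> {i - int l<..i} = {}" using iso by auto
  note \<phi> = remainder_window[OF l, of i' j'] remainder_sq_integrable[OF l, of i' j']
  have 1: "expectation (\<lambda>\<omega>. Yt l i j \<omega> * ?\<phi> \<omega>) = expectation (\<lambda>\<omega>. ?p j \<omega> * ?\<phi> \<omega>)"
    by (rule expectation_Yt_mult[OF l far J \<phi>])
  have 2: "expectation (\<lambda>\<omega>. ?p i \<omega> * ?\<phi> \<omega>) = 0"
    by (rule expectation_mult_windows_zero[OF _ proj_Xt_window[OF l] proj_Xt_sq_integrable[OF l] proj_Xt_mean[OF l] \<phi>])
       (use J in blast)
  have "(\<lambda>\<omega>. remainder l i j \<omega> * ?\<phi> \<omega>) = (\<lambda>\<omega>. Yt l i j \<omega> * ?\<phi> \<omega> - ?p i \<omega> * ?\<phi> \<omega> - ?p j \<omega> * ?\<phi> \<omega>)"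
    unfolding remainder_def[of l i j] by (simp add: left_diff_distrib)
  then show ?thesis
    using 1 2 sq_integrable_mult[OF Yt_sq_integrable[of l i j] \<phi>(2)]
      sq_integrable_mult[OF proj_Xt_sq_integrable[OF l, of i] \<phi>(2)] sq_integrable_mult[OF proj_Xt_sq_integrable[OF l, of j] \<phi>(2)]
    by simp
qed

text \<open>
  On the band there is no degeneracy, but only boundedly many weights: if the windows of one
  pair avoid those of the other, the variables are independent, so the pair estimate applies with \<open>\<rho>\<close> supported on \<open>{..<l}\<close>.
\<close>

lemma remainder_near_sum:
  assumes l: "l \<ge> 1" and w: "\<And>k. w (- k) = w k"
  shows "(L2_norm M (\<lambda>\<omega>. \<Sum>i=1..int n. \<Sum>j=1..int n. (if \<bar>i - j\<bar> < int l then w (i - j) else 0) * remainder l i j \<omega>))\<^sup>2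
     \<le> 8 * (real l * (remainder_bound l)\<^sup>2) * (\<Sum>k=-int l..int l. \<bar>w k\<bar>)\<^sup>2 * real n"
proof -
  define \<rho> where "\<rho> k = (if k < l then (remainder_bound l)\<^sup>2 else 0)" for k
  define v where "v k = (if \<bar>k\<bar> < int l then w k else 0)" for k
  have \<rho>0: "\<rho> k \<ge> 0" for k by (simp add: \<rho>_def)
  have \<rho>_sums: "\<rho> sums (real l * (remainder_bound l)\<^sup>2)"
  proof -
    have "\<rho> sums (\<Sum>k<l. \<rho> k)" by (rule sums_finite) (auto simp: \<rho>_def)
    then show ?thesis by (simp add: \<rho>_def)
  qed
  have "(L2_norm M (\<lambda>\<omega>. \<Sum>i=1..int n. \<Sum>j=1..int n. v (i - j) * remainder l i j \<omega>))\<^sup>2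
     \<le> 8 * suminf \<rho> * (\<Sum>k=-int l..int l. \<bar>w k\<bar>)\<^sup>2 * real n"
  proof (rule L2_norm_pair_sum)
    show "sq_integrable M (remainder l i j)" for i j by (rule remainder_sq_integrable[OF l])
    show "v (- k) = v k" for k by (simp add: v_def w)
    show "\<rho> k \<ge> 0" for k by (rule \<rho>0)
    show "summable \<rho>" using \<rho>_sums by (rule sums_summable)
    show "0 \<le> (\<Sum>k=-int l..int l. \<bar>w k\<bar>)" by (intro sum_nonneg) auto
    show "(\<Sum>j=1..int n. \<bar>v (i - j)\<bar>) \<le> (\<Sum>k=-int l..int l. \<bar>w k\<bar>)" for i
    proof -
      have "(\<Sum>j=1..int n. \<bar>v (i - j)\<bar>) = (\<Sum>k=i - int n..i - 1. \<bar>v k\<bar>)"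
        by (rule sum.reindex_bij_witness[where i="\<lambda>k. i - k" and j="\<lambda>k. i - k"]) auto
      also have "\<dots> = (\<Sum>k\<in>{i - int n..i - 1} \<inter> {-int l..int l}. \<bar>v k\<bar>)"
        by (rule sum.mono_neutral_right) (auto simp: v_def)
      also have "\<dots> \<le> (\<Sum>k=-int l..int l. \<bar>v k\<bar>)" by (intro sum_mono2) auto
      also have "\<dots> \<le> (\<Sum>k=-int l..int l. \<bar>w k\<bar>)" by (intro sum_mono) (auto simp: v_def)
      finally show ?thesis .
    qed
    fix i j i' j'
    have aux: "x \<le> \<rho> a + \<rho> b + \<rho> c + \<rho> d"
      if "x \<le> (remainder_bound l)\<^sup>2" "a \<ge> l \<Longrightarrow> b \<ge> l \<Longrightarrow> c \<ge> l \<Longrightarrow> d \<ge> l \<Longrightarrow> x = 0" for x a b c d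
      using that \<rho>0[of a] \<rho>0[of b] \<rho>0[of c] \<rho>0[of d] by (fastforce simp: \<rho>_def not_less)
    show "\<bar>expectation (\<lambda>\<omega>. remainder l i j \<omega> * remainder l i' j' \<omega>)\<bar>
          \<le> \<rho> (nat \<bar>i - i'\<bar>) + \<rho> (nat \<bar>i - j'\<bar>) + \<rho> (nat \<bar>j - i'\<bar>) + \<rho> (nat \<bar>j - j'\<bar>)"
    proof (rule aux[OF remainder_cov_le[OF l]])
      assume "l \<le> nat \<bar>i - i'\<bar>" "l \<le> nat \<bar>i - j'\<bar>" "l \<le> nat \<bar>j - i'\<bar>" "l \<le> nat \<bar>j - j'\<bar>"
      then have *: "int l \<le> \<bar>i - i'\<bar>" "int l \<le> \<bar>i - j'\<bar>" "int l \<le> \<bar>j - i'\<bar>" "int l \<le> \<bar>j - j'\<bar>"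
        by (simp_all add: le_nat_iff)
      have "expectation (\<lambda>\<omega>. remainder l i j \<omega> * remainder l i' j' \<omega>) = 0"
        by (rule expectation_mult_windows_zero[OF _ remainder_window[OF l] remainder_sq_integrable[OF l] remainder_mean[OF l]
              remainder_window[OF l] remainder_sq_integrable[OF l]])
           (use far_windows_disjoint[OF *(1)] far_windows_disjoint[OF *(2)] far_windows_disjoint[OF *(3)] far_windows_disjoint[OF *(4)] in blast)
      then show "\<bar>expectation (\<lambda>\<omega>. remainder l i j \<omega> * remainder l i' j' \<omega>)\<bar> = 0" by simp
    qed
  qed
  then show ?thesis using \<rho>_sums by (simp add: v_def sums_iff)
qed

definition far_pairs :: "nat \<Rightarrow> nat \<Rightarrow> (int \<times> int) set" where
  "far_pairs l n = {p \<in> {1..int n} \<times> {1..int n}. int l \<le> \<bar>fst p - snd p\<bar>}"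

text \<open>
  Unless the pairs can be matched index by index, up to distance \<open>l\<close> and in one of the two orders, one
  of the four indices is isolated and the covariance vanishes.  Hence every pair has at most
  \<open>2 * (2 * l)\<^sup>2\<close> correlated neighbours.
\<close>

lemma remainder_far_sum:
  assumes l: "l \<ge> 1"
  shows "(L2_norm M (\<lambda>\<omega>. \<Sum>p\<in>far_pairs l n. w (fst p - snd p) * remainder l (fst p) (snd p) \<omega>))\<^sup>2
     \<le> (remainder_bound l)\<^sup>2 * (2 * (2 * real l)\<^sup>2) * (\<Sum>p\<in>far_pairs l n. (w (fst p - snd p))\<^sup>2)"
proof (rule L2_norm_sum_neighbours[where nb = "\<lambda>p q. (\<bar>fst p - fst q\<bar> < int l \<and> \<bar>snd p - snd q\<bar> < int l)
      \<or> (\<bar>fst p - snd q\<bar> < int l \<and> \<bar>snd p - fst q\<bar> < int l)"])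
  let ?nb = "\<lambda>p q. (\<bar>fst p - fst q\<bar> < int l \<and> \<bar>snd p - snd q\<bar> < int l)
      \<or> (\<bar>fst p - snd q\<bar> < int l \<and> \<bar>snd p - fst q\<bar> < int l)"
  show fin: "finite (far_pairs l n)" unfolding far_pairs_def by simp
  show "sq_integrable M (remainder l (fst p) (snd p))" for p by (rule remainder_sq_integrable[OF l])
  show "?nb p q \<longleftrightarrow> ?nb q p" for p q :: "int \<times> int" by (auto simp: abs_minus_commute)
  show "real (card {q \<in> far_pairs l n. ?nb p q}) \<le> 2 * (2 * real l)\<^sup>2" for p
  proof -
    let ?N = "\<lambda>i. {j\<in>{1..int n}. \<bar>i - j\<bar> < int l}"
    have cN: "card (?N i) \<le> 2 * l" for i
      using card_int_neighbours[of "{1..int n}" i "int l"] by simp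
    have "card {q \<in> far_pairs l n. ?nb p q} \<le> card (?N (fst p) \<times> ?N (snd p) \<union> ?N (snd p) \<times> ?N (fst p))"
    proof (rule card_mono)
      have "finite (?N i)" for i by (rule finite_subset[of _ "{1..int n}"]) auto
      then show "finite (?N (fst p) \<times> ?N (snd p) \<union> ?N (snd p) \<times> ?N (fst p))"
        by (intro finite_UnI finite_cartesian_product)
    qed (auto simp: far_pairs_def)
    also have "\<dots> \<le> card (?N (fst p) \<times> ?N (snd p)) + card (?N (snd p) \<times> ?N (fst p))"
      by (rule card_Un_le)
    also have "\<dots> = 2 * (card (?N (fst p)) * card (?N (snd p)))" by (simp add: card_cartesian_product)
    also have "\<dots> \<le> 2 * ((2 * l) * (2 * l))" by (intro mult_le_mono cN order_refl)
    finally have "real (card {q \<in> far_pairs l n. ?nb p q}) \<le> real (2 * ((2 * l) * (2 * l)))" by (rule of_nat_mono)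
    then show ?thesis by (simp add: power2_eq_square)
  qed
  fix p q assume pq: "p \<in> far_pairs l n" "q \<in> far_pairs l n"
  obtain i j i' j' where p: "p = (i, j)" and q: "q = (i', j')" by fastforce
  have far: "int l \<le> \<bar>i - j\<bar>" "int l \<le> \<bar>j - i\<bar>" "int l \<le> \<bar>i' - j'\<bar>" "int l \<le> \<bar>j' - i'\<bar>"
    using pq by (auto simp: far_pairs_def p q abs_minus_commute)
  let ?E = "\<lambda>i j i' j'. expectation (\<lambda>\<omega>. remainder l i j \<omega> * remainder l i' j' \<omega>)"
  have "?E i j i' j' = 0" if nn: "\<not> ?nb p q"
  proof -
    have comm: "?E i j i' j' = ?E i' j' i j" for i j i' j' by (simp add: mult.commute)
    consider "int l \<le> \<bar>i - i'\<bar>" "int l \<le> \<bar>i - j'\<bar>" | "int l \<le> \<bar>j - i'\<bar>" "int l \<le> \<bar>j - j'\<bar>"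
      | "int l \<le> \<bar>i' - i\<bar>" "int l \<le> \<bar>i' - j\<bar>" | "int l \<le> \<bar>j' - i\<bar>" "int l \<le> \<bar>j' - j\<bar>"
      using nn unfolding p q fst_conv snd_conv by (metis abs_minus_commute not_le)
    then show ?thesis
    proof cases
      case 1 then show ?thesis by (rule remainder_degenerate[OF l far(1)])
    next
      case 2 then show ?thesis
        using remainder_degenerate[OF l far(2)] by (simp add: remainder_sym[of l i j])
    next
      case 3 then show ?thesis
        unfolding comm[of i j i' j'] by (rule remainder_degenerate[OF l far(3)])
    next
      case 4 then show ?thesis
        unfolding comm[of i j i' j'] using remainder_degenerate[OF l far(4)] by (simp add: remainder_sym[of l i' j'])
    qed
  qed
  then show "\<bar>expectation (\<lambda>\<omega>. remainder l (fst p) (snd p) \<omega> * remainder l (fst q) (snd q) \<omega>)\<bar>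
       \<le> (if ?nb p q then (remainder_bound l)\<^sup>2 else 0)"
    using remainder_cov_le[OF l, of i j i' j'] by (simp add: p q)
qed simp

lemma weighted_sum_decomposition:
  assumes w: "\<And>k. w (- k) = w k"
  shows "(\<Sum>i=1..int n. \<Sum>j=1..int n. w (i - j) * Yt l i j \<omega>)
     = (\<Sum>i=1..int n. W_at w n i * (2 * proj l (Xt l i \<omega>)))
       + ((\<Sum>i=1..int n. \<Sum>j=1..int n. (if \<bar>i - j\<bar> < int l then w (i - j) else 0) * remainder l i j \<omega>)
       + (\<Sum>p\<in>far_pairs l n. w (fst p - snd p) * remainder l (fst p) (snd p) \<omega>))"
proof -
  let ?N = "{1..int n}" and ?h = "\<lambda>i. proj l (Xt l i \<omega>)"
  have A: "(\<Sum>p\<in>far_pairs l n. w (fst p - snd p) * remainder l (fst p) (snd p) \<omega>)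
      = (\<Sum>i\<in>?N. \<Sum>j\<in>?N. (if \<bar>i - j\<bar> < int l then 0 else w (i - j)) * remainder l i j \<omega>)"
  proof -
    have "(\<Sum>p\<in>far_pairs l n. w (fst p - snd p) * remainder l (fst p) (snd p) \<omega>)
        = (\<Sum>p\<in>?N \<times> ?N. if int l \<le> \<bar>fst p - snd p\<bar> then w (fst p - snd p) * remainder l (fst p) (snd p) \<omega> else 0)"
      unfolding far_pairs_def by (rule sum.inter_filter) simp
    also have "\<dots> = (\<Sum>p\<in>?N \<times> ?N. (if \<bar>fst p - snd p\<bar> < int l then 0 else w (fst p - snd p)) * remainder l (fst p) (snd p) \<omega>)"
      by (intro sum.cong refl) auto
    finally show ?thesis by (simp add: sum.cartesian_product case_prod_beta)
  qed
  have h1: "(\<Sum>i\<in>?N. \<Sum>j\<in>?N. w (i - j) * ?h i) = (\<Sum>i\<in>?N. W_at w n i * ?h i)"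
    by (simp add: W_at_def sum_distrib_right)
  have "(\<Sum>i\<in>?N. \<Sum>j\<in>?N. w (i - j) * ?h j) = (\<Sum>j\<in>?N. \<Sum>i\<in>?N. w (i - j) * ?h j)" by (rule sum.swap)
  also have "\<dots> = (\<Sum>j\<in>?N. \<Sum>i\<in>?N. w (j - i) * ?h j)"
    by (intro sum.cong refl) (metis minus_diff_eq w)
  also have "\<dots> = (\<Sum>j\<in>?N. W_at w n j * ?h j)" by (simp add: W_at_def sum_distrib_right)
  finally have h2: "(\<Sum>i\<in>?N. \<Sum>j\<in>?N. w (i - j) * ?h j) = (\<Sum>j\<in>?N. W_at w n j * ?h j)" .
  have "(\<Sum>i\<in>?N. \<Sum>j\<in>?N. w (i - j) * Yt l i j \<omega>)
    = (\<Sum>i\<in>?N. \<Sum>j\<in>?N. (w (i - j) * ?h i + w (i - j) * ?h j)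
        + ((if \<bar>i - j\<bar> < int l then w (i - j) else 0) * remainder l i j \<omega>
        + (if \<bar>i - j\<bar> < int l then 0 else w (i - j)) * remainder l i j \<omega>))"
    by (intro sum.cong refl) (auto simp: remainder_def algebra_simps)
  also have "\<dots> = ((\<Sum>i\<in>?N. W_at w n i * ?h i) + (\<Sum>i\<in>?N. W_at w n i * ?h i))
       + ((\<Sum>i=1..int n. \<Sum>j=1..int n. (if \<bar>i - j\<bar> < int l then w (i - j) else 0) * remainder l i j \<omega>)
       + (\<Sum>p\<in>far_pairs l n. w (fst p - snd p) * remainder l (fst p) (snd p) \<omega>))"
    unfolding A sum.distrib h1 h2 ..
  also have "(\<Sum>i\<in>?N. W_at w n i * ?h i) + (\<Sum>i\<in>?N. W_at w n i * ?h i) = (\<Sum>i\<in>?N. W_at w n i * (2 * ?h i))"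
    by (simp add: sum.distrib[symmetric] mult.left_commute)
  finally show ?thesis .
qed

end

section \<open>Weights with divergent sum\<close>

lemma W_at_eq_sum: "W_at w n i = (\<Sum>k=i - int n..i - 1. w k)"
  unfolding W_at_def by (rule sum.reindex_bij_witness[where i="\<lambda>k. i - k" and j="\<lambda>k. i - k"]) auto

text \<open>
  Moving \<open>i\<close> by one step shifts the summation range \<open>{i - n..i - 1}\<close> by one.
\<close>

lemma W_at_increment:
  assumes "n > 0"
  shows "W_at w n (i + 1) - W_at w n i = w i - w (i - int n)"
proof -
  have "{i - int n..i - 1} = insert (i - int n) {i - int n + 1..i - 1}"
    and "{i + 1 - int n..i + 1 - 1} = insert i {i - int n + 1..i - 1}"
    using assms by auto
  then show ?thesis unfolding W_at_eq_sum by simp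
qed

lemma sum_abs_weights_le:
  fixes w :: "int \<Rightarrow> real"
  assumes w: "\<And>k. w (- k) = w k" and i: "i \<in> {1..int n}"
  shows "(\<Sum>j=1..int n. \<bar>w (i - j)\<bar>) \<le> 2 * (\<Sum>k=0..int n. \<bar>w k\<bar>)"
proof -
  have "(\<Sum>j=1..int n. \<bar>w (i - j)\<bar>) = (\<Sum>k=i - int n..i - 1. \<bar>w k\<bar>)"
    by (rule sum.reindex_bij_witness[where i="\<lambda>k. i - k" and j="\<lambda>k. i - k"]) auto
  also have "\<dots> \<le> (\<Sum>k\<in>{0..int n} \<union> {-int n..0}. \<bar>w k\<bar>)"
    using i by (intro sum_mono2) auto
  also have "\<dots> \<le> (\<Sum>k=0..int n. \<bar>w k\<bar>) + (\<Sum>k=-int n..0. \<bar>w k\<bar>)"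
    by (subst sum_Un) (auto intro: sum_nonneg)
  also have "(\<Sum>k=-int n..0. \<bar>w k\<bar>) = (\<Sum>k=0..int n. \<bar>w k\<bar>)"
    by (rule sum.reindex_bij_witness[where i="\<lambda>k. - k" and j="\<lambda>k. - k"]) (auto simp: w)
  finally show ?thesis by simp
qed

lemma sum_int_shift_nat: "(\<Sum>i=1..int n. f i) = (\<Sum>k=1..n. f (int k))"
  by (rule sum.reindex_bij_witness[where i=int and j=nat]) auto

text \<open>
  Passing from \<open>n\<close> to \<open>n + 1\<close> adds the diagonal weight and one row and one column, each with squared
  weights at distances \<open>1, ..., n\<close>.
\<close>

lemma sum_pair_weights_le:
  fixes w :: "int \<Rightarrow> real"
  assumes w: "\<And>k. w (- k) = w k"
  shows "(\<Sum>i=1..int n. \<Sum>j=1..int n. (w (i - j))\<^sup>2) \<le> 2 * (\<Sum>k=0..n. real (n - k) * (w (int k))\<^sup>2)"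
proof (induction n)
  case (Suc n)
  let ?N = "{1..int n}" and ?q = "\<lambda>k. (w k)\<^sup>2"
  have ins: "{1..int (Suc n)} = insert (int n + 1) ?N" by auto
  have row: "(\<Sum>j\<in>?N. ?q (int n + 1 - j)) = (\<Sum>k=1..n. ?q (int k))"
  proof -
    have "(\<Sum>j\<in>?N. ?q (int n + 1 - j)) = (\<Sum>k\<in>?N. ?q k)"
      by (rule sum.reindex_bij_witness[where i="\<lambda>k. int n + 1 - k" and j="\<lambda>k. int n + 1 - k"]) auto
    also have "\<dots> = (\<Sum>k=1..n. ?q (int k))" by (rule sum_int_shift_nat)
    finally show ?thesis .
  qed
  have col: "(\<Sum>i\<in>?N. ?q (i - (int n + 1))) = (\<Sum>k=1..n. ?q (int k))"
    unfolding row[symmetric] by (intro sum.cong refl) (metis minus_diff_eq w)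
  have "(\<Sum>i=1..int (Suc n). \<Sum>j=1..int (Suc n). ?q (i - j))
      = ?q 0 + (\<Sum>j\<in>?N. ?q (int n + 1 - j)) + (\<Sum>i\<in>?N. ?q (i - (int n + 1))) + (\<Sum>i\<in>?N. \<Sum>j\<in>?N. ?q (i - j))"
    unfolding ins by (simp add: sum.distrib)
  also have "\<dots> \<le> ?q 0 + 2 * (\<Sum>k=1..n. ?q (int k)) + 2 * (\<Sum>k=0..n. real (n - k) * ?q (int k))"
    using Suc.IH unfolding row col by simp
  also have "\<dots> \<le> 2 * (\<Sum>k=0..n. ?q (int k)) + 2 * (\<Sum>k=0..n. real (n - k) * ?q (int k))"
    by (simp add: sum.atLeast_Suc_atMost)
  also have "\<dots> = 2 * (\<Sum>k=0..n. real (Suc n - k) * ?q (int k))"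
  proof -
    have "(\<Sum>k=0..n. real (Suc n - k) * ?q (int k)) = (\<Sum>k=0..n. ?q (int k) + real (n - k) * ?q (int k))"
      by (intro sum.cong refl) (auto simp: Suc_diff_le algebra_simps)
    then show ?thesis by (simp add: sum.distrib)
  qed
  also have "\<dots> = 2 * (\<Sum>k=0..Suc n. real (Suc n - k) * ?q (int k))" by simp
  finally show ?case .
qed simp

lemma W_at_increment_sum_le:
  fixes w :: "int \<Rightarrow> real"
  assumes w: "\<And>k. w (- k) = w k"
  shows "(\<Sum>i=1..int n - 1. (W_at w n (i + 1) - W_at w n i)\<^sup>2) \<le> 4 * (\<Sum>k=0..n. real (n - k) * (w (int k))\<^sup>2)"
proof (cases "n > 0")
  case True
  let ?q = "\<lambda>k. (w k)\<^sup>2"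
  have "(\<Sum>i=1..int n - 1. (W_at w n (i + 1) - W_at w n i)\<^sup>2) \<le> (\<Sum>i=1..int n - 1. 2 * ?q i + 2 * ?q (i - int n))"
  proof (intro sum_mono)
    fix i
    have "(x - y)\<^sup>2 \<le> 2 * x\<^sup>2 + 2 * y\<^sup>2" for x y :: real
      using zero_le_power2[of "x + y"] by (simp add: power2_eq_square algebra_simps)
    then show "(W_at w n (i + 1) - W_at w n i)\<^sup>2 \<le> 2 * ?q i + 2 * ?q (i - int n)"
      unfolding W_at_increment[OF True] .
  qed
  also have "\<dots> = 2 * (\<Sum>i=1..int n - 1. ?q i) + 2 * (\<Sum>i=1..int n - 1. ?q (i - int n))"
    by (simp add: sum.distrib sum_distrib_left)
  also have "(\<Sum>i=1..int n - 1. ?q (i - int n)) = (\<Sum>i=1..int n - 1. ?q i)"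
  proof (rule sum.reindex_bij_witness[where i="\<lambda>k. int n - k" and j="\<lambda>k. int n - k"])
    show "?q (int n - a) = ?q (a - int n)" for a by (metis minus_diff_eq w)
  qed auto
  also have "(\<Sum>i=1..int n - 1. ?q i) = (\<Sum>k=1..n-1. ?q (int k))"
    using sum_int_shift_nat[of ?q "n - 1"] True by (simp add: of_nat_diff)
  also have "\<dots> \<le> (\<Sum>k=1..n-1. real (n - k) * ?q (int k))"
  proof (intro sum_mono)
    fix k assume "k \<in> {1..n-1}"
    then have "1 \<le> n - k" using True by auto
    then have "1 \<le> real (n - k)" by (simp only: one_of_nat_le_iff)
    then show "?q (int k) \<le> real (n - k) * ?q (int k)" by (metis mult_1 mult_right_mono zero_le_power2)
  qed
  also have "\<dots> \<le> (\<Sum>k=0..n. real (n - k) * ?q (int k))"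
    by (intro sum_mono2) auto
  finally show ?thesis by simp
qed simp

lemma abs_weight_sums_unbounded:
  fixes w :: "int \<Rightarrow> real"
  assumes "\<not> summable (\<lambda>i. \<bar>w (int (Suc i))\<bar>)"
  shows "\<forall>\<^sub>F n in sequentially. (\<Sum>i=0..int n. \<bar>w i\<bar>) > B"
proof -
  obtain N where N: "(\<Sum>k\<le>N. \<bar>w (int (Suc k))\<bar>) > B"
    using bounded_imp_summable[of "\<lambda>i. \<bar>w (int (Suc i))\<bar>" B] assms by (auto simp: not_le[symmetric])
  have "(\<Sum>i=0..int n. \<bar>w i\<bar>) > B" if "n \<ge> Suc N" for n
  proof -
    have "(\<Sum>k\<le>N. \<bar>w (int (Suc k))\<bar>) = (\<Sum>i\<in>(\<lambda>k. int (Suc k)) ` {..N}. \<bar>w i\<bar>)"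
      by (subst sum.reindex) (auto simp: inj_on_def)
    also have "\<dots> \<le> (\<Sum>i=0..int n. \<bar>w i\<bar>)" using that by (intro sum_mono2) auto
    finally show ?thesis using N by simp
  qed
  then show ?thesis by (auto simp: eventually_sequentially)
qed

context kernel_process
begin

lemma weighted_U_stat_sq_integrable: "sq_integrable M (weighted_U_stat M K w (proc F eps) n)"
  unfolding weighted_U_stat_def[abs_def] by (intro sq_integrable_intros Y_sq_integrable)

text \<open>
  The normalisation is \<open>s n = sqrt n * W w n\<close>, and the positive lower limit gives \<open>A n \<le> W w n / c\<close> for
  the sums \<open>A n\<close> of the \<open>\<bar>w i\<bar>\<close>.  The accuracy \<open>e\<close> is spent in equal parts on truncating the past
  (choice of \<open>l\<close>), on the band (\<open>W w n \<longlonglongrightarrow> \<infinity>\<close>), and on the degenerate remainder (choice of \<open>\<eta>\<close>).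
\<close>

theorem divergent_weights_asymp_normal:
  assumes w: "\<And>k. w (- k) = w k" and div: "\<not> summable (\<lambda>i. \<bar>w (int (Suc i))\<bar>)"
    and liminf: "liminf (\<lambda>n. ereal (W w n / (\<Sum>i=0..int n. \<bar>w i\<bar>))) > 0"
    and small: "(\<lambda>n. \<Sum>k=0..n. real (n - k) * (w (int k))\<^sup>2) \<in> o(\<lambda>n. real n * (W w n)\<^sup>2)"
  shows "asymp_normal M (\<lambda>n \<omega>. weighted_U_stat M K w (proc F eps) n \<omega> / sqrt (real n * (W w n)\<^sup>2))"
proof (rule asymp_normal_approx)
  define Q where "Q n = (\<Sum>k=0..n. real (n - k) * (w (int k))\<^sup>2)" for n
  define A where "A n = (\<Sum>i=0..int n. \<bar>w i\<bar>)" for n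
  define s where "s n = sqrt (real n * (W w n)\<^sup>2)" for n
  have A0: "A n \<ge> 0" for n unfolding A_def by (intro sum_nonneg) auto
  have W0: "W w n \<ge> 0" for n by (auto simp: W_def intro!: real_sqrt_ge_zero divide_nonneg_nonneg sum_nonneg)
  have s_eq: "s n = sqrt (real n) * W w n" for n using W0 by (simp add: s_def real_sqrt_mult)
  have s2: "(s n)\<^sup>2 = real n * (W w n)\<^sup>2" for n by (simp add: s_def)
  obtain c where c: "c > 0" "\<forall>\<^sub>F n in sequentially. c < W w n / A n"
  proof -
    obtain c where "0 < ereal c" "ereal c < liminf (\<lambda>n. ereal (W w n / (\<Sum>i=0..int n. \<bar>w i\<bar>)))"
      using ereal_dense2[OF liminf] by blast
    moreover from this(2) have "\<forall>\<^sub>F n in sequentially. ereal c < ereal (W w n / (\<Sum>i=0..int n. \<bar>w i\<bar>))"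
      by (rule less_LiminfD)
    ultimately show thesis using that[of c] by (simp add: A_def)
  qed
  have WA: "\<forall>\<^sub>F n in sequentially. A n \<le> W w n / c"
    using c(2)
  proof eventually_elim
    case (elim n)
    then have "A n > 0" using A0[of n] c(1) by (cases "A n = 0") auto
    then show ?case using elim c(1) by (simp add: field_simps)
  qed
  \<comment> \<open>\<open>W w n\<close> dominates the sums of the \<open>\<bar>w i\<bar>\<close>, which diverge.\<close>
  have W_large: "\<forall>\<^sub>F n in sequentially. B < W w n" for B
    using WA abs_weight_sums_unbounded[OF div, of "B / c"]
    by eventually_elim (use c(1) in \<open>auto simp: A_def field_simps\<close>)
  have good: "\<forall>\<^sub>F n in sequentially. n > 0 \<and> W w n > 0 \<and> A n \<le> W w n / c"
    using WA W_large[of 0] eventually_gt_at_top[of 0] by eventually_elim auto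
  have Q_small: "\<forall>\<^sub>F n in sequentially. Q n \<le> \<eta> * (s n)\<^sup>2" if "\<eta> > 0" for \<eta>
  proof -
    have "\<forall>\<^sub>F n in sequentially. norm (Q n) \<le> \<eta> * norm (real n * (W w n)\<^sup>2)"
      using landau_o.smallD[OF small that] by (simp add: Q_def)
    then show ?thesis by eventually_elim (simp add: s2)
  qed
  have Q0: "Q n \<ge> 0" for n unfolding Q_def by (intro sum_nonneg) auto
  show "sq_integrable M (\<lambda>\<omega>. weighted_U_stat M K w (proc F eps) n \<omega> / sqrt (real n * (W w n)\<^sup>2))" for n
    by (intro sq_integrable_divide weighted_U_stat_sq_integrable)
  fix e :: real assume e: "e > 0"
  define S\<delta> where "S\<delta> = suminf tail_delta"
  obtain l where l: "l \<ge> 1" "sqrt (24 * S\<delta> * tail_delta l) * (2 / c) \<le> e / 3"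
  proof -
    have "(\<lambda>l. sqrt (24 * S\<delta> * tail_delta l) * (2 / c)) \<longlonglongrightarrow> sqrt (24 * S\<delta> * 0) * (2 / c)"
      by (intro tendsto_intros tail_delta_tendsto_0)
    then have "\<forall>\<^sub>F l in sequentially. sqrt (24 * S\<delta> * tail_delta l) * (2 / c) < e / 3"
      by (rule order_tendstoD) (use e in auto)
    from eventually_conj[OF this eventually_ge_at_top[of 1]] obtain l
      where "sqrt (24 * S\<delta> * tail_delta l) * (2 / c) < e / 3 \<and> 1 \<le> l"
      using eventually_happens trivial_limit_sequentially by blast
    then show thesis using that[of l] by simp
  qed
  define T' where "T' n \<omega> = (\<Sum>i=1..int n. W_at w n i * (2 * proj l (Xt l i \<omega>)))" for n \<omega>
  have T'_sq: "sq_integrable M (T' n)" for n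
    unfolding T'_def by (intro sq_integrable_intros proj_Xt_sq_integrable l)
  define C1 where "C1 = sqrt (8 * (real l * (remainder_bound l)\<^sup>2)) * (\<Sum>k=-int l..int l. \<bar>w k\<bar>)"
  define C2 where "C2 = (remainder_bound l)\<^sup>2 * (2 * (2 * real l)\<^sup>2) * 2"
  have C2: "C2 \<ge> 0" by (simp add: C2_def)
  define \<eta> where "\<eta> = (e / 3)\<^sup>2 / (C2 + 1)"
  have \<eta>: "\<eta> > 0" "C2 * \<eta> \<le> (e / 3)\<^sup>2"
  proof -
    show "\<eta> > 0" using e C2 by (simp add: \<eta>_def)
    then have "C2 * \<eta> \<le> (C2 + 1) * \<eta>" by (intro mult_right_mono) auto
    also have "\<dots> = (e / 3)\<^sup>2" using C2 by (simp add: \<eta>_def)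
    finally show "C2 * \<eta> \<le> (e / 3)\<^sup>2" .
  qed
  show "\<exists>T'. (\<forall>n. sq_integrable M (T' n)) \<and> asymp_normal M T' \<and>
       (\<forall>\<^sub>F n in sequentially. L2_norm M (\<lambda>\<omega>. weighted_U_stat M K w (proc F eps) n \<omega> / sqrt (real n * (W w n)\<^sup>2) - T' n \<omega>) \<le> e)"
    unfolding s_def[symmetric]
  proof (intro exI[of _ "\<lambda>n \<omega>. T' n \<omega> / s n"] conjI allI)
    show "sq_integrable M (\<lambda>\<omega>. T' n \<omega> / s n)" for n by (intro sq_integrable_divide T'_sq)
    show "asymp_normal M (\<lambda>n \<omega>. T' n \<omega> / s n)"
    proof -
      define G where "G x = 2 * proj l (window_at l 0 x)" for x
      have G: "G \<in> borel_measurable (PiM UNIV (\<lambda>_. S))"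
        unfolding G_def[abs_def] using measurable_compose[OF window_at_measurable[OF l(1)] proj_measurable[OF l(1)]] by simp
      have GX: "G (shifted i \<omega>) = 2 * proj l (Xt l i \<omega>)" for i \<omega>
        unfolding G_def using proc_trunc_shifted[of l i 0 \<omega>] by simp
      have "asymp_normal M (\<lambda>n \<omega>. \<Sum>i=1..int n. (W_at w n i / s n) * G (shifted i \<omega>))"
      proof (rule m_dependent_clt[OF G, where m = "int l" and B = "2 / c" and s = 1])
        show "(\<lambda>\<omega>. G (shifted i \<omega>)) \<in> borel_measurable (window_algebra {i - int l..i + int l})" for i
          unfolding GX by (intro borel_measurable_times borel_measurable_const measurable_window_mono[OF proj_Xt_window[OF l(1)]]) auto
        show "sq_integrable M (\<lambda>\<omega>. G (shifted 0 \<omega>))"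
          unfolding GX by (intro sq_integrable_cmult proj_Xt_sq_integrable l)
        show "expectation (\<lambda>\<omega>. G (shifted 0 \<omega>)) = 0"
          unfolding GX by (simp add: proj_Xt_mean[OF l(1)])
        show "\<forall>\<^sub>F n in sequentially. \<forall>i\<in>{1..int n}. \<bar>W_at w n i / s n\<bar> \<le> 2 / c / sqrt (real n)"
          using good
        proof eventually_elim
          case (elim n)
          show ?case
          proof
            fix i assume i: "i \<in> {1..int n}"
            have "\<bar>W_at w n i\<bar> \<le> (\<Sum>j=1..int n. \<bar>w (i - j)\<bar>)" unfolding W_at_def by (rule sum_abs)
            also have "\<dots> \<le> 2 * A n" unfolding A_def by (rule sum_abs_weights_le[where w=w, OF w i])
            also have "\<dots> \<le> 2 / c * W w n" using elim by simp
            finally have "\<bar>W_at w n i\<bar> / (sqrt (real n) * W w n) \<le> (2 / c * W w n) / (sqrt (real n) * W w n)"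
              using elim by (intro divide_right_mono) auto
            also have "\<dots> = 2 / c / sqrt (real n)" using elim by simp
            finally show "\<bar>W_at w n i / s n\<bar> \<le> 2 / c / sqrt (real n)"
              using elim by (simp add: s_eq abs_mult)
          qed
        qed
        show "(\<lambda>n. \<Sum>i=1..int n - 1. (W_at w n (i + 1) / s n - W_at w n i / s n)\<^sup>2) \<longlonglongrightarrow> 0"
        proof (rule tendstoI)
          fix \<epsilon> :: real assume \<epsilon>: "\<epsilon> > 0"
          then have "\<epsilon> / 8 > 0" by simp
          from Q_small[OF this] good
          show "\<forall>\<^sub>F n in sequentially. dist (\<Sum>i=1..int n - 1. (W_at w n (i + 1) / s n - W_at w n i / s n)\<^sup>2) 0 < \<epsilon>"
          proof eventually_elim
            case (elim n)
            have s_pos: "(s n)\<^sup>2 > 0" using elim by (simp add: s2)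
            have "(\<Sum>i=1..int n - 1. (W_at w n (i + 1) / s n - W_at w n i / s n)\<^sup>2)
               = (\<Sum>i=1..int n - 1. (W_at w n (i + 1) - W_at w n i)\<^sup>2) / (s n)\<^sup>2"
              by (simp add: diff_divide_distrib[symmetric] power_divide sum_divide_distrib)
            also have "\<dots> \<le> (4 * Q n) / (s n)\<^sup>2"
              using W_at_increment_sum_le[where w=w, OF w, of n] s_pos unfolding Q_def by (intro divide_right_mono) auto
            also have "\<dots> \<le> (4 * (\<epsilon> / 8 * (s n)\<^sup>2)) / (s n)\<^sup>2"
              using elim s_pos by (intro divide_right_mono) auto
            also have "\<dots> < \<epsilon>" using s_pos \<epsilon> by simp
            finally show ?case by (simp add: dist_real_def sum_nonneg)
          qed
        qed
        have "\<forall>\<^sub>F n in sequentially. (1::real) = (\<Sum>i=1..int n. (W_at w n i / s n)\<^sup>2)"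
          using good
        proof eventually_elim
          case (elim n)
          have "(\<Sum>i=1..int n. (W_at w n i)\<^sup>2) / real n \<ge> 0" by (intro divide_nonneg_nonneg sum_nonneg) auto
          then have "(s n)\<^sup>2 = (\<Sum>i=1..int n. (W_at w n i)\<^sup>2)" using elim by (simp add: s2 W_def)
          moreover have "(s n)\<^sup>2 > 0" using elim by (simp add: s2)
          ultimately show ?case by (simp add: power_divide sum_divide_distrib[symmetric])
        qed
        then show "(\<lambda>n. \<Sum>i=1..int n. (W_at w n i / s n)\<^sup>2) \<longlonglongrightarrow> 1"
          by (rule Lim_transform_eventually[OF tendsto_const])
      qed (use c in auto)
      then show ?thesis unfolding GX T'_def by (simp add: sum_divide_distrib)
    qed
    show "\<forall>\<^sub>F n in sequentially. L2_norm M (\<lambda>\<omega>. weighted_U_stat M K w (proc F eps) n \<omega> / s n - T' n \<omega> / s n) \<le> e"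
      using good W_large[of "3 * C1 / e"] Q_small[OF \<eta>(1)]
    proof eventually_elim
      case (elim n)
      let ?U = "\<lambda>\<omega>. \<Sum>i=1..int n. \<Sum>j=1..int n. w (i - j) * (Y i j \<omega> - Yt l i j \<omega>)"
      let ?N = "\<lambda>\<omega>. \<Sum>i=1..int n. \<Sum>j=1..int n. (if \<bar>i - j\<bar> < int l then w (i - j) else 0) * remainder l i j \<omega>"
      let ?F = "\<lambda>\<omega>. \<Sum>p\<in>far_pairs l n. w (fst p - snd p) * remainder l (fst p) (snd p) \<omega>"
      have s_pos: "s n > 0" using elim by (simp add: s_eq)
      have sq: "sq_integrable M ?U" "sq_integrable M ?N" "sq_integrable M ?F"
        by (intro sq_integrable_intros Y_sq_integrable Yt_sq_integrable remainder_sq_integrable l)+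
      have U: "L2_norm M ?U \<le> e / 3 * s n"
      proof -
        have "(L2_norm M ?U)\<^sup>2 \<le> 24 * S\<delta> * tail_delta l * (2 * A n)\<^sup>2 * real n"
          unfolding S\<delta>_def by (rule truncation_error_sum) (use w sum_abs_weights_le[where w=w, OF w] A0 in \<open>auto simp: A_def\<close>)
        then have "L2_norm M ?U \<le> sqrt (24 * S\<delta> * tail_delta l * (2 * A n)\<^sup>2 * real n)" by (rule real_le_rsqrt)
        also have "\<dots> = sqrt (24 * S\<delta> * tail_delta l) * (2 * A n) * sqrt (real n)"
          using A0[of n] by (simp only: real_sqrt_mult real_sqrt_abs)
        also have "\<dots> \<le> sqrt (24 * S\<delta> * tail_delta l) * (2 * (W w n / c)) * sqrt (real n)"
        proof -
          have "S\<delta> \<ge> 0" unfolding S\<delta>_def by (intro suminf_nonneg tail_delta_summable) simp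
          then show ?thesis using elim by (intro mult_right_mono mult_left_mono) auto
        qed
        also have "\<dots> = (sqrt (24 * S\<delta> * tail_delta l) * (2 / c)) * s n" by (simp add: s_eq)
        also have "\<dots> \<le> e / 3 * s n" using l(2) s_pos by (intro mult_right_mono) auto
        finally show ?thesis .
      qed
      have N: "L2_norm M ?N \<le> e / 3 * s n"
      proof -
        have V0: "(\<Sum>k=-int l..int l. \<bar>w k\<bar>) \<ge> 0" by (intro sum_nonneg) auto
        have "L2_norm M ?N \<le> sqrt (8 * (real l * (remainder_bound l)\<^sup>2) * (\<Sum>k=-int l..int l. \<bar>w k\<bar>)\<^sup>2 * real n)"
          by (rule real_le_rsqrt[OF remainder_near_sum[where w=w, OF l(1) w]])
        also have "\<dots> = C1 * sqrt (real n)"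
          using V0 unfolding C1_def by (simp only: real_sqrt_mult real_sqrt_abs abs_of_nonneg)
        also have "\<dots> \<le> (e / 3 * W w n) * sqrt (real n)"
          using elim e by (intro mult_right_mono) (auto simp: field_simps)
        finally show ?thesis by (simp add: s_eq mult_ac)
      qed
      have F: "L2_norm M ?F \<le> e / 3 * s n"
      proof (rule power2_le_imp_le)
        have "(\<Sum>p\<in>far_pairs l n. (w (fst p - snd p))\<^sup>2) \<le> (\<Sum>p\<in>{1..int n} \<times> {1..int n}. (w (fst p - snd p))\<^sup>2)"
          by (intro sum_mono2) (auto simp: far_pairs_def)
        also have "\<dots> = (\<Sum>i=1..int n. \<Sum>j=1..int n. (w (i - j))\<^sup>2)"
          by (simp add: sum.cartesian_product case_prod_beta)
        also have "\<dots> \<le> 2 * Q n" unfolding Q_def by (rule sum_pair_weights_le[where w=w, OF w])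
        finally have far_le: "(\<Sum>p\<in>far_pairs l n. (w (fst p - snd p))\<^sup>2) \<le> 2 * Q n" .
        have "(L2_norm M ?F)\<^sup>2 \<le> (remainder_bound l)\<^sup>2 * (2 * (2 * real l)\<^sup>2) * (\<Sum>p\<in>far_pairs l n. (w (fst p - snd p))\<^sup>2)"
          by (rule remainder_far_sum[OF l(1)])
        also have "\<dots> \<le> (remainder_bound l)\<^sup>2 * (2 * (2 * real l)\<^sup>2) * (2 * Q n)"
          by (intro mult_left_mono far_le) auto
        also have "\<dots> = C2 * Q n" by (simp add: C2_def)
        also have "\<dots> \<le> C2 * (\<eta> * (s n)\<^sup>2)" using elim C2 by (intro mult_left_mono) auto
        also have "\<dots> \<le> (e / 3)\<^sup>2 * (s n)\<^sup>2"
          unfolding mult.assoc[symmetric] by (intro mult_right_mono \<eta>) auto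
        finally show "(L2_norm M ?F)\<^sup>2 \<le> (e / 3 * s n)\<^sup>2" by (simp only: power_mult_distrib)
        show "0 \<le> e / 3 * s n" using e s_pos by simp
      qed
      have eq: "weighted_U_stat M K w (proc F eps) n \<omega> - T' n \<omega> = ?U \<omega> + (?N \<omega> + ?F \<omega>)" for \<omega>
      proof -
        have "weighted_U_stat M K w (proc F eps) n \<omega> = ?U \<omega> + (\<Sum>i=1..int n. \<Sum>j=1..int n. w (i - j) * Yt l i j \<omega>)"
          unfolding weighted_U_stat_def by (simp add: right_diff_distrib sum_subtractf)
        then show ?thesis
          unfolding weighted_sum_decomposition[where w=w and n=n and l=l and \<omega>=\<omega>, OF w] T'_def by simp
      qed
      have "L2_norm M (\<lambda>\<omega>. weighted_U_stat M K w (proc F eps) n \<omega> - T' n \<omega>) \<le> L2_norm M ?U + (L2_norm M ?N + L2_norm M ?F)"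
        unfolding eq using L2_norm_triangle[OF sq(1) sq_integrable_add[OF sq(2,3)]] L2_norm_triangle[OF sq(2,3)] by simp
      also have "\<dots> \<le> e * s n" using U N F by (simp add: field_simps)
      finally have "L2_norm M (\<lambda>\<omega>. weighted_U_stat M K w (proc F eps) n \<omega> - T' n \<omega>) / s n \<le> e"
        using s_pos by (simp add: field_simps)
      then show ?case
        using L2_norm_divide[of M "\<lambda>\<omega>. weighted_U_stat M K w (proc F eps) n \<omega> - T' n \<omega>" "s n"] s_pos
        by (simp add: diff_divide_distrib)
    qed
  qed
qed

end

section \<open>The limit theorem\<close>

theorem theorem6:
  fixes M :: "'a measure" and S :: "'b measure"
    and eps :: "int \<Rightarrow> 'a \<Rightarrow> 'b"
    and F :: "(nat \<Rightarrow> 'b) \<Rightarrow> real" and Fl :: "nat \<Rightarrow> (nat \<Rightarrow> 'b) \<Rightarrow> real"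
    and K :: "real \<Rightarrow> real \<Rightarrow> real" and w :: "int \<Rightarrow> real"
    and \<alpha> r C :: real
  assumes "prob_space M"
    and "iid M S eps"
    and "F \<in> borel_measurable (PiM UNIV (\<lambda>_. S))"
    and "(\<lambda>(x, y). K x y) \<in> borel_measurable (borel \<Otimes>\<^sub>M borel)"
    and "\<And>x y. K x y = K y x"
    and "\<And>i. w (- i) = w i"
    and "\<And>l. l \<ge> 1 \<Longrightarrow> Fl l \<in> borel_measurable (PiM {..<l} (\<lambda>_. S))"
    and "finite_variances M K (proc F eps)"
    and "\<And>l. l \<ge> 1 \<Longrightarrow> finite_variances M K (proc_trunc Fl eps l)"
    and "\<alpha> > 0" and "0 < r" and "r < 1"
    and "\<And>l k. l \<ge> 1 \<Longrightarrow>
           integrable M (\<lambda>\<omega>. \<bar>F (past_seq eps k \<omega>) - Fl l (past_window eps k l \<omega>)\<bar> powr \<alpha>) \<and>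
           (\<integral>\<omega>. \<bar>F (past_seq eps k \<omega>) - Fl l (past_window eps k l \<omega>)\<bar> powr \<alpha> \<partial>M) \<le> C * r ^ l"
    and "(\<Sum>i. SUP l\<in>{i..}. delta M K F Fl eps l) < \<infinity>"
  shows
    "((\<lambda>i. \<bar>w i\<bar>) summable_on UNIV \<longrightarrow>
       (\<exists>\<sigma>2\<ge>0. conv_in_distr M
          (\<lambda>n \<omega>. weighted_U_stat M K w (proc F eps) n \<omega> / sqrt (real n))
          (centred_normal \<sigma>2))) \<and>
     (\<not> summable (\<lambda>i. \<bar>w (int (Suc i))\<bar>) \<and>
      liminf (\<lambda>n. ereal (W w n / (\<Sum>i=0..int n. \<bar>w i\<bar>))) > 0 \<and>
      (\<lambda>n. \<Sum>k=0..n. real (n - k) * (w (int k))\<^sup>2) \<in> o(\<lambda>n. real n * (W w n)\<^sup>2) \<longrightarrow>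
       (\<exists>\<sigma>2\<ge>0. conv_in_distr M
          (\<lambda>n \<omega>. weighted_U_stat M K w (proc F eps) n \<omega> / sqrt (real n * (W w n)\<^sup>2))
          (centred_normal \<sigma>2)))"
proof -
  interpret prob_space M by fact
  interpret kernel_process M S eps F Fl K
    using assms by unfold_locales auto
  show ?thesis
  proof (intro conjI impI)
    assume "(\<lambda>i. \<bar>w i\<bar>) summable_on UNIV"
    then show "\<exists>\<sigma>2\<ge>0. conv_in_distr M
          (\<lambda>n \<omega>. weighted_U_stat M K w (proc F eps) n \<omega> / sqrt (real n)) (centred_normal \<sigma>2)"
      using assms(6) weighted_U_stat_sq_integrable
      by (intro asymp_normal_imp_conv_in_distr summable_weights_asymp_normal borel_measurable_divide) (auto simp: sq_integrable_def)
  next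
    assume "\<not> summable (\<lambda>i. \<bar>w (int (Suc i))\<bar>) \<and>
      liminf (\<lambda>n. ereal (W w n / (\<Sum>i=0..int n. \<bar>w i\<bar>))) > 0 \<and>
      (\<lambda>n. \<Sum>k=0..n. real (n - k) * (w (int k))\<^sup>2) \<in> o(\<lambda>n. real n * (W w n)\<^sup>2)"
    then show "\<exists>\<sigma>2\<ge>0. conv_in_distr M
          (\<lambda>n \<omega>. weighted_U_stat M K w (proc F eps) n \<omega> / sqrt (real n * (W w n)\<^sup>2)) (centred_normal \<sigma>2)"
      using assms(6) weighted_U_stat_sq_integrable
      by (intro asymp_normal_imp_conv_in_distr divergent_weights_asymp_normal borel_measurable_divide) (auto simp: sq_integrable_def)
  qed
qed

end
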